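(* Let $Z$ be the single-type branching process with immigration at the atoms of a point process $\Phi$, and let $Z_\times$ be the corresponding process without immigration (both defined in the context). Write $G_{Z_\times}(t,s)=\mathbb{E}[s^{Z_\times(t)}]$. Let $t\ge 0$ and $s\in[0,1]$. 1. If $\Phi$ is a $(\Lambda,K)$-determinantal point process, then $$\mathbb{E}\left[s^{Z(t)}\right]=1+\sum_{n\ge 1}\frac{(-1)^n}{n!}\int_{(0,t]^n}\det\left(K(x_i,x_j)\right)_{1\le i,j\le n}\prod_{i=1}^n\left(1-G_{Z_\times}(t-x_i,s)\right)\Lambda(\mathrm{d}x_1)\cdots\Lambda(\mathrm{d}x_n).$$ 2. If $\Phi$ is a Cox process with directing measure $\eta$, then $$\mathbb{E}\left[s^{Z(t)}\right]=\mathbb{E}\left[\exp\left(-\int_{(0,t]}\left(1-G_{Z_\times}(t-x,s)\right)\eta(\mathrm{d}x)\right)\right].$$ 3. If $\Phi$ is a $(\beta,\lambda)$-fractional Poisson process, with $\beta\in(0,1]$ and $\lambda>0$, then $$\mathbb{E}\left[s^{Z(t)}\right]=\mathbb{E}\left[\exp\left(-\lambda\int_{(0,t]}\left(1-G_{Z_\times}(t-x,s)\right)\mathrm{d}Y_\beta(x)\right)\right],$$ where $Y_\beta$ is the inverse of a $\beta$-stable subordinator. Moreover, for $s\ge 0$ the Laplace transform $\mathbb{E}[e^{-sZ(t)}]$ is given in each of the three cases by the same right-hand side with $G_{Z_\times}(\cdot,s)$ replaced by $\mathcal{L}_{Z_\times}(\cdot,s)$, where $\mathcal{L}_{Z_\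times}(t,s)=\mathbb{E}[e^{-sZ_\times(t)}]$.
   Context: Notation: $\mathbb{R}_+=[0,\infty)$, $\mathbb{N}_0=\{0,1,2,\dots\}$. A point process is a random measure $\Phi=\sum_{i\le\kappa}\delta_{T_i}$ on $\mathbb{R}_+$ with random number $\kappa$ (possibly infinite) of random atoms $T_i\in\mathbb{R}_+$, repeated according to multiplicity. Process without immigration: $Z_\times=(Z_\times(t))_{t\ge0}$ is a continuous-time Markov branching process with random initial state $Z_\times(0)$ distributed as $I$, an $\mathbb{N}_0$-valued random variable (the size of one immigrant group) with $\mathbb{E}[I]<\infty$. Each particle evolves independently of the others, lives an exponential time with rate $1/\mu$ (mean $\mu>0$), and at death produces a random number of new particles distributed as $\nu$, an $\mathbb{N}_0$-valued random variable with $\mathbb{E}[\nu]<\infty$ that is not a.s. constant. Process with immigration: $Z(t)=\sum_{i:\,T_i\in(0,t]}Z_\times^{(i)}(t-T_i)$, where the $T_i$ are the atoms of $\Phi$ and $Z_\times^{(i)}$ are i.i.d. copies of $Z_\times$, independent of $\Phi$ (in case 2 also of $\eta$). Conventions: $0^0=1$; if the sum is infinite, $s^{\infty}=0$ for $s\in[0,1)$, $1^\infty=1$, and similarly $e^{-s\cdot\infty}=0$ for $s>0$ and $=1$ for $s=0$. Determinantal process: let $\Lambda$ be a locally finite measure on $\mathbb{R}_+$ and $K:\mathbb{R}_+^2\to\mathbb{R}_+$ a symmetric measurable function such that, for every $n$ and $\Lambda^n$-almost all $(x_1,\dots,x_n)$, the matrix $(K(x_i,x_j))_{1\le i,j\le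 n}$ is non-negative definite, and $\int_B K(x,x)\Lambda(\mathrm{d}x)<\infty$ for each bounded Borel $B\subset\mathbb{R}_+$. A point process $\Phi$ is $(\Lambda,K)$-determinantal if its joint intensities with respect to $\Lambda$ are $\rho_n(x_1,\dots,x_n)=\det(K(x_i,x_j))_{1\le i,j\le n}$, i.e. $\mathbb{E}[\prod_{i=1}^n\Phi(B_i)]=\int_{B_1\times\dots\times B_n}\rho_n\,\mathrm{d}\Lambda^n$ for disjoint Borel $B_1,\dots,B_n$. The law of $\Phi$ is the one determined by the Laplace functional $$\mathbb{E}\left[e^{-\int f\,\mathrm{d}\Phi}\right]=1+\sum_{n\ge1}\frac{(-1)^n}{n!}\int_{\mathbb{R}_+^n}\rho_n(x_1,\dots,x_n)\prod_{i=1}^n(1-e^{-f(x_i)})\Lambda(\mathrm{d}x_1)\cdots\Lambda(\mathrm{d}x_n)$$ for non-negative measurable $f$ with compact support. Cox process: given a random $\sigma$-finite measure $\eta$ on $\mathbb{R}_+$, $\Phi$ is a Cox process with directing measure $\eta$ if, conditionally on $\eta$, it is a Poisson process with intensity measure $\eta$. Fractional Poisson process: for $\beta\in(0,1]$, $\lambda>0$, the $(\beta,\lambda)$-fractional Poisson process has atoms at $T_1+\dots+T_n$, $n\ge1$, where here the $T_i$ denote i.i.d. interarrival times with $\mathbb{P}(T_i>t)=E_\beta(-\lambda t^\beta)$, $E_\beta(z)=\sum_{k\ge0}z^k/\Gamma(1+\beta k)$. The inverse of a $\beta$-stable subordinator $D$ (normalized by $\mathbb{E}[e^{-uD(t)}]=e^{-tu^\beta}$,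 $u\ge0$) is $Y_\beta(t)=\inf\{r\ge0: D(r)>t\}$; for $\beta=1$, $Y_1(t)=t$. *)

theory Defs
  imports "HOL-Probability.Probability" "Jordan_Normal_Form.Determinant"
begin

definition pow_enat :: "real \<Rightarrow> enat \<Rightarrow> real" where
  "pow_enat s z = (case z of enat n \<Rightarrow> s ^ n | \<infinity> \<Rightarrow> if s = 1 then 1 else 0)"

text \<open>\<open>exp_enat s z\<close> is \<open>exp (- s z)\<close> for \<open>s \<ge> 0\<close>.\<close>

definition exp_enat :: "real \<Rightarrow> enat \<Rightarrow> real" where
  "exp_enat s z = (case z of enat n \<Rightarrow> exp (- s * real n) | \<infinity> \<Rightarrow> if s = 0 then 1 else 0)"

text \<open>\<open>exp_neg x\<close> is \<open>exp (- x)\<close>, with value 0 at infinity.\<close>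

definition exp_neg :: "ennreal \<Rightarrow> real" where
  "exp_neg x = (if x = \<infinity> then 0 else exp (- enn2real x))"

text \<open>
  Particles are labelled by nonempty lists: \<open>[k]\<close> is the \<open>k\<close>-th initial particle and \<open>k # u\<close>
  the \<open>k\<close>-th child of \<open>u\<close>. The particle with label \<open>u\<close>, if it is ever born, has lifetime
  \<open>fst (x u)\<close> and \<open>snd (x u)\<close> children, born at its death; \<open>m\<close> is the number of initial
  particles.
\<close>

fun ever_born :: "nat \<Rightarrow> (nat list \<Rightarrow> real \<times> nat) \<Rightarrow> nat list \<Rightarrow> bool" where
  "ever_born m x [] \<longleftrightarrow> False"
| "ever_born m x [k] \<longleftrightarrow> k < m"
| "ever_born m x (k # l # u) \<longleftrightarrow> ever_born m x (l # u) \<and> k < snd (x (l # u))"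

fun birth_time :: "(nat list \<Rightarrow> real \<times> nat) \<Rightarrow> nat list \<Rightarrow> real" where
  "birth_time x [] = 0"
| "birth_time x [k] = 0"
| "birth_time x (k # l # u) = birth_time x (l # u) + fst (x (l # u))"

definition alive :: "real \<Rightarrow> nat \<times> (nat list \<Rightarrow> real \<times> nat) \<Rightarrow> nat list set" where
  "alive t = (\<lambda>(m, x). {u. ever_born m x u \<and> birth_time x u \<le> t \<and> t < birth_time x u + fst (x u)})"

definition population :: "real \<Rightarrow> nat \<times> (nat list \<Rightarrow> real \<times> nat) \<Rightarrow> enat" where
  "population t d = (if finite (alive t d) then enat (card (alive t d)) else \<infinity>)"

definition tree_measure :: "real \<Rightarrow> nat pmf \<Rightarrow> nat pmf \<Rightarrow> (nat \<times> (nat list \<Rightarrow> real \<times> nat)) measure" where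
  "tree_measure \<mu> I \<nu> =
     measure_pmf I \<Otimes>\<^sub>M
     PiM UNIV (\<lambda>_. density lborel (exponential_density (1 / \<mu>)) \<Otimes>\<^sub>M measure_pmf \<nu>)"

definition path_space :: "(real \<Rightarrow> enat) measure" where
  "path_space = PiM {0..} (\<lambda>_. count_space UNIV)"

definition branching_law :: "real \<Rightarrow> nat pmf \<Rightarrow> nat pmf \<Rightarrow> (real \<Rightarrow> enat) measure" where
  "branching_law \<mu> I \<nu> =
     distr (tree_measure \<mu> I \<nu>) path_space (\<lambda>d. \<lambda>t\<in>{0..}. population t d)"

definition path :: "(real \<Rightarrow> 'a \<Rightarrow> nat) \<Rightarrow> 'a \<Rightarrow> real \<Rightarrow> enat" where
  "path X \<omega> = (\<lambda>t\<in>{0..}. enat (X t \<omega>))"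

text \<open>
  A process with the law (finite-dimensional distributions) of the population size above and
  with right-continuous paths. The finite-dimensional distributions alone would not determine
  the process at random times. If \<open>I\<close> and \<open>\<nu>\<close> have finite mean, the population size is almost
  surely finite at all times, so taking the processes \<open>nat\<close>-valued is no restriction.
\<close>

definition branching_process ::
  "'a measure \<Rightarrow> real \<Rightarrow> nat pmf \<Rightarrow> nat pmf \<Rightarrow> (real \<Rightarrow> 'a \<Rightarrow> nat) \<Rightarrow> bool" where
  "branching_process M \<mu> I \<nu> X \<longleftrightarrow>
     prob_space M \<and>
     (\<forall>t\<ge>0. X t \<in> M \<rightarrow>\<^sub>M count_space UNIV) \<and>
     (\<forall>\<omega>\<in>space M. \<forall>t\<ge>0. \<forall>\<^sub>F u in at_right t. X u \<omega> = X t \<omega>) \<and>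
     distr M path_space (path X) = branching_law \<mu> I \<nu>"

definition pgf_process :: "'a measure \<Rightarrow> (real \<Rightarrow> 'a \<Rightarrow> nat) \<Rightarrow> real \<Rightarrow> real \<Rightarrow> real" where
  "pgf_process M X t s = (\<integral>\<omega>. s ^ X t \<omega> \<partial>M)"

definition laplace_process :: "'a measure \<Rightarrow> (real \<Rightarrow> 'a \<Rightarrow> nat) \<Rightarrow> real \<Rightarrow> real \<Rightarrow> real" where
  "laplace_process M X t s = (\<integral>\<omega>. exp (- s * real (X t \<omega>)) \<partial>M)"

abbreviation borel_Rplus :: "real measure" where
  "borel_Rplus \<equiv> restrict_space borel {0..}"

text \<open>
  A point process is given by an enumeration of its atoms: \<open>T i\<close> for \<open>i < \<kappa>\<close>; the values
  \<open>T i\<close> for \<open>i \<ge> \<kappa>\<close> are irrelevant.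
\<close>

definition point_process :: "'a measure \<Rightarrow> ('a \<Rightarrow> enat) \<Rightarrow> (nat \<Rightarrow> 'a \<Rightarrow> real) \<Rightarrow> bool" where
  "point_process M \<kappa> T \<longleftrightarrow>
     prob_space M \<and> \<kappa> \<in> M \<rightarrow>\<^sub>M count_space UNIV \<and> (\<forall>i. T i \<in> M \<rightarrow>\<^sub>M borel_Rplus)"

definition atom_measure :: "enat \<Rightarrow> (nat \<Rightarrow> real) \<Rightarrow> real measure" where
  "atom_measure k x = distr (count_space {i. enat i < k}) borel_Rplus x"

definition random_measure :: "('a \<Rightarrow> enat) \<Rightarrow> (nat \<Rightarrow> 'a \<Rightarrow> real) \<Rightarrow> 'a \<Rightarrow> real measure" where
  "random_measure \<kappa> T \<omega> = atom_measure (\<kappa> \<omega>) (\<lambda>i. T i \<omega>)"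

definition atoms_space :: "(enat \<times> (nat \<Rightarrow> real)) measure" where
  "atoms_space = count_space UNIV \<Otimes>\<^sub>M PiM UNIV (\<lambda>_. borel_Rplus)"

definition atoms :: "('a \<Rightarrow> enat) \<Rightarrow> (nat \<Rightarrow> 'a \<Rightarrow> real) \<Rightarrow> 'a \<Rightarrow> enat \<times> (nat \<Rightarrow> real)" where
  "atoms \<kappa> T \<omega> = (\<kappa> \<omega>, \<lambda>i. T i \<omega>)"

definition immigration_process ::
  "('a \<Rightarrow> enat) \<Rightarrow> (nat \<Rightarrow> 'a \<Rightarrow> real) \<Rightarrow> (nat \<Rightarrow> real \<Rightarrow> 'a \<Rightarrow> nat) \<Rightarrow> real \<Rightarrow> 'a \<Rightarrow> enat" where
  "immigration_process \<kappa> T X t \<omega> =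
     (\<Sum>i. if enat i < \<kappa> \<omega> \<and> T i \<omega> \<in> {0<..t} then enat (X i (t - T i \<omega>) \<omega>) else 0)"

text \<open>
  Independence of random variables whose value types may differ (\<open>indep_var\<close> requires equal
  types).
\<close>

definition independent_rvs ::
  "'a measure \<Rightarrow> 'b measure \<Rightarrow> ('a \<Rightarrow> 'b) \<Rightarrow> 'c measure \<Rightarrow> ('a \<Rightarrow> 'c) \<Rightarrow> bool" where
  "independent_rvs M S U R V \<longleftrightarrow>
     U \<in> M \<rightarrow>\<^sub>M S \<and> V \<in> M \<rightarrow>\<^sub>M R \<and>
     prob_space.indep_set M (sets (vimage_algebra (space M) U S)) (sets (vimage_algebra (space M) V R))"

definition paths_space :: "(nat \<Rightarrow> real \<Rightarrow> enat) measure" where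
  "paths_space = PiM UNIV (\<lambda>_. path_space)"

definition paths :: "(nat \<Rightarrow> real \<Rightarrow> 'a \<Rightarrow> nat) \<Rightarrow> 'a \<Rightarrow> nat \<Rightarrow> real \<Rightarrow> enat" where
  "paths X \<omega> = (\<lambda>i. path (X i) \<omega>)"

definition iid_branching_processes ::
  "'a measure \<Rightarrow> real \<Rightarrow> nat pmf \<Rightarrow> nat pmf \<Rightarrow> (nat \<Rightarrow> real \<Rightarrow> 'a \<Rightarrow> nat) \<Rightarrow> bool" where
  "iid_branching_processes M \<mu> I \<nu> X \<longleftrightarrow>
     (\<forall>i. branching_process M \<mu> I \<nu> (X i)) \<and>
     prob_space.indep_vars M (\<lambda>_. path_space) (\<lambda>i. path (X i)) UNIV"

definition kernel_det :: "(real \<Rightarrow> real \<Rightarrow> real) \<Rightarrow> nat \<Rightarrow> (nat \<Rightarrow> real) \<Rightarrow> real" where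
  "kernel_det K n x = Determinant.det (Matrix.mat n n (\<lambda>(i, j). K (x i) (x j)))"

definition det_term ::
  "real measure \<Rightarrow> (real \<Rightarrow> real \<Rightarrow> real) \<Rightarrow> real set \<Rightarrow> (real \<Rightarrow> real) \<Rightarrow> nat \<Rightarrow> real" where
  "det_term \<Lambda> K B h n =
     (-1) ^ n / fact n *
     (LINT x:(PiE {..<n} (\<lambda>_. B))|PiM {..<n} (\<lambda>_. \<Lambda>). kernel_det K n x * (\<Prod>i<n. h (x i)))"

definition det_kernel :: "real measure \<Rightarrow> (real \<Rightarrow> real \<Rightarrow> real) \<Rightarrow> bool" where
  "det_kernel \<Lambda> K \<longleftrightarrow>
     sets \<Lambda> = sets borel_Rplus \<and>
     (\<forall>B\<in>sets \<Lambda>. bounded B \<longrightarrow> emeasure \<Lambda> B < \<infinity>) \<and>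
     (\<lambda>(x, y). K x y) \<in> borel_measurable (borel_Rplus \<Otimes>\<^sub>M borel_Rplus) \<and>
     (\<forall>x\<ge>0. \<forall>y\<ge>0. K x y = K y x \<and> 0 \<le> K x y) \<and>
     (\<forall>n. AE x in PiM {..<n} (\<lambda>_. \<Lambda>). \<forall>v::nat \<Rightarrow> real.
        0 \<le> (\<Sum>i<n. \<Sum>j<n. v i * K (x i) (x j) * v j)) \<and>
     (\<forall>B\<in>sets \<Lambda>. bounded B \<longrightarrow> (\<integral>\<^sup>+x\<in>B. ennreal (K x x) \<partial>\<Lambda>) < \<infinity>)"

text \<open>
  Joint intensities over disjoint sets do not by themselves determine the law (they carry no
  information on multiplicities), so the Laplace functional is part of the definition. Its
  series starts at \<open>n = 1\<close>, hence the index \<open>Suc n\<close>.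
\<close>

definition determinantal_process ::
  "'a measure \<Rightarrow> ('a \<Rightarrow> enat) \<Rightarrow> (nat \<Rightarrow> 'a \<Rightarrow> real) \<Rightarrow> real measure \<Rightarrow> (real \<Rightarrow> real \<Rightarrow> real) \<Rightarrow> bool" where
  "determinantal_process M \<kappa> T \<Lambda> K \<longleftrightarrow>
     det_kernel \<Lambda> K \<and>
     (\<forall>n B. (\<forall>i<n. B i \<in> sets borel_Rplus) \<and> disjoint_family_on B {..<n} \<longrightarrow>
        (\<integral>\<^sup>+\<omega>. (\<Prod>i<n. emeasure (random_measure \<kappa> T \<omega>) (B i)) \<partial>M) =
        (\<integral>\<^sup>+x\<in>PiE {..<n} B. ennreal (kernel_det K n x) \<partial>PiM {..<n} (\<lambda>_. \<Lambda>))) \<and>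
     (\<forall>f. f \<in> borel_measurable borel_Rplus \<and> (\<forall>x\<ge>0. 0 \<le> f x) \<and> (\<exists>r. \<forall>x>r. f x = 0) \<longrightarrow>
        (\<lambda>n. det_term \<Lambda> K {0..} (\<lambda>x. 1 - exp (- f x)) (Suc n)) sums
        ((\<integral>\<omega>. exp_neg (\<integral>\<^sup>+x. ennreal (f x) \<partial>random_measure \<kappa> T \<omega>) \<partial>M) - 1))"

text \<open>The analogue of \<open>subprob_algebra\<close> for arbitrary measures.\<close>

definition measure_algebra :: "'a measure \<Rightarrow> 'a measure measure" where
  "measure_algebra R =
     (SUP A\<in>sets R. vimage_algebra {m. sets m = sets R} (\<lambda>m. emeasure m A) borel)"

definition poisson_prob :: "ennreal \<Rightarrow> nat \<Rightarrow> real" where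
  "poisson_prob a k = (if a = \<infinity> then 0 else exp (- enn2real a) * enn2real a ^ k / fact k)"

text \<open>
  A set of infinite intensity carries infinitely many atoms almost surely, so the conditional
  finite-dimensional distributions of the counts are determined by their finite values.
\<close>

definition cox_process ::
  "'a measure \<Rightarrow> ('a \<Rightarrow> enat) \<Rightarrow> (nat \<Rightarrow> 'a \<Rightarrow> real) \<Rightarrow> ('a \<Rightarrow> real measure) \<Rightarrow> bool" where
  "cox_process M \<kappa> T \<eta> \<longleftrightarrow>
     \<eta> \<in> M \<rightarrow>\<^sub>M measure_algebra borel_Rplus \<and>
     (\<forall>\<omega>\<in>space M. sigma_finite_measure (\<eta> \<omega>)) \<and>
     (\<forall>n B. \<forall>k::nat \<Rightarrow> nat. (\<forall>i<n. B i \<in> sets borel_Rplus) \<and> disjoint_family_on B {..<n} \<longrightarrow>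
        (AE \<omega> in M.
           real_cond_exp M (vimage_algebra (space M) \<eta> (measure_algebra borel_Rplus))
             (indicator {\<omega>\<in>space M. \<forall>i<n. emeasure (random_measure \<kappa> T \<omega>) (B i) = of_nat (k i)}) \<omega> =
           (\<Prod>i<n. poisson_prob (emeasure (\<eta> \<omega>) (B i)) (k i))))"

definition mittag_leffler :: "real \<Rightarrow> real \<Rightarrow> real" where
  "mittag_leffler \<beta> z = (\<Sum>k. z ^ k / Gamma (1 + \<beta> * real k))"

definition fractional_poisson_process ::
  "'a measure \<Rightarrow> ('a \<Rightarrow> enat) \<Rightarrow> (nat \<Rightarrow> 'a \<Rightarrow> real) \<Rightarrow> real \<Rightarrow> real \<Rightarrow> bool" where
  "fractional_poisson_process M \<kappa> T \<beta> rate \<longleftrightarrow>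
     (\<exists>\<tau>::nat \<Rightarrow> 'a \<Rightarrow> real.
        prob_space.indep_vars M (\<lambda>_. borel) \<tau> UNIV \<and>
        (\<forall>n. \<forall>t\<ge>0. measure M {\<omega>\<in>space M. t < \<tau> n \<omega>} = mittag_leffler \<beta> (- rate * t powr \<beta>)) \<and>
        (AE \<omega> in M. random_measure \<kappa> T \<omega> = atom_measure \<infinity> (\<lambda>n. \<Sum>i\<le>n. \<tau> i \<omega>)))"

definition stable_subordinator :: "'a measure \<Rightarrow> real \<Rightarrow> (real \<Rightarrow> 'a \<Rightarrow> real) \<Rightarrow> bool" where
  "stable_subordinator N \<beta> D \<longleftrightarrow>
     prob_space N \<and>
     (\<forall>r\<ge>0. D r \<in> borel_measurable N) \<and>
     (AE \<omega> in N. D 0 \<omega> = 0 \<and> mono_on {0..} (\<lambda>r. D r \<omega>) \<and>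
        (\<forall>r\<ge>0. continuous (at_right r) (\<lambda>q. D q \<omega>))) \<and>
     (\<forall>n. \<forall>r::nat \<Rightarrow> real. 0 \<le> r 0 \<and> mono r \<longrightarrow>
        prob_space.indep_vars N (\<lambda>_. borel) (\<lambda>i \<omega>. D (r (Suc i)) \<omega> - D (r i) \<omega>) {..<n}) \<and>
     (\<forall>r\<ge>0. \<forall>h\<ge>0. distr N borel (\<lambda>\<omega>. D (r + h) \<omega> - D r \<omega>) = distr N borel (D h)) \<and>
     (\<forall>r\<ge>0. \<forall>u\<ge>0. (\<integral>\<omega>. exp (- u * D r \<omega>) \<partial>N) = exp (- r * u powr \<beta>))"

text \<open>
  Almost surely, \<open>D\<close> is unbounded and \<open>t \<mapsto> inverse_subordinator D t \<omega>\<close> is nondecreasing,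
  continuous and zero on the negative half-line, so \<open>interval_measure\<close> yields its
  Lebesgue-Stieltjes measure.
\<close>

definition inverse_subordinator :: "(real \<Rightarrow> 'a \<Rightarrow> real) \<Rightarrow> real \<Rightarrow> 'a \<Rightarrow> real" where
  "inverse_subordinator D t \<omega> = Inf {r. 0 \<le> r \<and> t < D r \<omega>}"

text \<open>
  The outer expectation is a \<open>nn_integral\<close>, which is insensitive to the null set on which
  \<open>Y\<close> need not be a distribution function (or even depend measurably on \<open>\<omega>\<close>).
\<close>

definition stieltjes_expectation ::
  "'a measure \<Rightarrow> real \<Rightarrow> (real \<Rightarrow> 'a \<Rightarrow> real) \<Rightarrow> real \<Rightarrow> (real \<Rightarrow> real) \<Rightarrow> ennreal" where
  "stieltjes_expectation N rate Y t h =
     (\<integral>\<^sup>+\<omega>. ennreal (exp_neg (ennreal rate * (\<integral>\<^sup>+x\<in>{0<..t}. ennreal (h x)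
                \<partial>interval_measure (\<lambda>r. Y r \<omega>)))) \<partial>N)"

end

theory Submission
  imports Defs
begin

text \<open>
  Discretising time from the right makes the population at the random times \<open>t - T\<^sub>i\<close>
  a function of countably many coordinates, so independence turns the generating function of the
  process with immigration into the generating functional of \<open>\<Phi>\<close> at
  \<open>h(x) = G(t - x)\<close> on \<open>(0,t]\<close> and \<open>h = 1\<close> elsewhere.

  Determinantal case: for \<open>a < 1\<close> the Laplace functional applies to
  \<open>- ln (1 - a (1 - h))\<close>, and Hadamard's determinant inequality bounds the coefficients of
  the resulting power series in \<open>a\<close>, so that \<open>a\<close> can tend to 1.

  Cox case: for simple \<open>1 - h\<close> the functional is the joint generating function of the
  counts on the level sets; the general case follows by monotone approximation.

  Fractional Poisson case: a Mittag-Leffler waiting time has the law of the subordinator at an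
  independent exponential time. Hence the generating functional is that of a Poisson process, of
  rate \<open>\<lambda>\<close>, evaluated along \<open>r \<mapsto> h(D(r))\<close>, and the image of Lebesgue
  measure under \<open>D\<close> is the Lebesgue-Stieltjes measure of the inverse.
\<close>

section \<open>Generating functionals of point processes\<close>

text \<open>Boundary values shape the argument. The function \<open>h\<close> may vanish (for
  instance at s = 0), so -ln h must be allowed the value \<infinity>, whereas the Laplace functional
  of a determinantal process speaks of real-valued functions only; this is the reason for the factor
  a < 1. The n-th coefficient is at most C^n / n!, so the power series in a is entire and the
  passage to a = 1 is plain continuity. In the fractional Poisson case no Poisson process is
  constructed: its generating functional arises as the limit of the iterates of a renewal equation.
  Conditioning on the first point in that equation fits the Markov property of the subordinator, so
  the same iterates can be read along the time of D or along its values. The waiting-time law is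
  identified through Laplace transforms; the Mittag-Leffler series is integrated term by term, with
  absolute convergence only for \<lambda> < u powr \<beta>, so uniqueness is proved for transforms
  that agree from some u0 on.\<close>

lemma exp_neg_nonneg [simp]: "0 \<le> exp_neg x"
  by (simp add: exp_neg_def)

lemma exp_neg_le_1 [simp]: "exp_neg x \<le> 1"
  by (simp add: exp_neg_def)

lemma exp_neg_0 [simp]: "exp_neg 0 = 1"
  by (simp add: exp_neg_def)

lemma exp_neg_ennreal: "0 \<le> r \<Longrightarrow> exp_neg (ennreal r) = exp (- r)"
  by (simp add: exp_neg_def)

lemma exp_neg_add: "exp_neg (a + b) = exp_neg a * exp_neg b"
proof (cases a; cases b)
  fix r q assume "0 \<le> r" "0 \<le> q" "a = ennreal r" "b = ennreal q"
  then show ?thesis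
    by (simp add: exp_neg_ennreal exp_add[symmetric] flip: ennreal_plus)
qed (auto simp: exp_neg_def)

lemma exp_neg_sum: "exp_neg (\<Sum>i\<in>A. f i) = (\<Prod>i\<in>A. exp_neg (f i))"
  by (induction A rule: infinite_finite_induct) (auto simp: exp_neg_add)

lemma borel_measurable_exp_neg [measurable]: "exp_neg \<in> borel_measurable borel"
  unfolding exp_neg_def[abs_def] by measurable

text \<open>Large finite values already bring exp (- r) close to the value 0 at \<infinity>, so
  vanishing infinite products need no separate treatment later.\<close>

lemma tendsto_exp_neg:
  assumes "(f \<longlongrightarrow> a) F"
  shows "((\<lambda>x. exp_neg (f x)) \<longlongrightarrow> exp_neg a) F"
proof (cases "a = \<infinity>")
  case False
  then have fin: "\<forall>\<^sub>F x in F. f x < \<infinity>"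
    using order_tendstoD(2)[OF assms, of \<infinity>] by (simp add: less_top)
  have "((\<lambda>x. exp (- enn2real (f x))) \<longlongrightarrow> exp (- enn2real a)) F"
    using False by (intro tendsto_intros tendsto_enn2real[OF _ enn2real_nonneg])
       (simp_all add: assms less_top)
  moreover have "\<forall>\<^sub>F x in F. exp (- enn2real (f x)) = exp_neg (f x)"
    using fin by eventually_elim (simp add: exp_neg_def)
  ultimately show ?thesis
    using False by (simp add: exp_neg_def[of a] Lim_transform_eventually)
next
  case True
  show ?thesis
  proof (rule order_tendstoI)
    fix e :: real assume "exp_neg a < e"
    then have "e > 0" using True by (simp add: exp_neg_def)
    have "\<forall>\<^sub>F x in F. ennreal (max 0 (1 - ln e)) < f x"
      using order_tendstoD(1)[OF assms, of "ennreal (max 0 (1 - ln e))"] True by simp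
    then show "\<forall>\<^sub>F x in F. exp_neg (f x) < e"
    proof eventually_elim
      case (elim x)
      show ?case
      proof (cases "f x = \<infinity>")
        case True
        then show ?thesis using \<open>e > 0\<close> by (simp add: exp_neg_def)
      next
        case False
        then obtain r where r: "f x = ennreal r" "r \<ge> 0" by (cases "f x") auto
        have "max 0 (1 - ln e) < r"
            using elim unfolding r(1) by (rule ennreal_less_iff[THEN iffD1, rotated]) simp
        then have "- r < ln e" by simp
        then have "exp (- r) < exp (ln e)" unfolding exp_less_cancel_iff .
        then have "exp (- r) < e" using \<open>e > 0\<close> by simp
        then show ?thesis using r by (simp add: exp_neg_ennreal)
      qed
    qed
  next
    fix e :: real assume "e < exp_neg a"
    then have "e < 0"
      using True by (simp add: exp_neg_def)
    then show "\<forall>\<^sub>F x in F. e < exp_neg (f x)"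
      by (intro always_eventually allI less_le_trans[OF _ exp_neg_nonneg])
  qed
qed

text \<open>The value \<infinity> at 0 keeps \<open>exp_neg (neg_ln h) = h\<close> valid at h = 0,
  which the real logarithm could not do. A factor 0 in a product over atoms thereby forces an
  infinite sum.\<close>

definition neg_ln :: "real \<Rightarrow> ennreal" where
  "neg_ln h = (if h \<le> 0 then \<infinity> else ennreal (- ln h))"

lemma exp_neg_neg_ln: "0 \<le> h \<Longrightarrow> h \<le> 1 \<Longrightarrow> exp_neg (neg_ln h) = h"
  by (auto simp: neg_ln_def exp_neg_ennreal) (auto simp: exp_neg_def)

lemma neg_ln_1 [simp]: "neg_ln 1 = 0"
  by (simp add: neg_ln_def)

lemma neg_ln_antimono: "h \<le> h' \<Longrightarrow> neg_ln h' \<le> neg_ln h"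
  by (auto simp: neg_ln_def intro!: ennreal_leI)

lemma borel_measurable_neg_ln [measurable]: "neg_ln \<in> borel_measurable borel"
  unfolding neg_ln_def[abs_def] by measurable

text \<open>The terms of a decreasing sequence stay above the limit. Hence for a > 0 only the real
  branch of \<open>neg_ln\<close> occurs; for a \<le> 0 the values grow beyond every bound or reach
  the infinite branch.\<close>

lemma tendsto_neg_ln_decseq:
  assumes h: "decseq h" "h \<longlonglongrightarrow> a"
  shows "(\<lambda>n. neg_ln (h n)) \<longlonglongrightarrow> neg_ln a"
proof (cases "a \<le> 0")
  case False
  then have pos: "h n > 0" for n
    using decseq_ge[OF h, of n] by simp
  have "(\<lambda>n. ennreal (- ln (h n))) \<longlonglongrightarrow> ennreal (- ln a)"
    using False by (intro tendsto_intros h) auto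
  then show ?thesis
    using False pos by (simp add: neg_ln_def not_le[symmetric])
next
  case True
  have "(\<lambda>n. neg_ln (h n)) \<longlonglongrightarrow> \<infinity>"
    unfolding tendsto_PInfty_eq_at_top tendsto_top_iff_ennreal infinity_ennreal_def
  proof (intro allI impI)
    fix l :: real assume "l \<ge> 0"
    have "\<forall>\<^sub>F n in sequentially. h n < exp (- l - 1)"
      using True by (intro order_tendstoD(2)[OF h(2)]) (meson exp_gt_zero le_less_trans)
    then show "\<forall>\<^sub>F n in sequentially. ennreal l < neg_ln (h n)"
    proof eventually_elim
      case (elim n)
      show ?case
      proof (cases "h n \<le> 0")
        case False
        with elim have "ln (h n) < - l - 1"
          by (metis exp_gt_zero ln_exp ln_less_cancel_iff not_le)
        then show ?thesis using False \<open>l \<ge> 0\<close> by (simp add: neg_ln_def ennreal_less_iff)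
      qed (simp add: neg_ln_def)
    qed
  qed
  with True show ?thesis by (simp add: neg_ln_def)
qed

section \<open>Products over the atoms as integrals against the random measure\<close>

lemma nn_integral_atom_measure:
  assumes x: "\<And>i. 0 \<le> x i" and [measurable]: "f \<in> borel_measurable borel_Rplus"
  shows "(\<integral>\<^sup>+y. f y \<partial>atom_measure k x) = (\<Sum>i. if enat i < k then f (x i) else 0)"
proof -
  have "(\<integral>\<^sup>+y. f y \<partial>atom_measure k x) = (\<integral>\<^sup>+i. f (x i) \<partial>count_space {i. enat i < k})"
    unfolding atom_measure_def
    by (subst nn_integral_distr) (auto simp: space_restrict_space x)
  also have "\<dots> = (\<integral>\<^sup>+i. f (x i) * indicator {i. enat i < k} i \<partial>count_space UNIV)"
    by (subst nn_integral_count_space_indicator) auto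
  also have "\<dots> = (\<Sum>i. f (x i) * indicator {i. enat i < k} i)"
    by (rule nn_integral_count_space_nat)
  also have "\<dots> = (\<Sum>i. if enat i < k then f (x i) else 0)"
    by (intro suminf_cong) (auto simp: indicator_def)
  finally show ?thesis .
qed

lemma sets_random_measure [simp, measurable_cong]: "sets (random_measure \<kappa> T w) = sets borel_Rplus"
  by (simp add: random_measure_def atom_measure_def)

text \<open>\<open>exp_neg\<close> turns the partial sums of \<open>neg_ln\<close> into the partial
  products, and increasing sums always converge in \<open>ennreal\<close>; so the infinite product
  exists without any summability condition.\<close>

lemma tendsto_prod_atoms:
  assumes x: "\<And>i. 0 \<le> x i" and [measurable]: "h \<in> borel_measurable borel_Rplus"
    and h: "\<And>y. 0 \<le> y \<Longrightarrow> 0 \<le> h y \<and> h y \<le> 1"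
  shows "(\<lambda>m. \<Prod>i<m. if enat i < k then h (x i) else 1)
    \<longlonglongrightarrow> exp_neg (\<integral>\<^sup>+y. neg_ln (h y) \<partial>atom_measure k x)"
proof -
  have "(\<Prod>i<m. if enat i < k then h (x i) else 1)
      = exp_neg (\<Sum>i<m. if enat i < k then neg_ln (h (x i)) else 0)" for m
    unfolding exp_neg_sum using x h by (intro prod.cong) (auto simp: exp_neg_neg_ln)
  moreover have "(\<lambda>m. \<Sum>i<m. if enat i < k then neg_ln (h (x i)) else 0)
      \<longlonglongrightarrow> (\<integral>\<^sup>+y. neg_ln (h y) \<partial>atom_measure k x)"
    by (subst nn_integral_atom_measure) (auto simp: x intro!: summable_LIMSEQ)
  ultimately show ?thesis
    by (simp add: tendsto_exp_neg)
qed

lemma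
  assumes "point_process M \<kappa> T"
  shows point_process_prob_space: "prob_space M"
    and measurable_point_process_size [measurable]: "\<kappa> \<in> M \<rightarrow>\<^sub>M count_space UNIV"
    and measurable_point_process_atom: "T i \<in> M \<rightarrow>\<^sub>M borel_Rplus"
    and point_process_atom_nonneg: "w \<in> space M \<Longrightarrow> 0 \<le> T i w"
  using assms measurable_space[of "T i" M borel_Rplus w]
  by (auto simp: point_process_def space_restrict_space)

lemma measurable_nn_integral_random_measure:
  assumes pp: "point_process M \<kappa> T" and [measurable]: "f \<in> borel_measurable borel_Rplus"
  shows "(\<lambda>w. \<integral>\<^sup>+x. f x \<partial>random_measure \<kappa> T w) \<in> borel_measurable M"
proof -
  note [measurable] = measurable_point_process_size[OF pp] measurable_point_process_atom[OF pp]
  have "(\<lambda>w. \<Sum>i. if enat i < \<kappa> w then f (T i w) else 0) \<in> borel_measurable M"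
    by measurable
  then show ?thesis
    by (rule measurable_cong[THEN iffD1, rotated])
      (simp add: random_measure_def nn_integral_atom_measure point_process_atom_nonneg[OF pp])
qed

text \<open>The expectation of the product of h over all atoms. As an integral against the random
  measure it does not see the enumeration of the atoms, and this is the form in which the
  determinantal and Cox hypotheses describe the process.\<close>

definition pgfl :: "'a measure \<Rightarrow> ('a \<Rightarrow> enat) \<Rightarrow> (nat \<Rightarrow> 'a \<Rightarrow> real) \<Rightarrow> (real \<Rightarrow> real) \<Rightarrow> real" where
  "pgfl M \<kappa> T h = (\<integral>w. exp_neg (\<integral>\<^sup>+x. neg_ln (h x) \<partial>random_measure \<kappa> T w) \<partial>M)"

lemma (in prob_space) tendsto_expectation_exp_neg:
  assumes [measurable]: "\<And>n. X n \<in> borel_measurable M" "Y \<in> borel_measurable M"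
    and lim: "\<And>w. w \<in> space M \<Longrightarrow> (\<lambda>n. X n w) \<longlonglongrightarrow> Y w"
  shows "(\<lambda>n. \<integral>w. exp_neg (X n w) \<partial>M) \<longlonglongrightarrow> (\<integral>w. exp_neg (Y w) \<partial>M)"
proof (rule integral_dominated_convergence[where w = "\<lambda>_. 1"])
  show "AE w in M. (\<lambda>n. exp_neg (X n w)) \<longlonglongrightarrow> exp_neg (Y w)"
    using lim by (intro AE_I2 tendsto_exp_neg)
qed auto

text \<open>As \<open>neg_ln\<close> is antitone, decreasing functions give increasing integrands:
  monotone convergence applies for each fixed w, and the bound 1 on \<open>exp_neg\<close> gives the
  outer limit.\<close>

lemma tendsto_pgfl:
  assumes pp: "point_process M \<kappa> T"
    and [measurable]: "\<And>n. h n \<in> borel_measurable borel_Rplus" "k \<in> borel_measurable borel_Rplus"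
    and h: "\<And>x. 0 \<le> x \<Longrightarrow> decseq (\<lambda>n. h n x)" "\<And>x. 0 \<le> x \<Longrightarrow> (\<lambda>n. h n x) \<longlonglongrightarrow> k x"
  shows "(\<lambda>n. pgfl M \<kappa> T (h n)) \<longlonglongrightarrow> pgfl M \<kappa> T k"
proof -
  interpret prob_space M
    using pp by (rule point_process_prob_space)
  note [measurable] = measurable_nn_integral_random_measure[OF pp]
  show ?thesis
    unfolding pgfl_def
  proof (rule tendsto_expectation_exp_neg)
    fix w
    let ?R = "random_measure \<kappa> T w"
    have sp: "x \<in> space ?R \<longleftrightarrow> 0 \<le> x" for x
      by (simp add: random_measure_def atom_measure_def space_restrict_space)
    have "neg_ln (k x) = (SUP n. neg_ln (h n x))" if "0 \<le> x" for x
      using h[OF that]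
      by (intro LIMSEQ_unique[OF tendsto_neg_ln_decseq[OF h[OF that]]] LIMSEQ_SUP)
        (auto simp: incseq_def decseq_def neg_ln_antimono)
    then have "(\<integral>\<^sup>+x. neg_ln (k x) \<partial>?R) = (\<integral>\<^sup>+x. (SUP n. neg_ln (h n x)) \<partial>?R)"
      by (intro nn_integral_cong) (simp add: sp)
    also have "\<dots> = (SUP n. \<integral>\<^sup>+x. neg_ln (h n x) \<partial>?R)"
      using h(1) by (intro nn_integral_monotone_convergence_SUP_AE)
        (auto intro!: AE_I2 neg_ln_antimono simp: sp decseq_Suc_iff)
    also have "(\<lambda>n. \<integral>\<^sup>+x. neg_ln (h n x) \<partial>?R) \<longlonglongrightarrow> \<dots>"
      using h(1) by (intro LIMSEQ_SUP incseq_SucI nn_integral_mono neg_ln_antimono)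
        (auto simp: sp decseq_Suc_iff)
    finally show "(\<lambda>n. \<integral>\<^sup>+x. neg_ln (h n x) \<partial>?R) \<longlonglongrightarrow> (\<integral>\<^sup>+x. neg_ln (k x) \<partial>?R)" .
  qed measurable
qed

section \<open>Determinantal processes\<close>

text \<open>One elimination step by a unit upper triangular matrix. If the pivot is 0, the
  assumption makes the whole last column 0, and both sides vanish.\<close>

lemma det_schur_complement:
  fixes a :: "nat \<Rightarrow> nat \<Rightarrow> 'a :: field"
  assumes "a n n \<noteq> 0 \<or> (\<forall>i<n. a i n = 0)"
  shows "Determinant.det (Matrix.mat (Suc n) (Suc n) (\<lambda>(i, j). a i j)) =
    Determinant.det (Matrix.mat n n (\<lambda>(i, j). a i j - a i n * a n j / a n n)) * a n n"
proof -
  define A where "A = Matrix.mat (Suc n) (Suc n) (\<lambda>(i, j). a i j)"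
  \<comment> \<open>The last column of \<open>U\<close> clears the entries above the pivot;
    multiplication by \<open>U\<close> from the left does not touch the last row.\<close>
  define U where "U = Matrix.mat (Suc n) (Suc n)
    (\<lambda>(i, j). if i = j then 1 else if j = n then - a i n / a n n else 0)"
  define C where "C = Matrix.mat n n (\<lambda>(i, j). a i j - a i n * a n j / a n n)"
  define R where "R = Matrix.mat 1 n (\<lambda>(i, j). a n j)"
  have [simp]: "A \<in> carrier_mat (Suc n) (Suc n)" "U \<in> carrier_mat (Suc n) (Suc n)"
    by (auto simp: A_def U_def)
  have [simp]: "C \<in> carrier_mat n n" "R \<in> carrier_mat 1 n"
    by (auto simp: C_def R_def)
  have "upper_triangular U"
    by (auto simp: upper_triangular_def U_def)
  moreover have "diag_mat U = replicate (Suc n) 1"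
    by (auto simp: diag_mat_def U_def intro!: nth_equalityI simp del: upt_Suc replicate_Suc)
  ultimately have "Determinant.det U = 1"
    by (subst det_upper_triangular[where n = "Suc n"]) auto
  have "U * A = four_block_mat C (0\<^sub>m n 1) R (Matrix.mat 1 1 (\<lambda>_. a n n))"
  proof (rule eq_matI)
    fix i j
    assume "i < dim_row (four_block_mat C (0\<^sub>m n 1) R (Matrix.mat 1 1 (\<lambda>_. a n n)))"
      and "j < dim_col (four_block_mat C (0\<^sub>m n 1) R (Matrix.mat 1 1 (\<lambda>_. a n n)))"
    then have ij: "i < Suc n" "j < Suc n" by (auto simp: C_def)
    have "(U * A) $$ (i, j) = (\<Sum>k<Suc n. U $$ (i, k) * A $$ (k, j))"
      using ij by (simp add: times_mat_def scalar_prod_def A_def U_def atLeast0LessThan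
          del: sum.lessThan_Suc)
    also have "\<dots> = (\<Sum>k<n. (if k = i then a i j else 0)) + U $$ (i, n) * a n j"
      using ij unfolding sum.lessThan_Suc
      by (intro arg_cong2[where f = "(+)"] sum.cong) (auto simp: A_def U_def)
    also have "\<dots> = (if i < n then a i j - a i n * a n j / a n n else a n j)"
      using ij by (auto simp: U_def sum.delta)
    also have "\<dots> = four_block_mat C (0\<^sub>m n 1) R (Matrix.mat 1 1 (\<lambda>_. a n n)) $$ (i, j)"
    \<comment> \<open>This is the entry that the elimination makes 0, namely a i n - a i n * a n n /
      a n n; for a n n = 0 the assumption gives a i n = 0.\<close>
    proof (cases "i < n \<and> j = n")
      case True
      then show ?thesis using assms ij
        by (auto simp: four_block_mat_def C_def R_def Let_def)
    next
      case False
      then show ?thesis using ij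
        by (auto simp: four_block_mat_def C_def R_def Let_def less_Suc_eq)
    qed
    finally show "(U * A) $$ (i, j) = \<dots>" .
  qed (auto simp: U_def A_def C_def R_def)
  then have "Determinant.det (U * A) = Determinant.det C * a n n"
    by (simp only:) (subst det_four_block_mat_upper_right_zero[where n = n and m = 1], auto simp: det_single simp del: One_nat_def)
  with \<open>Determinant.det U = 1\<close> show ?thesis
    by (simp add: det_mult[of _ "Suc n"] A_def[symmetric] C_def[symmetric])
qed

text \<open>Induction through the Schur complement of the last diagonal entry: it is again positive
  semidefinite, and its diagonal is dominated by the original one because multiples of squares are
  subtracted.\<close>

lemma Hadamard_det_bound:
  fixes a :: "nat \<Rightarrow> nat \<Rightarrow> real"
  assumes "\<And>i j. i < n \<Longrightarrow> j < n \<Longrightarrow> a i j = a j i"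
    and "\<And>v. 0 \<le> (\<Sum>i<n. \<Sum>j<n. v i * a i j * v j)"
  shows "0 \<le> Determinant.det (Matrix.mat n n (\<lambda>(i, j). a i j)) \<and>
    Determinant.det (Matrix.mat n n (\<lambda>(i, j). a i j)) \<le> (\<Prod>i<n. a i i)"
  using assms
proof (induction n arbitrary: a)
  case 0
  then show ?case by simp
next
  case (Suc n)
  define s where "s v = (\<Sum>i<n. v i * a i n)" for v
  \<comment> \<open>The quadratic form as a polynomial of degree two in the last coordinate.\<close>
  have split: "(\<Sum>i<Suc n. \<Sum>j<Suc n. v i * a i j * v j) =
      (\<Sum>i<n. \<Sum>j<n. v i * a i j * v j) + 2 * v n * s v + (v n)\<^sup>2 * a n n" for v
  proof -
    have "(\<Sum>j<n. v n * a n j * v j) = v n * s v"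
      using Suc.prems(1)[of n] by (auto simp: s_def sum_distrib_left intro!: sum.cong)
    moreover have "(\<Sum>i<n. v i * a i n * v n) = v n * s v"
      by (auto simp: s_def sum_distrib_left intro!: sum.cong)
    ultimately show ?thesis
      by (simp add: sum.distrib power2_eq_square algebra_simps)
  qed
  have diag: "0 \<le> a i i" if "i < Suc n" for i
  proof -
    have "(\<Sum>i'<Suc n. \<Sum>j<Suc n. (if i' = i then 1 else 0) * a i' j * (if j = i then 1 else 0)) = a i i"
      using that by (simp add: if_distrib[of "\<lambda>x. x * _"] if_distrib[of "\<lambda>x. _ * x"] sum.delta
          cong: if_cong del: sum.lessThan_Suc)
    with Suc.prems(2)[of "\<lambda>j. if j = i then 1 else 0"] show ?thesis by simp
  qed
  have zero: "a i n = 0" if "a n n = 0" "i < n" for i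
  proof (rule ccontr)
    assume nz: "a i n \<noteq> 0"
    \<comment> \<open>As a n n = 0, the form at e_i plus a multiple of e_n is affine in that
      multiple, which is chosen so that the value would be -1.\<close>
    define v where "v j = (if j = i then 1 else if j = n then - (a i i + 1) / (2 * a i n) else 0)" for j
    have "s v = (\<Sum>j<n. if j = i then a i n else 0)"
      unfolding s_def by (intro sum.cong) (auto simp: v_def)
    then have "s v = a i n" using that by simp
    moreover have "(\<Sum>i'<n. \<Sum>j<n. v i' * a i' j * v j) = (\<Sum>i'<n. \<Sum>j<n. if j = i then (if i' = i then a i i else 0) else 0)"
      by (intro sum.cong) (auto simp: v_def)
    then have "(\<Sum>i'<n. \<Sum>j<n. v i' * a i' j * v j) = a i i"
      using that by simp
    ultimately have "0 \<le> a i i + 2 * v n * a i n"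
      using Suc.prems(2)[of v] split[of v] that by simp
    moreover have "v n = - (a i i + 1) / (2 * a i n)"
      using that by (simp add: v_def)
    ultimately show False
      using nz by (simp add: field_simps)
  qed
  define c where "c i j = a i j - a i n * a n j / a n n" for i j
  have IH: "0 \<le> Determinant.det (Matrix.mat n n (\<lambda>(i, j). c i j)) \<and>
      Determinant.det (Matrix.mat n n (\<lambda>(i, j). c i j)) \<le> (\<Prod>i<n. c i i)"
  proof (rule Suc.IH)
    show "c i j = c j i" if "i < n" "j < n" for i j
      using that Suc.prems(1)[of i j] Suc.prems(1)[of i n] Suc.prems(1)[of j n] by (simp add: c_def)
    fix v :: "nat \<Rightarrow> real"
    \<comment> \<open>Completing the square: with this last coordinate the form becomes that of the
      Schur complement. For a n n = 0, division by zero gives w n = 0, which is right as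
      well.\<close>
    define w where "w = v(n := - s v / a n n)"
    have [simp]: "s w = s v" "w n = - s v / a n n"
      by (auto simp: s_def w_def)
    have "0 \<le> (\<Sum>i<n. \<Sum>j<n. v i * a i j * v j) + 2 * w n * s v + (w n)\<^sup>2 * a n n"
    proof -
      have "(\<Sum>i<n. \<Sum>j<n. w i * a i j * w j) = (\<Sum>i<n. \<Sum>j<n. v i * a i j * v j)"
        by (intro sum.cong) (auto simp: w_def)
      with Suc.prems(2)[of w] split[of w] show ?thesis by simp
    qed
    also have "\<dots> = (\<Sum>i<n. \<Sum>j<n. v i * a i j * v j) - s v * s v / a n n"
      by (simp add: power2_eq_square field_simps)
    also have "s v * s v / a n n = (\<Sum>i<n. \<Sum>j<n. v i * (a i n * a n j / a n n) * v j)"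
      unfolding s_def sum_product sum_divide_distrib using Suc.prems(1)
      by (intro sum.cong) auto
    finally show "0 \<le> (\<Sum>i<n. \<Sum>j<n. v i * c i j * v j)"
      by (simp add: c_def algebra_simps sum_subtractf)
  qed
  have det: "Determinant.det (Matrix.mat (Suc n) (Suc n) (\<lambda>(i, j). a i j)) =
      Determinant.det (Matrix.mat n n (\<lambda>(i, j). c i j)) * a n n"
    unfolding c_def using zero by (intro det_schur_complement) auto
  have "(\<Prod>i<n. c i i) \<le> (\<Prod>i<n. a i i)" if "a n n \<noteq> 0"
  proof (intro prod_mono conjI)
    fix i assume i: "i \<in> {..<n}"
    show "c i i \<le> a i i"
      using diag[of n] Suc.prems(1)[of i n] i by (auto simp: c_def)
    \<comment> \<open>The unit vector e_i, with the last coordinate again taken from completing the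
      square; the form then has the value \<open>c i i\<close>.\<close>
    define v where "v j = (if j = i then 1 else if j = n then - a i n / a n n else 0)" for j
    have "s v = (\<Sum>j<n. if j = i then a i n else 0)"
      unfolding s_def by (intro sum.cong) (auto simp: v_def)
    then have "s v = a i n" using i by simp
    moreover have "(\<Sum>i'<n. \<Sum>j<n. v i' * a i' j * v j) = (\<Sum>i'<n. \<Sum>j<n. if j = i then (if i' = i then a i i else 0) else 0)"
      by (intro sum.cong) (auto simp: v_def)
    then have "(\<Sum>i'<n. \<Sum>j<n. v i' * a i' j * v j) = a i i"
      using i by simp
    ultimately have "0 \<le> a i i + 2 * v n * a i n + (v n)\<^sup>2 * a n n"
      using Suc.prems(2)[of v] split[of v] by simp
    moreover have "v n = - a i n / a n n"
      using i by (simp add: v_def)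
    ultimately show "0 \<le> c i i"
      using that Suc.prems(1)[of i n] i by (simp add: c_def power2_eq_square)
  qed
  then show ?case
    unfolding det prod.lessThan_Suc using IH diag[of n]
    by (cases "a n n = 0") (auto intro!: mult_right_mono)
qed

section \<open>The determinantal series\<close>

text \<open>If f is not integrable, its Bochner integral is 0 by default, so the bound
  persists.\<close>

lemma norm_integral_le_nn_integral:
  fixes f :: "'a \<Rightarrow> 'b :: {banach, second_countable_topology}"
  shows "ennreal (norm (\<integral>x. f x \<partial>M)) \<le> (\<integral>\<^sup>+x. ennreal (norm (f x)) \<partial>M)"
  using integral_norm_bound_ennreal[of M f] by (cases "integrable M f") (auto simp: not_integrable_integral_eq)

lemma sigma_finite_det_kernel:
  assumes "det_kernel \<Lambda> K"
  shows "sigma_finite_measure \<Lambda>"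
proof
  have sp: "space \<Lambda> = {0..}"
    using assms sets_eq_imp_space_eq[of \<Lambda> borel_Rplus] by (auto simp: det_kernel_def space_restrict_space)
  have sets: "{0..real n} \<in> sets \<Lambda>" for n
    using assms by (auto simp: det_kernel_def sets_restrict_space intro!: image_eqI[of _ _ "{0..real n}"])
  show "\<exists>A. countable A \<and> A \<subseteq> sets \<Lambda> \<and> \<Union> A = space \<Lambda> \<and> (\<forall>a\<in>A. emeasure \<Lambda> a \<noteq> \<infinity>)"
  proof (intro exI conjI)
    show "range (\<lambda>n. {0..real n}) \<subseteq> sets \<Lambda>" using sets by auto
    show "\<Union> (range (\<lambda>n. {0..real n})) = space \<Lambda>" unfolding sp by (auto intro: real_arch_simple)
    show "\<forall>a\<in>range (\<lambda>n. {0..real n}). emeasure \<Lambda> a \<noteq> \<infinity>"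
      using assms sets by (auto simp: det_kernel_def less_top)
  qed auto
qed

lemma kernel_det_bound:
  assumes K: "det_kernel \<Lambda> K"
  shows "AE x in PiM {..<n} (\<lambda>_. \<Lambda>). 0 \<le> kernel_det K n x \<and> kernel_det K n x \<le> (\<Prod>i<n. K (x i) (x i))"
proof -
  have sp: "space \<Lambda> = {0..}"
    using K sets_eq_imp_space_eq[of \<Lambda> borel_Rplus] by (auto simp: det_kernel_def space_restrict_space)
  have "AE x in PiM {..<n} (\<lambda>_. \<Lambda>). \<forall>v::nat \<Rightarrow> real. 0 \<le> (\<Sum>i<n. \<Sum>j<n. v i * K (x i) (x j) * v j)"
    using K by (simp add: det_kernel_def)
  then show ?thesis
  proof (rule AE_mp, intro AE_I2 impI)
    fix x assume x: "x \<in> space (PiM {..<n} (\<lambda>_. \<Lambda>))"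
      and pos: "\<forall>v::nat \<Rightarrow> real. 0 \<le> (\<Sum>i<n. \<Sum>j<n. v i * K (x i) (x j) * v j)"
    have "K (x i) (x j) = K (x j) (x i)" if "i < n" "j < n" for i j
      using x that K by (auto simp: space_PiM sp PiE_iff det_kernel_def)
    with pos show "0 \<le> kernel_det K n x \<and> kernel_det K n x \<le> (\<Prod>i<n. K (x i) (x i))"
      unfolding kernel_det_def by (intro Hadamard_det_bound) auto
  qed
qed

text \<open>Hadamard's inequality replaces the determinant by a product with separated variables, so
  the n-fold integral is at most C^n, where C is the integral of the diagonal of K over B.\<close>

lemma det_term_bound:
  assumes K: "det_kernel \<Lambda> K" and B: "B \<in> sets \<Lambda>"
    and C: "(\<integral>\<^sup>+x\<in>B. ennreal (K x x) \<partial>\<Lambda>) = ennreal C" "0 \<le> C"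
    and h: "\<And>x. x \<in> B \<Longrightarrow> \<bar>h x\<bar> \<le> 1"
  shows "\<bar>det_term \<Lambda> K B h n\<bar> \<le> C ^ n / fact n"
proof -
  interpret sigma_finite_measure \<Lambda>
    using K by (rule sigma_finite_det_kernel)
  interpret product_sigma_finite "\<lambda>_::nat. \<Lambda>" ..
  have sets: "sets \<Lambda> = sets borel_Rplus"
    using K by (simp add: det_kernel_def)
  note [measurable_cong] = sets
  have [measurable]: "B \<in> sets \<Lambda>" by fact
  have [measurable]: "(\<lambda>x. K x x) \<in> borel_measurable \<Lambda>"
  proof -
    have "(\<lambda>(x, y). K x y) \<in> borel_measurable (\<Lambda> \<Otimes>\<^sub>M \<Lambda>)"
      using K unfolding det_kernel_def by (simp cong: measurable_cong_sets add: sets_pair_measure_cong[OF sets sets])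
    from measurable_compose[OF _ this, of "\<lambda>x. (x, x)" \<Lambda>] show ?thesis by simp
  qed
  let ?P = "PiM {..<n} (\<lambda>_. \<Lambda>)"
  let ?f = "\<lambda>x. indicator (PiE {..<n} (\<lambda>_. B)) x *\<^sub>R (kernel_det K n x * (\<Prod>i<n. h (x i)))"
  have "AE x in ?P. ennreal (norm (?f x)) \<le> (\<Prod>i<n. ennreal (K (x i) (x i)) * indicator B (x i))"
    using kernel_det_bound[OF K, of n]
  proof eventually_elim
    case (elim x)
    show ?case
    proof (cases "x \<in> PiE {..<n} (\<lambda>_. B)")
      case True
      then have xB: "x i \<in> B" if "i < n" for i using that by auto
      have K0: "0 \<le> K (x i) (x i)" if "i < n" for i
        using xB[OF that] K sets.sets_into_space[OF B] sets_eq_imp_space_eq[OF sets]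
        by (auto simp: det_kernel_def space_restrict_space)
      have "norm (?f x) = kernel_det K n x * (\<Prod>i<n. \<bar>h (x i)\<bar>)"
        using True elim by (simp add: abs_mult abs_prod)
      also have "\<dots> \<le> (\<Prod>i<n. K (x i) (x i)) * 1"
        using elim h xB by (intro mult_mono prod_le_1) (auto intro!: prod_nonneg)
      finally have "ennreal (norm (?f x)) \<le> ennreal (\<Prod>i<n. K (x i) (x i))"
        by (intro ennreal_leI) simp
      also have "\<dots> = (\<Prod>i<n. ennreal (K (x i) (x i)))"
        using K0 by (subst prod_ennreal) auto
      also have "\<dots> = (\<Prod>i<n. ennreal (K (x i) (x i)) * indicator B (x i))"
        using xB by (intro prod.cong) auto
      finally show ?thesis .
    qed simp
  qed
  then have "(\<integral>\<^sup>+x. ennreal (norm (?f x)) \<partial>?P) \<le> (\<integral>\<^sup>+x. (\<Prod>i<n. ennreal (K (x i) (x i)) * indicator B (x i)) \<partial>?P)"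
    by (rule nn_integral_mono_AE)
  also have "\<dots> = (\<Prod>i<n. \<integral>\<^sup>+x. ennreal (K x x) * indicator B x \<partial>\<Lambda>)"
    by (intro product_nn_integral_prod) auto
  also have "\<dots> = ennreal (C ^ n)"
    using C by (simp add: ennreal_power)
  finally have "ennreal (norm (\<integral>x. ?f x \<partial>?P)) \<le> ennreal (C ^ n)"
    by (rule order_trans[OF norm_integral_le_nn_integral])
  then have "\<bar>\<integral>x. ?f x \<partial>?P\<bar> \<le> C ^ n"
    using C by (subst (asm) ennreal_le_iff) auto
  then show ?thesis
    unfolding det_term_def set_lebesgue_integral_def
    by (simp add: abs_mult power_abs divide_simps)
qed

lemma det_term_cong:
  assumes "\<And>x. x \<in> B \<Longrightarrow> h x = k x"
  shows "det_term \<Lambda> K B h n = det_term \<Lambda> K B k n"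
  unfolding det_term_def set_lebesgue_integral_def
  by (intro arg_cong2[where f = "(*)"] Bochner_Integration.integral_cong refl)
    (auto simp: indicator_def assms PiE_iff intro!: prod.cong)

text \<open>Homogeneity of degree n is what turns the series for a * h into a power series in
  a.\<close>

lemma det_term_scale:
  "det_term \<Lambda> K B (\<lambda>x. a * h x) n = a ^ n * det_term \<Lambda> K B h n"
proof -
  have "(\<lambda>x. indicator (PiE {..<n} (\<lambda>_. B)) x *\<^sub>R (kernel_det K n x * (\<Prod>i<n. a * h (x i)))) =
      (\<lambda>x. a ^ n * (indicator (PiE {..<n} (\<lambda>_. B)) x *\<^sub>R (kernel_det K n x * (\<Prod>i<n. h (x i)))))"
    by (simp add: fun_eq_iff prod.distrib)
  then show ?thesis
    unfolding det_term_def set_lebesgue_integral_def by simp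
qed

text \<open>Reconciles the Laplace functional, which integrates over the whole half-line, with
  integrals over (0,t].\<close>

lemma det_term_support:
  assumes "sets \<Lambda> = sets borel_Rplus" and "B \<subseteq> {0..}" and "\<And>x. x \<notin> B \<Longrightarrow> h x = 0"
  shows "det_term \<Lambda> K {0..} h n = det_term \<Lambda> K B h n"
proof -
  have sp: "space \<Lambda> = {0..}"
    using sets_eq_imp_space_eq[OF assms(1)] by (auto simp: space_restrict_space)
  have "indicator (PiE {..<n} (\<lambda>_. {0..})) x *\<^sub>R (kernel_det K n x * (\<Prod>i<n. h (x i))) =
      indicator (PiE {..<n} (\<lambda>_. B)) x *\<^sub>R (kernel_det K n x * (\<Prod>i<n. h (x i)))"
    if "x \<in> space (PiM {..<n} (\<lambda>_. \<Lambda>))" for x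
  proof (cases "\<forall>i<n. x i \<in> B")
    case True
    then show ?thesis using that assms(2) by (auto simp: indicator_def space_PiM PiE_iff)
  next
    case False
    then have "(\<Prod>i<n. h (x i)) = 0" using assms(3) by (auto intro!: prod_zero)
    then show ?thesis by simp
  qed
  then show ?thesis
    unfolding det_term_def set_lebesgue_integral_def
    by (intro arg_cong2[where f = "(*)"] Bochner_Integration.integral_cong refl)
qed

lemma pgfl_determinantal_process:
  assumes pp: "point_process M \<kappa> T" and D: "determinantal_process M \<kappa> T \<Lambda> K"
    and [measurable]: "h \<in> borel_measurable borel_Rplus"
    and h: "\<And>x. 0 \<le> h x \<and> h x \<le> 1" "\<And>x. x \<notin> {0<..t} \<Longrightarrow> h x = 1"
  shows "summable (\<lambda>n. det_term \<Lambda> K {0<..t} (\<lambda>x. 1 - h x) (Suc n))"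
    and "pgfl M \<kappa> T h = 1 + (\<Sum>n. det_term \<Lambda> K {0<..t} (\<lambda>x. 1 - h x) (Suc n))"
proof -
  have K: "det_kernel \<Lambda> K" and sets: "sets \<Lambda> = sets borel_Rplus"
    using D by (auto simp: determinantal_process_def det_kernel_def)
  have B: "{0<..t} \<in> sets \<Lambda>"
    unfolding sets sets_restrict_space by (auto intro!: image_eqI[of _ _ "{0<..t}"])
  then have "(\<integral>\<^sup>+x\<in>{0<..t}. ennreal (K x x) \<partial>\<Lambda>) < \<infinity>"
    using K by (simp add: det_kernel_def)
  then obtain C where C: "(\<integral>\<^sup>+x\<in>{0<..t}. ennreal (K x x) \<partial>\<Lambda>) = ennreal C" "0 \<le> C"
    by (cases "\<integral>\<^sup>+x\<in>{0<..t}. ennreal (K x x) \<partial>\<Lambda>") auto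
  define c where "c n = det_term \<Lambda> K {0<..t} (\<lambda>x. 1 - h x) n" for n
  have bound: "\<bar>c n\<bar> \<le> C ^ n / fact n" for n
    unfolding c_def using h(1) by (intro det_term_bound[OF K B C]) (auto simp: abs_le_iff)
  \<comment> \<open>The factorial in the bound gives convergence for every y, so that 1 is an
    interior point of the domain of convergence.\<close>
  have summ: "summable (\<lambda>n. c n * y ^ n)" for y
  proof (rule summable_comparison_test', rule summable_exp)
    show "norm (c n * y ^ n) \<le> inverse (fact n) * (C * \<bar>y\<bar>) ^ n" for n
      using mult_right_mono[OF bound[of n], of "\<bar>y\<bar> ^ n"]
      by (simp add: abs_mult power_abs power_mult_distrib field_simps)
  qed
  from summ[of 1] have summ1: "summable c" by simp
  then show "summable (\<lambda>n. det_term \<Lambda> K {0<..t} (\<lambda>x. 1 - h x) (Suc n))"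
    unfolding c_def[symmetric] by (subst summable_Suc_iff)
  \<comment> \<open>The empty determinant and the empty product are 1, so the leading 1 of the
    expansion is the term of index 0.\<close>
  have c0: "c 0 = 1"
    unfolding c_def det_term_def kernel_det_def by (simp add: set_lebesgue_integral_def PiM_empty)
  \<comment> \<open>A sequence increasing to 1 from below; a n < 1 keeps 1 - a n * (1 - h x)
    positive even where h x = 0, so that its logarithm is real.\<close>
  define a where "a n = 1 - 1 / real (n + 2)" for n
  have a: "0 \<le> a n" "a n < 1" for n
    by (auto simp: a_def field_simps)
  have lim_a: "a \<longlonglongrightarrow> 1"
    unfolding a_def
    using tendsto_diff[OF tendsto_const LIMSEQ_ignore_initial_segment[OF lim_1_over_n, of 2], of "1 :: real"]
    by simp
  have "incseq a"
    unfolding a_def by (auto simp: incseq_def field_simps)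
  have ag: "a n * (1 - h x) < 1" for n x
    using a[of n] h(1)[of x] mult_left_le[of "1 - h x" "a n"] by linarith
  have "pgfl M \<kappa> T (\<lambda>x. 1 - a n * (1 - h x)) = (\<Sum>k. c k * a n ^ k)" for n
  proof -
    let ?f = "\<lambda>x. - ln (1 - a n * (1 - h x))"
    have "?f \<in> borel_measurable borel_Rplus" by measurable
    moreover have "0 \<le> ?f x" for x
      using a[of n] h(1)[of x] ag[of n x] by simp
    moreover have "?f x = 0" if "x > t" for x
      using that h(2)[of x] by simp
    ultimately have "(\<lambda>k. det_term \<Lambda> K {0..} (\<lambda>x. 1 - exp (- ?f x)) (Suc k)) sums
        ((\<integral>w. exp_neg (\<integral>\<^sup>+x. ennreal (?f x) \<partial>random_measure \<kappa> T w) \<partial>M) - 1)"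
      using D unfolding determinantal_process_def by blast
    also have "(\<lambda>x. ennreal (?f x)) = (\<lambda>x. neg_ln (1 - a n * (1 - h x)))"
      using ag[of n] by (auto simp: neg_ln_def not_le fun_eq_iff)
    also have "(\<lambda>x. 1 - exp (- ?f x)) = (\<lambda>x. a n * (1 - h x))"
      using ag[of n] by (auto simp: fun_eq_iff)
    also have "(\<lambda>k. det_term \<Lambda> K {0..} (\<lambda>x. a n * (1 - h x)) (Suc k)) = (\<lambda>k. c (Suc k) * a n ^ Suc k)"
      unfolding c_def
      by (subst det_term_support[OF sets, where B = "{0<..t}"]) (auto simp: h(2) det_term_scale fun_eq_iff)
    finally have "(\<lambda>k. c (Suc k) * a n ^ Suc k) sums (pgfl M \<kappa> T (\<lambda>x. 1 - a n * (1 - h x)) - 1)"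
      by (simp add: pgfl_def)
    then have "(\<lambda>k. c k * a n ^ k) sums pgfl M \<kappa> T (\<lambda>x. 1 - a n * (1 - h x))"
      by (subst (asm) sums_Suc_iff) (simp add: c0)
    then show ?thesis by (simp add: sums_iff)
  qed
  moreover have "(\<lambda>n. pgfl M \<kappa> T (\<lambda>x. 1 - a n * (1 - h x))) \<longlonglongrightarrow> pgfl M \<kappa> T h"
  proof (rule tendsto_pgfl[OF pp])
    show "decseq (\<lambda>n. 1 - a n * (1 - h x))" for x
      using \<open>incseq a\<close> h(1)[of x] by (auto simp: decseq_def incseq_def intro!: mult_right_mono)
    show "(\<lambda>n. 1 - a n * (1 - h x)) \<longlonglongrightarrow> h x" for x
      by (auto intro!: tendsto_eq_intros lim_a)
  qed measurable
  moreover have "(\<lambda>n. \<Sum>k. c k * a n ^ k) \<longlonglongrightarrow> (\<Sum>k. c k * 1 ^ k)"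
    using isCont_powser_converges_everywhere[of c 1, OF summ] lim_a by (rule isCont_tendsto_compose)
  ultimately have "pgfl M \<kappa> T h = (\<Sum>k. c k)"
    by (simp add: LIMSEQ_unique)
  also have "\<dots> = 1 + (\<Sum>k. c (Suc k))"
    using suminf_split_head[OF summ1] c0 by simp
  finally show "pgfl M \<kappa> T h = 1 + (\<Sum>n. det_term \<Lambda> K {0<..t} (\<lambda>x. 1 - h x) (Suc n))"
    by (simp add: c_def)
qed

section \<open>Cox processes\<close>

lemma space_measure_algebra: "space (measure_algebra R) = {m. sets m = sets R}"
  by (auto simp add: measure_algebra_def space_Sup_eq_UN)

lemma measurable_emeasure_measure_algebra [measurable]:
  "A \<in> sets R \<Longrightarrow> (\<lambda>m. emeasure m A) \<in> borel_measurable (measure_algebra R)"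
  by (auto intro!: measurable_Sup1 measurable_vimage_algebra1 simp: measure_algebra_def)

text \<open>Counts are natural numbers or \<infinity>, so a sum over the natural values of a count
  misses only \<infinity>.\<close>

lemma emeasure_random_measure_cases:
  assumes "point_process M \<kappa> T" and "w \<in> space M" and B: "B \<in> sets borel_Rplus"
  obtains k :: nat where "emeasure (random_measure \<kappa> T w) B = of_nat k"
  | "emeasure (random_measure \<kappa> T w) B = \<infinity>"
proof -
  have "emeasure (random_measure \<kappa> T w) B =
      emeasure (count_space {i. enat i < \<kappa> w}) ((\<lambda>i. T i w) -` B \<inter> {i. enat i < \<kappa> w})"
    unfolding random_measure_def atom_measure_def
    using B point_process_atom_nonneg[OF assms(1,2)]
    by (subst emeasure_distr) (auto simp: space_restrict_space)
  with that show ?thesis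
    by (auto simp: emeasure_count_space split: if_splits)
qed

lemma exp_neg_mult_of_nat: "exp_neg (x * of_nat k) = exp_neg x ^ k"
  by (induction k) (auto simp: distrib_left exp_neg_add)

text \<open>At x = \<infinity> both sides are 0 because v < 1. At v = 0 the conventions 0^0 = 1 and
  \<infinity> * 0 = 0 agree.\<close>

lemma exp_neg_neg_ln_mult_suminf:
  assumes v: "0 \<le> v" "v < 1" and x: "(\<exists>k :: nat. x = of_nat k) \<or> x = \<infinity>"
  shows "ennreal (exp_neg (neg_ln v * x)) = (\<Sum>k. ennreal (v ^ k) * indicator {of_nat k} x)"
  using x
proof
  assume "\<exists>k :: nat. x = of_nat k"
  then obtain k :: nat where x: "x = of_nat k" by blast
  have "(\<Sum>j. ennreal (v ^ j) * indicator {of_nat j} x) =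
      (\<Sum>j\<in>{k}. ennreal (v ^ j) * indicator {of_nat j} x)"
    by (rule suminf_finite) (auto simp: x indicator_def)
  also have "\<dots> = ennreal (v ^ k)" by (simp add: x)
  also have "v ^ k = exp_neg (neg_ln v * x)"
    using v by (simp add: x exp_neg_mult_of_nat exp_neg_neg_ln)
  finally show ?thesis by simp
next
  assume x: "x = \<infinity>"
  have "neg_ln v > 0"
    using v by (auto simp: neg_ln_def)
  then have "neg_ln v * x = \<infinity>"
    by (simp add: x ennreal_mult_eq_top_iff)
  moreover have "(\<Sum>j. ennreal (v ^ j) * indicator {of_nat j} x) = (\<Sum>j :: nat. 0)"
    by (intro suminf_cong) (auto simp: x indicator_def)
  ultimately show ?thesis by (simp add: exp_neg_def)
qed

lemma poisson_prob_nonneg [simp]: "0 \<le> poisson_prob a k"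
  by (simp add: poisson_prob_def)

lemma borel_measurable_poisson_prob [measurable]: "(\<lambda>a. poisson_prob a k) \<in> borel_measurable borel"
  unfolding poisson_prob_def[abs_def] by measurable

text \<open>The generating function of the Poisson law. For a = \<infinity> all the probabilities
  are 0 and, because v < 1, so is the right-hand side.\<close>

lemma poisson_prob_pgf:
  assumes v: "0 \<le> v" "v < 1"
  shows "(\<Sum>k. ennreal (v ^ k) * ennreal (poisson_prob a k)) = ennreal (exp_neg (ennreal (1 - v) * a))"
proof (cases a)
  case (real r)
  have "(\<lambda>k. exp (- r) * ((v * r) ^ k /\<^sub>R fact k)) sums (exp (- r) * exp (v * r))"
    by (intro sums_mult exp_converges)
  moreover have "exp (- r) * ((v * r) ^ k /\<^sub>R fact k) = v ^ k * poisson_prob a k" for k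
    using real by (simp add: poisson_prob_def power_mult_distrib field_simps)
  moreover have "exp (- r) * exp (v * r) = exp_neg (ennreal (1 - v) * a)"
  proof -
    have "ennreal (1 - v) * a = ennreal ((1 - v) * r)"
      using real v by (simp add: ennreal_mult)
    then have "exp_neg (ennreal (1 - v) * a) = exp (- ((1 - v) * r))"
      using real v by (simp only: exp_neg_ennreal mult_nonneg_nonneg diff_ge_0_iff_ge less_imp_le)
    also have "- ((1 - v) * r) = - r + v * r"
      by (simp add: algebra_simps)
    finally show ?thesis by (simp only: exp_add)
  qed
  ultimately have "(\<lambda>k. v ^ k * poisson_prob a k) sums exp_neg (ennreal (1 - v) * a)"
    by simp
  then have "(\<Sum>k. ennreal (v ^ k * poisson_prob a k)) = ennreal (exp_neg (ennreal (1 - v) * a))"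
    using v by (intro suminf_ennreal_eq) auto
  then show ?thesis
    using v by (simp add: ennreal_mult)
next
  case top
  then show ?thesis
    using v by (simp add: poisson_prob_def exp_neg_def ennreal_mult_eq_top_iff)
qed

lemma sum_indicator_disjoint:
  fixes c :: "nat \<Rightarrow> ennreal"
  assumes "disjoint_family_on B {..<n}" "j < n" "x \<in> B j"
  shows "(\<Sum>i<n. c i * indicator (B i) x) = c j"
proof -
  have "(\<Sum>i<n. c i * indicator (B i) x) = (\<Sum>i<n. if i = j then c i else 0)"
    using assms by (intro sum.cong) (auto simp: disjoint_family_on_def indicator_def)
  then show ?thesis using assms by simp
qed

lemma nn_integral_disjoint_simple:
  fixes n :: nat
  assumes sets: "sets R = sets borel_Rplus"
    and B: "\<And>i. i < n \<Longrightarrow> B i \<in> sets borel_Rplus" "disjoint_family_on B {..<n}"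
    and f: "\<And>i x. i < n \<Longrightarrow> x \<in> B i \<Longrightarrow> f x = c i"
      "\<And>x. 0 \<le> x \<Longrightarrow> \<forall>i<n. x \<notin> B i \<Longrightarrow> f x = 0"
  shows "(\<integral>\<^sup>+x. f x \<partial>R) = (\<Sum>i<n. c i * emeasure R (B i))"
proof -
  have "(\<integral>\<^sup>+x. f x \<partial>R) = (\<integral>\<^sup>+x. (\<Sum>i<n. c i * indicator (B i) x) \<partial>R)"
  proof (intro nn_integral_cong)
    fix x assume "x \<in> space R"
    then have "0 \<le> x" using sets_eq_imp_space_eq[OF sets] by (simp add: space_restrict_space)
    show "f x = (\<Sum>i<n. c i * indicator (B i) x)"
    proof (cases "\<exists>j<n. x \<in> B j")
      case True
      then obtain j where "j < n" "x \<in> B j" by blast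
      then show ?thesis
        using f(1) sum_indicator_disjoint[OF B(2), of j x c] by simp
    next
      case False
      then show ?thesis using f(2)[OF \<open>0 \<le> x\<close>] by simp
    qed
  qed
  also have "\<dots> = (\<Sum>i<n. \<integral>\<^sup>+x. c i * indicator (B i) x \<partial>R)"
  proof (rule nn_integral_sum)
    fix i assume "i \<in> {..<n}"
    then have [measurable]: "B i \<in> sets R" using B(1) by (simp add: sets)
    show "(\<lambda>x. c i * indicator (B i) x) \<in> borel_measurable R" by measurable
  qed
  also have "\<dots> = (\<Sum>i<n. c i * emeasure R (B i))"
    using B(1) by (intro sum.cong refl nn_integral_cmult_indicator) (simp add: sets)
  finally show ?thesis .
qed

section \<open>Joint generating functions of the counts\<close>

locale cox =
  fixes M :: "'a measure" and \<kappa> :: "'a \<Rightarrow> enat" and T :: "nat \<Rightarrow> 'a \<Rightarrow> real" and \<eta> :: "'a \<Rightarrow> real measure"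
  assumes pp: "point_process M \<kappa> T" and cox: "cox_process M \<kappa> T \<eta>"
begin

sublocale prob_space M
  using pp by (rule point_process_prob_space)

lemma measurable_directing [measurable]: "\<eta> \<in> M \<rightarrow>\<^sub>M measure_algebra borel_Rplus"
  using cox by (simp add: cox_process_def)

lemma sets_directing: "w \<in> space M \<Longrightarrow> sets (\<eta> w) = sets borel_Rplus"
  using measurable_space[OF measurable_directing] by (simp add: space_measure_algebra)

lemma measurable_count [measurable]:
  assumes [measurable]: "B \<in> sets borel_Rplus"
  shows "(\<lambda>w. emeasure (random_measure \<kappa> T w) B) \<in> borel_measurable M"
  using measurable_nn_integral_random_measure[OF pp, of "indicator B"] by simp

text \<open>Integrating the conditional probabilities over M removes the conditioning: what is used
  later is only that the joint law of the counts is a mixture of products of Poisson laws.\<close>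

lemma prob_counts:
  fixes k :: "nat \<Rightarrow> nat"
  assumes B: "\<And>i. i < n \<Longrightarrow> B i \<in> sets borel_Rplus" "disjoint_family_on B {..<n}"
  shows "(\<integral>\<^sup>+w. (\<Prod>i<n. indicator {of_nat (k i)} (emeasure (random_measure \<kappa> T w) (B i))) \<partial>M) =
    (\<integral>\<^sup>+w. (\<Prod>i<n. ennreal (poisson_prob (emeasure (\<eta> w) (B i)) (k i))) \<partial>M)"
proof -
  let ?F = "vimage_algebra (space M) \<eta> (measure_algebra borel_Rplus)"
  let ?A = "{w \<in> space M. \<forall>i<n. emeasure (random_measure \<kappa> T w) (B i) = of_nat (k i)}"
  let ?p = "\<lambda>w. \<Prod>i<n. poisson_prob (emeasure (\<eta> w) (B i)) (k i)"
  have [measurable]: "B i \<in> sets borel_Rplus" if "i \<in> {..<n}" for i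
    using that B by simp
  interpret finite_measure_subalgebra M ?F
    by unfold_locales (auto simp: subalgebra_def sets_image_in_sets[OF refl measurable_directing, THEN subsetD])
  have [measurable]: "?A \<in> sets M"
  proof -
    have "?A = {w \<in> space M. \<forall>i\<in>{..<n}. emeasure (random_measure \<kappa> T w) (B i) = of_nat (k i)}" by auto
    also have "\<dots> \<in> sets M" by measurable
    finally show ?thesis .
  qed
  have AE: "AE w in M. real_cond_exp M ?F (indicator ?A) w = ?p w"
    using cox B unfolding cox_process_def by blast
  have int: "integrable M (indicator ?A :: 'a \<Rightarrow> real)"
    by (intro integrable_const_bound[where B = 1]) auto
  have "(\<integral>w. ?p w \<partial>M) = (\<integral>w. real_cond_exp M ?F (indicator ?A) w \<partial>M)"
    using AE by (intro integral_cong_AE) auto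
  also have "\<dots> = (\<integral>w. indicator ?A w \<partial>M)"
    using int by (rule real_cond_exp_int)
  finally have eq: "(\<integral>w. ?p w \<partial>M) = (\<integral>w. indicator ?A w \<partial>M)" .
  have "integrable M (real_cond_exp M ?F (indicator ?A))"
    using int by (rule real_cond_exp_int)
  then have intp: "integrable M ?p"
    by (rule integrable_cong_AE_imp[OF _ _ AE]) measurable
  have "(\<integral>\<^sup>+w. (\<Prod>i<n. indicator {of_nat (k i)} (emeasure (random_measure \<kappa> T w) (B i))) \<partial>M) =
      (\<integral>\<^sup>+w. ennreal (indicator ?A w) \<partial>M)"
    by (intro nn_integral_cong) (auto simp: indicator_def)
  also have "\<dots> = ennreal (\<integral>w. ?p w \<partial>M)"
    unfolding eq by (rule nn_integral_eq_integral[OF int]) simp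
  also have "\<dots> = (\<integral>\<^sup>+w. ennreal (?p w) \<partial>M)"
    by (rule nn_integral_eq_integral[OF intp, symmetric]) (simp add: prod_nonneg)
  also have "\<dots> = (\<integral>\<^sup>+w. (\<Prod>i<n. ennreal (poisson_prob (emeasure (\<eta> w) (B i)) (k i))) \<partial>M)"
    by (simp add: prod_ennreal)
  finally show ?thesis .
qed

text \<open>The generating functions in the first \<open>m\<close> counts are introduced one at a time, the
  remaining counts being kept fixed.\<close>

lemma pgf_counts:
  fixes n m :: nat and k :: "nat \<Rightarrow> nat"
  assumes B: "\<And>i. i < n \<Longrightarrow> B i \<in> sets borel_Rplus" "disjoint_family_on B {..<n}"
    and v: "\<And>i. i < n \<Longrightarrow> 0 \<le> v i \<and> v i < 1" and "m \<le> n"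
  shows "(\<integral>\<^sup>+w. (\<Prod>i<m. ennreal (exp_neg (neg_ln (v i) * emeasure (random_measure \<kappa> T w) (B i)))) *
      (\<Prod>i=m..<n. indicator {of_nat (k i)} (emeasure (random_measure \<kappa> T w) (B i))) \<partial>M) =
    (\<integral>\<^sup>+w. (\<Prod>i<m. ennreal (exp_neg (ennreal (1 - v i) * emeasure (\<eta> w) (B i)))) *
      (\<Prod>i=m..<n. ennreal (poisson_prob (emeasure (\<eta> w) (B i)) (k i))) \<partial>M)"
  using \<open>m \<le> n\<close>
proof (induction m arbitrary: k)
  case 0
  then show ?case
    using prob_counts[OF B, of k] by (simp add: atLeast0LessThan)
next
  case (Suc m)
  define N where "N i w = emeasure (random_measure \<kappa> T w) (B i)" for i w
  define a where "a i w = emeasure (\<eta> w) (B i)" for i w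
  have [measurable]: "N i \<in> borel_measurable M" "a i \<in> borel_measurable M" if "i < n" for i
    unfolding N_def a_def using B(1)[OF that] by measurable
  define A A' where "A w = (\<Prod>i<m. ennreal (exp_neg (neg_ln (v i) * N i w)))"
    and "A' w = (\<Prod>i<m. ennreal (exp_neg (ennreal (1 - v i) * a i w)))" for w
  define C C' where "C w = (\<Prod>i=Suc m..<n. indicator {of_nat (k i)} (N i w) :: ennreal)"
    and "C' w = (\<Prod>i=Suc m..<n. ennreal (poisson_prob (a i w) (k i)))" for w
  have m: "m < n" "m \<le> n" using Suc.prems by auto
  have [measurable]: "A \<in> borel_measurable M" "A' \<in> borel_measurable M"
    "C \<in> borel_measurable M" "C' \<in> borel_measurable M"
    unfolding A_def[abs_def] A'_def[abs_def] C_def[abs_def] C'_def[abs_def]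
    using m by (auto intro!: borel_measurable_prod_ennreal)
  have [measurable]: "N m \<in> borel_measurable M" "a m \<in> borel_measurable M"
    using m by auto
  have IH: "(\<integral>\<^sup>+w. A w * (indicator {of_nat j} (N m w) * C w) \<partial>M) =
      (\<integral>\<^sup>+w. A' w * (ennreal (poisson_prob (a m w) j) * C' w) \<partial>M)" for j
    using Suc.IH[of "k(m := j)"] m
    by (simp add: A_def A'_def C_def C'_def N_def a_def prod.atLeast_Suc_lessThan cong: prod.cong_simp)
  have "(\<integral>\<^sup>+w. (\<Prod>i<Suc m. ennreal (exp_neg (neg_ln (v i) * N i w))) *
      (\<Prod>i=Suc m..<n. indicator {of_nat (k i)} (N i w)) \<partial>M) =
      (\<integral>\<^sup>+w. (\<Sum>j. ennreal (v m ^ j) * (A w * (indicator {of_nat j} (N m w) * C w))) \<partial>M)"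
  proof (intro nn_integral_cong)
    fix w assume "w \<in> space M"
    then have "ennreal (exp_neg (neg_ln (v m) * N m w)) = (\<Sum>j. ennreal (v m ^ j) * indicator {of_nat j} (N m w))"
      using v[of m] m B(1)[of m] unfolding N_def
      by (intro exp_neg_neg_ln_mult_suminf)
        (auto intro: emeasure_random_measure_cases[OF pp, of w "B m"])
    then have "(\<Prod>i<Suc m. ennreal (exp_neg (neg_ln (v i) * N i w))) * C w =
        A w * (\<Sum>j. ennreal (v m ^ j) * indicator {of_nat j} (N m w)) * C w"
      by (simp add: A_def)
    also have "\<dots> = (\<Sum>j. A w * (ennreal (v m ^ j) * indicator {of_nat j} (N m w)) * C w)"
      by simp
    also have "\<dots> = (\<Sum>j. ennreal (v m ^ j) * (A w * (indicator {of_nat j} (N m w) * C w)))"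
      by (intro suminf_cong) (simp add: mult_ac)
    finally show "(\<Prod>i<Suc m. ennreal (exp_neg (neg_ln (v i) * N i w))) *
      (\<Prod>i=Suc m..<n. indicator {of_nat (k i)} (N i w)) = \<dots>" by (simp add: C_def)
  qed
  also have "\<dots> = (\<Sum>j. ennreal (v m ^ j) * (\<integral>\<^sup>+w. A w * (indicator {of_nat j} (N m w) * C w) \<partial>M))"
    by (subst nn_integral_suminf) (auto simp: nn_integral_cmult)
  also have "\<dots> = (\<integral>\<^sup>+w. (\<Sum>j. ennreal (v m ^ j) * (A' w * (ennreal (poisson_prob (a m w) j) * C' w))) \<partial>M)"
    unfolding IH by (subst nn_integral_suminf) (auto simp: nn_integral_cmult)
  also have "\<dots> = (\<integral>\<^sup>+w. (\<Prod>i<Suc m. ennreal (exp_neg (ennreal (1 - v i) * a i w))) *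
      (\<Prod>i=Suc m..<n. ennreal (poisson_prob (a i w) (k i))) \<partial>M)"
  proof (intro nn_integral_cong)
    fix w
    have "(\<Sum>j. ennreal (v m ^ j) * (A' w * (ennreal (poisson_prob (a m w) j) * C' w))) =
        (\<Sum>j. A' w * (ennreal (v m ^ j) * ennreal (poisson_prob (a m w) j)) * C' w)"
      by (intro suminf_cong) (simp add: mult_ac)
    also have "\<dots> = A' w * (\<Sum>j. ennreal (v m ^ j) * ennreal (poisson_prob (a m w) j)) * C' w"
      by simp
    also have "\<dots> = (\<Prod>i<Suc m. ennreal (exp_neg (ennreal (1 - v i) * a i w))) *
      (\<Prod>i=Suc m..<n. ennreal (poisson_prob (a i w) (k i)))"
      using v[OF m(1)] by (subst poisson_prob_pgf) (auto simp: A'_def C'_def)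
    finally show "(\<Sum>j. ennreal (v m ^ j) * (A' w * (ennreal (poisson_prob (a m w) j) * C' w))) = \<dots>" .
  qed
  finally show ?case by (simp only: N_def a_def)
qed

text \<open>The case \<open>m = n\<close> of \<open>pgf_counts\<close>. The region h = 1 is kept
  outside the sets B i, since v i < 1 is what discards infinite counts.\<close>

lemma pgfl_simple:
  fixes n :: nat
  assumes B: "\<And>i. i < n \<Longrightarrow> B i \<in> sets borel_Rplus" "disjoint_family_on B {..<n}"
    and v: "\<And>i. i < n \<Longrightarrow> 0 \<le> v i \<and> v i < 1"
    and h: "\<And>i x. i < n \<Longrightarrow> x \<in> B i \<Longrightarrow> h x = v i"
      "\<And>x. 0 \<le> x \<Longrightarrow> \<forall>i<n. x \<notin> B i \<Longrightarrow> h x = 1"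
    and [measurable]: "h \<in> borel_measurable borel_Rplus"
  shows "(\<lambda>w. \<integral>\<^sup>+x. ennreal (1 - h x) \<partial>\<eta> w) \<in> borel_measurable M"
    and "pgfl M \<kappa> T h = (\<integral>w. exp_neg (\<integral>\<^sup>+x. ennreal (1 - h x) \<partial>\<eta> w) \<partial>M)"
proof -
  have [measurable]: "B i \<in> sets borel_Rplus" if "i \<in> {..<n}" for i
    using that B by simp
  have int_\<eta>: "(\<integral>\<^sup>+x. ennreal (1 - h x) \<partial>\<eta> w) = (\<Sum>i<n. ennreal (1 - v i) * emeasure (\<eta> w) (B i))"
    if "w \<in> space M" for w
    using h by (intro nn_integral_disjoint_simple[OF sets_directing[OF that] B]) auto
  have "(\<lambda>w. \<Sum>i<n. ennreal (1 - v i) * emeasure (\<eta> w) (B i)) \<in> borel_measurable M"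
    by measurable
  then show meas [measurable]: "(\<lambda>w. \<integral>\<^sup>+x. ennreal (1 - h x) \<partial>\<eta> w) \<in> borel_measurable M"
    by (rule measurable_cong[THEN iffD1, rotated]) (simp add: int_\<eta>)
  have int_\<Phi>: "(\<integral>\<^sup>+x. neg_ln (h x) \<partial>random_measure \<kappa> T w) =
      (\<Sum>i<n. neg_ln (v i) * emeasure (random_measure \<kappa> T w) (B i))" for w
    using h by (intro nn_integral_disjoint_simple[OF sets_random_measure B]) auto
  note [measurable] = measurable_nn_integral_random_measure[OF pp]
  have "ennreal (pgfl M \<kappa> T h) = (\<integral>\<^sup>+w. ennreal (exp_neg (\<integral>\<^sup>+x. neg_ln (h x) \<partial>random_measure \<kappa> T w)) \<partial>M)"
    unfolding pgfl_def
    by (rule nn_integral_eq_integral[symmetric]) (auto intro!: integrable_const_bound[where B = 1])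
  also have "\<dots> = (\<integral>\<^sup>+w. (\<Prod>i<n. ennreal (exp_neg (neg_ln (v i) * emeasure (random_measure \<kappa> T w) (B i)))) \<partial>M)"
    unfolding int_\<Phi> exp_neg_sum by (simp add: prod_ennreal)
  also have "\<dots> = (\<integral>\<^sup>+w. (\<Prod>i<n. ennreal (exp_neg (ennreal (1 - v i) * emeasure (\<eta> w) (B i)))) \<partial>M)"
    using pgf_counts[OF B v order_refl] by simp
  also have "\<dots> = (\<integral>\<^sup>+w. ennreal (exp_neg (\<integral>\<^sup>+x. ennreal (1 - h x) \<partial>\<eta> w)) \<partial>M)"
    by (intro nn_integral_cong) (simp add: int_\<eta> exp_neg_sum prod_ennreal)
  also have "\<dots> = ennreal (\<integral>w. exp_neg (\<integral>\<^sup>+x. ennreal (1 - h x) \<partial>\<eta> w) \<partial>M)"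
    by (rule nn_integral_eq_integral) (auto intro!: integrable_const_bound[where B = 1])
  finally show "pgfl M \<kappa> T h = (\<integral>w. exp_neg (\<integral>\<^sup>+x. ennreal (1 - h x) \<partial>\<eta> w) \<partial>M)"
    by (subst (asm) ennreal_inj) (auto simp: pgfl_def intro!: integral_nonneg_AE)
qed

lemma pgfl_cox_process:
  assumes [measurable]: "h \<in> borel_measurable borel_Rplus" and h: "\<And>x. 0 \<le> h x \<and> h x \<le> 1"
  shows "pgfl M \<kappa> T h = (\<integral>w. exp_neg (\<integral>\<^sup>+x. ennreal (1 - h x) \<partial>\<eta> w) \<partial>M)"
proof -
  \<comment> \<open>Dyadic approximation of 1 - h; rounding down makes 1 - q n decrease to
    h.\<close>
  define q where "q n x = real_of_int \<lfloor>2 ^ n * (1 - h x)\<rfloor> / 2 ^ n" for n x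
  have [measurable]: "q n \<in> borel_measurable borel_Rplus" for n
    unfolding q_def[abs_def] by measurable
  have q0: "0 \<le> q n x" for n x using h[of x] by (simp add: q_def)
  have q_le: "q n x \<le> 1 - h x" and q_ge: "1 - h x - 1 / 2 ^ n \<le> q n x" for n x
  proof -
    show "q n x \<le> 1 - h x" by (simp add: q_def divide_le_eq mult.commute)
    have "2 ^ n * (1 - h x) - 1 \<le> real_of_int \<lfloor>2 ^ n * (1 - h x)\<rfloor>" by linarith
    from divide_right_mono[OF this, of "2 ^ n"] show "1 - h x - 1 / 2 ^ n \<le> q n x"
      by (simp add: q_def diff_divide_distrib)
  qed
  have q_mono: "incseq (\<lambda>n. q n x)" for x
  proof (rule incseq_SucI)
    fix n
    have "2 * \<lfloor>2 ^ n * (1 - h x)\<rfloor> \<le> \<lfloor>2 ^ Suc n * (1 - h x)\<rfloor>"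
      using of_int_floor_le[of "2 ^ n * (1 - h x)"] by (simp add: le_floor_iff algebra_simps)
    then have "2 * real_of_int \<lfloor>2 ^ n * (1 - h x)\<rfloor> \<le> real_of_int \<lfloor>2 ^ Suc n * (1 - h x)\<rfloor>"
      by linarith
    then show "q n x \<le> q (Suc n) x"
      by (simp add: q_def field_simps)
  qed
  have q_lim: "(\<lambda>n. q n x) \<longlonglongrightarrow> 1 - h x" for x
  proof (rule tendsto_sandwich)
    show "(\<lambda>n. 1 - h x - 1 / 2 ^ n) \<longlonglongrightarrow> 1 - h x"
      using tendsto_diff[OF tendsto_const LIMSEQ_power_zero[of "1 / 2 :: real"], of "1 - h x"]
      by (simp add: power_divide)
  qed (use q_le q_ge in auto)
  have simple: "(\<lambda>w. \<integral>\<^sup>+x. ennreal (q n x) \<partial>\<eta> w) \<in> borel_measurable M \<and>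
      pgfl M \<kappa> T (\<lambda>x. 1 - q n x) = (\<integral>w. exp_neg (\<integral>\<^sup>+x. ennreal (q n x) \<partial>\<eta> w) \<partial>M)" for n
  proof -
    \<comment> \<open>The level set of \<open>q n\<close> for the value (i + 1) / 2^n. The shift by
      one leaves out the value 0, at which 1 - q n = 1.\<close>
    define B where "B i = {x \<in> space borel_Rplus. \<lfloor>2 ^ n * (1 - h x)\<rfloor> = int i + 1}" for i :: nat
    have 1: "B i \<in> sets borel_Rplus" for i unfolding B_def by measurable
    have 2: "disjoint_family_on B {..<2 ^ n}" by (auto simp: disjoint_family_on_def B_def)
    have 3: "0 \<le> 1 - (real i + 1) / 2 ^ n \<and> 1 - (real i + 1) / 2 ^ n < 1" if "i < 2 ^ n" for i :: nat
    proof -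
      have "real (Suc i) \<le> real (2 ^ n)" using that by (simp only: of_nat_le_iff Suc_le_eq)
      then show ?thesis by (simp add: field_simps)
    qed
    have 4: "1 - q n x = 1 - (real i + 1) / 2 ^ n" if "x \<in> B i" for i x
      using that by (simp add: B_def q_def)
    have 5: "1 - q n x = 1" if "0 \<le> x" "\<forall>i<2 ^ n. x \<notin> B i" for x
    proof -
      define z where "z = \<lfloor>2 ^ n * (1 - h x)\<rfloor>"
      have "0 \<le> z" using h[of x] by (simp add: z_def)
      have "z \<le> 2 ^ n"
      proof -
        have "2 ^ n * (1 - h x) \<le> real_of_int (2 ^ n)" using h[of x] by (simp add: mult_left_le)
        then show ?thesis unfolding z_def by linarith
      qed
      have "z = 0"
      proof (rule ccontr)
        assume "z \<noteq> 0"
        with \<open>0 \<le> z\<close> have "1 \<le> z" by simp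
        then have "x \<in> B (nat (z - 1))"
          unfolding B_def z_def[symmetric] using that(1) by (simp add: space_restrict_space z_def)
        moreover have "nat (z - 1) < 2 ^ n"
          using \<open>1 \<le> z\<close> \<open>z \<le> 2 ^ n\<close> by (simp add: nat_less_iff)
        ultimately show False using that(2) by blast
      qed
      then show ?thesis by (simp add: q_def z_def)
    qed
    show ?thesis
      using pgfl_simple[of "2 ^ n" B "\<lambda>i. 1 - (real i + 1) / 2 ^ n" "\<lambda>x. 1 - q n x"] 1 2 3 4 5 by simp
  qed
  have conv: "(\<lambda>n. \<integral>\<^sup>+x. ennreal (q n x) \<partial>\<eta> w) \<longlonglongrightarrow> (\<integral>\<^sup>+x. ennreal (1 - h x) \<partial>\<eta> w)"
    if "w \<in> space M" for w
  proof (rule nn_integral_LIMSEQ)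
    show "incseq (\<lambda>n x. ennreal (q n x))"
      using q_mono by (auto simp: incseq_def le_fun_def intro!: ennreal_leI)
    show "(\<lambda>x. ennreal (q n x)) \<in> borel_measurable (\<eta> w)" for n
      using that by (simp add: sets_directing cong: measurable_cong_sets)
    show "(\<lambda>n. ennreal (q n x)) \<longlonglongrightarrow> ennreal (1 - h x)" for x
      by (intro tendsto_ennrealI q_lim)
  qed
  have "(\<lambda>n. \<integral>w. exp_neg (\<integral>\<^sup>+x. ennreal (q n x) \<partial>\<eta> w) \<partial>M) \<longlonglongrightarrow>
      (\<integral>w. exp_neg (\<integral>\<^sup>+x. ennreal (1 - h x) \<partial>\<eta> w) \<partial>M)"
  proof (rule tendsto_expectation_exp_neg)
    \<comment> \<open>\<open>measure_algebra\<close> makes evaluations at sets measurable; the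
      integral of 1 - h inherits measurability from the simple functions.\<close>
    show "(\<lambda>w. \<integral>\<^sup>+x. ennreal (1 - h x) \<partial>\<eta> w) \<in> borel_measurable M"
      using conv simple by (rule borel_measurable_LIMSEQ_order[OF _ conjunct1])
  qed (use simple conv in auto)
  moreover have "(\<lambda>n. pgfl M \<kappa> T (\<lambda>x. 1 - q n x)) \<longlonglongrightarrow> pgfl M \<kappa> T h"
  proof (rule tendsto_pgfl[OF pp])
    show "decseq (\<lambda>n. 1 - q n x)" for x
      using q_mono[of x] by (auto simp: decseq_def incseq_def)
    show "(\<lambda>n. 1 - q n x) \<longlonglongrightarrow> h x" for x
      using tendsto_diff[OF tendsto_const q_lim, of 1 x] by simp
  qed measurable
  ultimately show ?thesis
    using simple by (simp add: LIMSEQ_unique)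
qed

end

section \<open>Independence\<close>

text \<open>Fubini for the joint law. Phrasing independence as a factorisation of this law covers
  both \<open>indep_var\<close> and variables of different types.\<close>

lemma (in prob_space) nn_integral_indep_law:
  assumes [measurable]: "U \<in> M \<rightarrow>\<^sub>M S" "V \<in> M \<rightarrow>\<^sub>M R" "f \<in> borel_measurable (S \<Otimes>\<^sub>M R)"
    and law: "distr M (S \<Otimes>\<^sub>M R) (\<lambda>w. (U w, V w)) = distr M S U \<Otimes>\<^sub>M distr M R V"
  shows "(\<integral>\<^sup>+w. f (U w, V w) \<partial>M) = (\<integral>\<^sup>+w'. (\<integral>\<^sup>+w. f (U w, V w') \<partial>M) \<partial>M)"
proof -
  interpret U: prob_space "distr M S U" by (rule prob_space_distr) simp
  interpret V: prob_space "distr M R V" by (rule prob_space_distr) simp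
  interpret UV: pair_sigma_finite "distr M S U" "distr M R V" ..
  have "(\<integral>\<^sup>+w. f (U w, V w) \<partial>M) = (\<integral>\<^sup>+z. f z \<partial>distr M (S \<Otimes>\<^sub>M R) (\<lambda>w. (U w, V w)))"
    by (rule nn_integral_distr[symmetric]) measurable
  also have "\<dots> = (\<integral>\<^sup>+v. (\<integral>\<^sup>+u. f (u, v) \<partial>distr M S U) \<partial>distr M R V)"
    unfolding law by (rule UV.nn_integral_snd[symmetric]) measurable
  also have "\<dots> = (\<integral>\<^sup>+w'. (\<integral>\<^sup>+u. f (u, V w') \<partial>distr M S U) \<partial>M)"
    by (rule nn_integral_distr) measurable
  also have "\<dots> = (\<integral>\<^sup>+w'. (\<integral>\<^sup>+w. f (U w, V w') \<partial>M) \<partial>M)"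
  proof (rule nn_integral_cong)
    fix w' assume "w' \<in> space M"
    then have "V w' \<in> space R" by (rule measurable_space[OF \<open>V \<in> M \<rightarrow>\<^sub>M R\<close>])
    then have "(\<lambda>u. f (u, V w')) \<in> borel_measurable S" by measurable
    then show "(\<integral>\<^sup>+u. f (u, V w') \<partial>distr M S U) = (\<integral>\<^sup>+w. f (U w, V w') \<partial>M)"
      by (intro nn_integral_distr) auto
  qed
  finally show ?thesis .
qed

lemma (in prob_space) expectation_indep_law:
  fixes f :: "'b \<times> 'c \<Rightarrow> real"
  assumes U: "U \<in> M \<rightarrow>\<^sub>M S" and V: "V \<in> M \<rightarrow>\<^sub>M R" and f: "f \<in> borel_measurable (S \<Otimes>\<^sub>M R)"
    and law: "distr M (S \<Otimes>\<^sub>M R) (\<lambda>w. (U w, V w)) = distr M S U \<Otimes>\<^sub>M distr M R V"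
    and bounds: "\<And>z. 0 \<le> f z" "\<And>z. f z \<le> 1"
  shows "(\<integral>w. f (U w, V w) \<partial>M) = (\<integral>w'. (\<integral>w. f (U w, V w') \<partial>M) \<partial>M)"
proof -
  note [measurable] = U V f
  have int: "ennreal (\<integral>w. g w \<partial>M) = (\<integral>\<^sup>+w. ennreal (g w) \<partial>M)"
    if "g \<in> borel_measurable M" "\<And>w. 0 \<le> g w" "\<And>w. g w \<le> 1" for g :: "'a \<Rightarrow> real"
    using that by (intro nn_integral_eq_integral[symmetric] integrable_const_bound[where B = 1]) auto
  have inner: "ennreal (\<integral>w. f (U w, V w') \<partial>M) = (\<integral>\<^sup>+w. ennreal (f (U w, V w')) \<partial>M)"
    if "w' \<in> space M" for w'
  proof (rule int)
    from that have "V w' \<in> space R" by (rule measurable_space[OF V])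
    then show "(\<lambda>w. f (U w, V w')) \<in> borel_measurable M" by measurable
  qed (fact bounds)+
  have "ennreal (\<integral>w. f (U w, V w) \<partial>M) = (\<integral>\<^sup>+w. ennreal (f (U w, V w)) \<partial>M)"
    by (rule int) (measurable, fact bounds, fact bounds)
  also have "\<dots> = (\<integral>\<^sup>+w'. (\<integral>\<^sup>+w. ennreal (f (U w, V w')) \<partial>M) \<partial>M)"
    by (rule nn_integral_indep_law[OF U V _ law]) measurable
  also have "\<dots> = (\<integral>\<^sup>+w'. ennreal (\<integral>w. f (U w, V w') \<partial>M) \<partial>M)"
    by (rule nn_integral_cong) (simp only: inner)
  also have "\<dots> = ennreal (\<integral>w'. (\<integral>w. f (U w, V w') \<partial>M) \<partial>M)"
  proof (rule int[symmetric])
    show "(\<lambda>w'. \<integral>w. f (U w, V w') \<partial>M) \<in> borel_measurable M"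
      by (rule borel_measurable_lebesgue_integral) measurable
    show "0 \<le> (\<integral>w. f (U w, V w') \<partial>M)" for w'
      by (simp add: bounds)
    show "(\<integral>w. f (U w, V w') \<partial>M) \<le> 1" for w'
    proof (cases "integrable M (\<lambda>w. f (U w, V w'))")
      case True
      then show ?thesis by (intro integral_le_const) (simp_all add: bounds)
    qed (simp add: not_integrable_integral_eq)
  qed
  finally show ?thesis
    by (subst (asm) ennreal_inj) (simp_all add: bounds)
qed

section \<open>Branching processes at random times\<close>

text \<open>Partial sums of natural numbers are eventually constant or tend to infinity. In the
  second case the powers tend to 0 for s < 1 and to 1 for s = 1, which is the convention in
  \<open>pow_enat\<close>.\<close>

lemma tendsto_power_partial_sums:
  assumes s: "0 \<le> s" "s \<le> 1"
  shows "(\<lambda>m. s ^ (\<Sum>i<m. a i)) \<longlonglongrightarrow> pow_enat s (\<Sum>i. enat (a i))"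
proof -
  define b where "b m = (\<Sum>i<m. a i)" for m
  have "incseq b" by (auto simp: b_def incseq_def intro!: sum_mono2)
  have sup: "(\<Sum>i. enat (a i)) = (SUP m. enat (b m))"
  proof -
    have "(\<Sum>i<m. enat (a i)) = enat (b m)" for m
      by (induction m) (simp_all add: b_def zero_enat_def)
    then show ?thesis by (simp add: suminf_eq_SUP)
  qed
  show ?thesis
  proof (cases "\<exists>N. \<forall>m. b m \<le> N")
    case True
    then have "finite (range b)" by (auto simp: finite_nat_set_iff_bounded_le)
    then have "Max (range b) \<in> range b" by (rule Max_in) simp
    then obtain m0 where m0: "b m0 = Max (range b)" by (metis rangeE)
    have ev: "b m = b m0" if "m \<ge> m0" for m
    proof (rule antisym)
      show "b m \<le> b m0" unfolding m0 using \<open>finite (range b)\<close> by (rule Max_ge) (rule rangeI)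
      show "b m0 \<le> b m" using \<open>incseq b\<close> that by (rule incseqD)
    qed
    have "(\<Sum>i. enat (a i)) = enat (b m0)"
    proof (unfold sup, rule antisym)
      have "b m \<le> b m0" for m unfolding m0 using \<open>finite (range b)\<close> by (rule Max_ge) (rule rangeI)
      then show "(SUP m. enat (b m)) \<le> enat (b m0)" by (intro SUP_least) simp
      show "enat (b m0) \<le> (SUP m. enat (b m))" by (rule SUP_upper) simp
    qed
    then have lim: "pow_enat s (\<Sum>i. enat (a i)) = s ^ b m0"
      by (simp add: pow_enat_def)
    show ?thesis
      unfolding lim b_def[symmetric]
    proof (rule tendsto_eventually, rule eventually_sequentiallyI)
      show "s ^ b m = s ^ b m0" if "m0 \<le> m" for m
        by (simp only: ev[OF that])
    qed
  next
    case False
    have "(\<Sum>i. enat (a i)) = \<infinity>"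
    proof (rule ccontr)
      assume "(\<Sum>i. enat (a i)) \<noteq> \<infinity>"
      then obtain N where N: "(SUP m. enat (b m)) = enat N" by (auto simp: sup)
      have "enat (b m) \<le> enat N" for m unfolding N[symmetric] by (rule SUP_upper) simp
      then have "\<forall>m. b m \<le> N" by simp
      with False show False by blast
    qed
    moreover have "(\<lambda>m. s ^ b m) \<longlonglongrightarrow> 0" if "s \<noteq> 1"
    proof -
      have "filterlim b at_top sequentially"
        unfolding filterlim_at_top
      proof
        fix N
        obtain m where "N \<le> b m" using False nat_le_linear by blast
        then show "\<forall>\<^sub>F x in sequentially. N \<le> b x"
          using \<open>incseq b\<close> by (intro eventually_sequentiallyI[of m]) (auto simp: incseq_def intro: order_trans)
      qed
      then show ?thesis
        using s that by (intro filterlim_compose[OF LIMSEQ_power_zero]) auto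
    qed
    ultimately show ?thesis
      unfolding b_def[symmetric] by (cases "s = 1") (auto simp: pow_enat_def)
  qed
qed

section \<open>Discretised times\<close>

text \<open>For u \<ge> 0, the next multiple of 1 / (n + 1) strictly to the right of u. Countably
  many values give measurability, strictness the approach from the right that right-continuity asks
  for; truncation at 0 keeps the time admissible when u = t - x is negative.\<close>

definition grid :: "nat \<Rightarrow> real \<Rightarrow> real" where
  "grid n u = max 0 ((real_of_int \<lfloor>(real n + 1) * u\<rfloor> + 1) / (real n + 1))"

lemma grid_nonneg [simp]: "0 \<le> grid n u"
  by (simp add: grid_def)

lemma grid_bounds:
  assumes "0 \<le> u"
  shows "u < grid n u" "grid n u \<le> u + 1 / (real n + 1)"
proof -
  have "(real n + 1) * u < real_of_int \<lfloor>(real n + 1) * u\<rfloor> + 1" by linarith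
  then show "u < grid n u"
    by (simp add: grid_def field_simps less_max_iff_disj)
  have "(real_of_int \<lfloor>(real n + 1) * u\<rfloor> + 1) / (real n + 1) \<le> ((real n + 1) * u + 1) / (real n + 1)"
    using of_int_floor_le[of "(real n + 1) * u"] by (intro divide_right_mono) linarith+
  also have "\<dots> = u + 1 / (real n + 1)"
    by (simp add: add_divide_distrib)
  finally show "grid n u \<le> u + 1 / (real n + 1)"
    using assms by (simp add: grid_def)
qed

lemma filterlim_grid:
  assumes "0 \<le> u"
  shows "filterlim (\<lambda>n. grid n u) (at_right u) sequentially"
proof -
  have "(\<lambda>n. grid n u) \<longlonglongrightarrow> u"
  proof (rule tendsto_sandwich)
    show "\<forall>\<^sub>F n in sequentially. u \<le> grid n u" "\<forall>\<^sub>F n in sequentially. grid n u \<le> u + 1 / (real n + 1)"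
      using grid_bounds[OF assms] by (auto intro!: always_eventually less_imp_le)
    show "(\<lambda>n. u + 1 / (real n + 1)) \<longlonglongrightarrow> u"
      using LIMSEQ_inverse_real_of_nat_add[of u] by (simp add: inverse_eq_divide add.commute)
  qed simp
  then show ?thesis
    using grid_bounds(1)[OF assms] unfolding at_within_def
    by (intro filterlim_inf[THEN iffD2]) (auto simp: filterlim_principal)
qed

text \<open>Only countably many times occur, so measurability at each fixed time suffices.\<close>

lemma measurable_grid_compose:
  assumes f: "\<And>v. 0 \<le> v \<Longrightarrow> f v \<in> M \<rightarrow>\<^sub>M N" and [measurable]: "u \<in> borel_measurable M"
  shows "(\<lambda>x. f (grid n (u x)) x) \<in> M \<rightarrow>\<^sub>M N"
proof -
  have "(\<lambda>x. f (max 0 ((real_of_int \<lfloor>(real n + 1) * u x\<rfloor> + 1) / (real n + 1))) x) \<in> M \<rightarrow>\<^sub>M N"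
    by (rule measurable_compose_countable[where f = "\<lambda>i x. f (max 0 ((real_of_int i + 1) / (real n + 1))) x"])
      (auto intro!: f)
  then show ?thesis by (simp add: grid_def)
qed

lemma measurable_path:
  assumes "branching_process M \<mu> I \<nu> X"
  shows "path X \<in> M \<rightarrow>\<^sub>M path_space"
  unfolding path_def[abs_def] path_space_def
proof (rule measurable_restrict)
  fix t :: real assume "t \<in> {0..}"
  then have "X t \<in> M \<rightarrow>\<^sub>M count_space UNIV"
    using assms by (simp add: branching_process_def)
  then show "(\<lambda>w. enat (X t w)) \<in> M \<rightarrow>\<^sub>M count_space UNIV"
    by (rule measurable_compose) simp
qed

lemma measurable_path_space_eval:
  "0 \<le> u \<Longrightarrow> (\<lambda>p. f (p u)) \<in> path_space \<rightarrow>\<^sub>M (N :: 'b measure)" if "\<And>x. f x \<in> space N"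
  unfolding path_space_def
  by (rule measurable_compose[OF measurable_component_singleton]) (auto simp: that)

text \<open>The generating function depends on the law alone; this identifies the copies on M with
  the reference process on P.\<close>

lemma pgf_process_law:
  assumes X: "branching_process M \<mu> I \<nu> X" and "0 \<le> u"
  shows "pgf_process M X u s = (\<integral>p. pow_enat s (p u) \<partial>branching_law \<mu> I \<nu>)"
proof -
  have "(\<integral>p. pow_enat s (p u) \<partial>distr M path_space (path X)) = (\<integral>w. pow_enat s (path X w u) \<partial>M)"
    using assms by (intro integral_distr measurable_path measurable_path_space_eval) auto
  also have "\<dots> = pgf_process M X u s"
    using \<open>0 \<le> u\<close> by (simp add: pgf_process_def path_def pow_enat_def)
  finally show ?thesis
    using X by (simp add: branching_process_def)
qed

lemma pgf_process_bounds:
  assumes X: "branching_process M \<mu> I \<nu> X" and s: "0 \<le> s" "s \<le> 1"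
  shows "0 \<le> pgf_process M X u s" "pgf_process M X u s \<le> 1"
proof -
  interpret prob_space M using X by (simp add: branching_process_def)
  show "0 \<le> pgf_process M X u s"
    using s by (auto simp: pgf_process_def intro!: integral_nonneg_AE)
  show "pgf_process M X u s \<le> 1"
  \<comment> \<open>For u < 0 nothing is assumed about \<open>X u\<close>; if the power is not
    integrable, the integral is 0 by default.\<close>
  proof (cases "integrable M (\<lambda>w. s ^ X u w)")
    case True
    then show ?thesis
      unfolding pgf_process_def using s by (intro integral_le_const) (simp_all add: power_le_one)
  qed (simp add: pgf_process_def not_integrable_integral_eq)
qed

text \<open>Each path is constant immediately to the right of u, so its values along the grid are
  eventually constant. The measurability of G (t - x) in x rests on this limit.\<close>

lemma pgf_process_grid:
  assumes X: "branching_process M \<mu> I \<nu> X" and s: "0 \<le> s" "s \<le> 1" and u: "0 \<le> u"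
  shows "(\<lambda>n. pgf_process M X (grid n u) s) \<longlonglongrightarrow> pgf_process M X u s"
  unfolding pgf_process_def
proof (rule integral_dominated_convergence[where w = "\<lambda>_. 1"])
  interpret prob_space M using X by (simp add: branching_process_def)
  have [measurable]: "X v \<in> M \<rightarrow>\<^sub>M count_space UNIV" if "0 \<le> v" for v
    using X that by (simp add: branching_process_def)
  show "(\<lambda>w. s ^ X u w) \<in> borel_measurable M" "(\<lambda>w. s ^ X (grid n u) w) \<in> borel_measurable M" for n
    using u by measurable
  show "integrable M (\<lambda>_. 1 :: real)" by simp
  show "AE w in M. (\<lambda>n. s ^ X (grid n u) w) \<longlonglongrightarrow> s ^ X u w"
  proof (rule AE_I2)
    fix w assume "w \<in> space M"
    then have "\<forall>\<^sub>F v in at_right u. X v w = X u w"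
      using X u by (simp add: branching_process_def)
    then have "\<forall>\<^sub>F n in sequentially. X (grid n u) w = X u w"
      by (rule eventually_compose_filterlim[OF _ filterlim_grid[OF u]])
    then show "(\<lambda>n. s ^ X (grid n u) w) \<longlonglongrightarrow> s ^ X u w"
      by (intro tendsto_eventually) (auto elim: eventually_mono)
  qed
  show "AE w in M. norm (s ^ X (grid n u) w) \<le> 1" for n
    using s by (simp add: power_le_one)
qed

lemma independent_rvs_distr:
  assumes "prob_space M" and UV: "independent_rvs M S U R V"
  shows "distr M (S \<Otimes>\<^sub>M R) (\<lambda>w. (U w, V w)) = distr M S U \<Otimes>\<^sub>M distr M R V"
proof (rule pair_measure_eqI[symmetric])
  interpret prob_space M by fact
  have [measurable]: "U \<in> M \<rightarrow>\<^sub>M S" "V \<in> M \<rightarrow>\<^sub>M R"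
    and ind: "indep_set (sets (vimage_algebra (space M) U S)) (sets (vimage_algebra (space M) V R))"
    using UV by (auto simp: independent_rvs_def)
  interpret U: prob_space "distr M S U" by (rule prob_space_distr) simp
  interpret V: prob_space "distr M R V" by (rule prob_space_distr) simp
  show "sigma_finite_measure (distr M S U)" "sigma_finite_measure (distr M R V)"
    by unfold_locales
  show "sets (distr M S U \<Otimes>\<^sub>M distr M R V) = sets (distr M (S \<Otimes>\<^sub>M R) (\<lambda>w. (U w, V w)))"
    by (simp cong: sets_pair_measure_cong)
  fix A B assume "A \<in> sets (distr M S U)" "B \<in> sets (distr M R V)"
  then have [measurable]: "A \<in> sets S" "B \<in> sets R" by auto
  have "prob ((U -` A \<inter> space M) \<inter> (V -` B \<inter> space M)) = prob (U -` A \<inter> space M) * prob (V -` B \<inter> space M)"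
    using ind by (rule indep_setD) (auto intro!: in_vimage_algebra)
  moreover have "(\<lambda>w. (U w, V w)) -` (A \<times> B) \<inter> space M = (U -` A \<inter> space M) \<inter> (V -` B \<inter> space M)"
    by auto
  ultimately show "emeasure (distr M S U) A * emeasure (distr M R V) B =
      emeasure (distr M (S \<Otimes>\<^sub>M R) (\<lambda>w. (U w, V w))) (A \<times> B)"
    by (simp add: emeasure_distr emeasure_eq_measure ennreal_mult)
qed

section \<open>Conditioning on the immigration times\<close>

text \<open>One parameter s in [0,1] serves both transforms: the Laplace transform at s is the
  generating function at exp (- s).\<close>

locale immigration =
  fixes M :: "'w measure" and P :: "'p measure"
    and \<mu> :: real and I \<nu> :: "nat pmf"
    and Zx :: "real \<Rightarrow> 'p \<Rightarrow> nat" and X :: "nat \<Rightarrow> real \<Rightarrow> 'w \<Rightarrow> nat"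
    and \<kappa> :: "'w \<Rightarrow> enat" and T :: "nat \<Rightarrow> 'w \<Rightarrow> real" and t s :: real
  assumes Zx: "branching_process P \<mu> I \<nu> Zx"
    and X: "iid_branching_processes M \<mu> I \<nu> X"
    and pp: "point_process M \<kappa> T"
    and indep: "independent_rvs M paths_space (paths X) atoms_space (atoms \<kappa> T)"
    and s: "0 \<le> s" "s \<le> 1"
begin

sublocale prob_space M
  using pp by (rule point_process_prob_space)

definition G :: "real \<Rightarrow> real" where
  "G u = pgf_process P Zx u s"

definition h :: "real \<Rightarrow> real" where
  "h x = (if x \<in> {0<..t} then G (t - x) else 1)"

lemma G_bounds: "0 \<le> G u" "G u \<le> 1"
  unfolding G_def using pgf_process_bounds[OF Zx s] by auto

lemma h_bounds: "0 \<le> h x \<and> h x \<le> 1"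
  by (simp add: h_def G_bounds)

lemma bp: "branching_process M \<mu> I \<nu> (X i)"
  using X by (simp add: iid_branching_processes_def)

lemma expectation_power: "0 \<le> u \<Longrightarrow> (\<integral>w. s ^ X i u w \<partial>M) = G u"
  unfolding G_def using pgf_process_law[OF Zx, of u s] pgf_process_law[OF bp, of u i s]
  by (simp add: pgf_process_def)

lemma G_grid: "0 \<le> u \<Longrightarrow> (\<lambda>n. G (grid n u)) \<longlonglongrightarrow> G u"
  unfolding G_def by (rule pgf_process_grid[OF Zx s])

lemma borel_measurable_G_grid [measurable]: "(\<lambda>x. G (grid n x)) \<in> borel_measurable borel"
  by (rule measurable_grid_compose[where f = "\<lambda>v x. G v" and u = "\<lambda>x. x"]) auto

lemma borel_measurable_h [measurable]: "h \<in> borel_measurable borel"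
proof (rule borel_measurable_LIMSEQ_real)
  show "(\<lambda>n. if x \<in> {0<..t} then G (grid n (t - x)) else 1) \<longlonglongrightarrow> h x" for x
    by (auto simp: h_def intro!: G_grid)
qed measurable

lemma borel_measurable_h_Rplus [measurable]: "h \<in> borel_measurable borel_Rplus"
  by (rule measurable_restrict_space1) measurable

lemma measurable_X: "0 \<le> u \<Longrightarrow> X i u \<in> M \<rightarrow>\<^sub>M count_space UNIV"
  using bp[of i] by (simp add: branching_process_def)

definition active :: "nat \<Rightarrow> 'w \<Rightarrow> bool" where
  "active i w \<longleftrightarrow> enat i < \<kappa> w \<and> T i w \<in> {0<..t}"

lemma measurable_kappa [measurable]: "\<kappa> \<in> M \<rightarrow>\<^sub>M count_space UNIV"
  by (rule measurable_point_process_size[OF pp])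

lemma measurable_T [measurable]: "T i \<in> borel_measurable M"
  using measurable_point_process_atom[OF pp] by (rule measurable_restrict_space2_iff[THEN iffD1, THEN conjunct1])

lemma measurable_active [measurable]: "Measurable.pred M (active i)"
  unfolding active_def[abs_def] by measurable

text \<open>For frozen atoms the i-th factor involves only the i-th path, at one deterministic time,
  so independence of the paths factorises the expectation. The grid makes the integrand measurable
  on the product space, on which evaluating a path at an arbitrary time is not jointly
  measurable.\<close>

lemma expectation_grid:
  "(\<integral>w. (\<Prod>i<m. if active i w then s ^ X i (grid n (t - T i w)) w else 1) \<partial>M) =
   (\<integral>w. (\<Prod>i<m. if active i w then G (grid n (t - T i w)) else 1) \<partial>M)"
proof -
  \<comment> \<open>Written as a function of paths and atoms separately, so that the atoms can be
    frozen.\<close>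
  define f where "f = (\<lambda>(p :: nat \<Rightarrow> real \<Rightarrow> enat, k :: enat, x :: nat \<Rightarrow> real).
    \<Prod>i<m. if enat i < k \<and> x i \<in> {0<..t} then pow_enat s (p i (grid n (t - x i))) else 1)"
  have pow_bounds: "0 \<le> pow_enat s z" "pow_enat s z \<le> 1" for z
    using s by (auto simp: pow_enat_def power_le_one split: enat.split)
  have [measurable]: "f \<in> borel_measurable (paths_space \<Otimes>\<^sub>M atoms_space)"
  proof -
    have [measurable]: "(\<lambda>z. fst (snd z)) \<in> paths_space \<Otimes>\<^sub>M atoms_space \<rightarrow>\<^sub>M count_space UNIV"
      unfolding atoms_space_def by measurable
    have [measurable]: "(\<lambda>z. snd (snd z) i) \<in> borel_measurable (paths_space \<Otimes>\<^sub>M atoms_space)" for i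
    proof -
      have "(\<lambda>z. snd (snd z) i) \<in> paths_space \<Otimes>\<^sub>M atoms_space \<rightarrow>\<^sub>M borel_Rplus"
        unfolding atoms_space_def by measurable
      then show ?thesis by (rule measurable_restrict_space2_iff[THEN iffD1, THEN conjunct1])
    qed
    have [measurable]: "(\<lambda>z. pow_enat s (fst z i (grid n (t - snd (snd z) i))))
        \<in> borel_measurable (paths_space \<Otimes>\<^sub>M atoms_space)" for i
    proof (rule measurable_grid_compose[where f = "\<lambda>v z. pow_enat s (fst z i v)"])
      fix v :: real assume "0 \<le> v"
      have "(\<lambda>z. fst z i) \<in> paths_space \<Otimes>\<^sub>M atoms_space \<rightarrow>\<^sub>M path_space"
        unfolding paths_space_def by measurable
      then show "(\<lambda>z. pow_enat s (fst z i v)) \<in> borel_measurable (paths_space \<Otimes>\<^sub>M atoms_space)"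
        by (rule measurable_compose[OF _ measurable_path_space_eval[OF _ \<open>0 \<le> v\<close>]]) auto
    qed measurable
    have "f = (\<lambda>z. \<Prod>i<m. if enat i < fst (snd z) \<and> snd (snd z) i \<in> {0<..t}
        then pow_enat s (fst z i (grid n (t - snd (snd z) i))) else 1)"
      by (simp add: f_def fun_eq_iff cong: if_cong)
    then show ?thesis by simp
  qed
  have U: "paths X \<in> M \<rightarrow>\<^sub>M paths_space" and V: "atoms \<kappa> T \<in> M \<rightarrow>\<^sub>M atoms_space"
    using indep by (simp_all add: independent_rvs_def)
  have "(\<integral>w. f (paths X w, atoms \<kappa> T w) \<partial>M) = (\<integral>w'. (\<integral>w. f (paths X w, atoms \<kappa> T w') \<partial>M) \<partial>M)"
  proof (rule expectation_indep_law[OF U V _ independent_rvs_distr[OF prob_space_axioms indep]])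
    show "0 \<le> f z" "f z \<le> 1" for z
      by (cases z; simp add: f_def prod_nonneg prod_le_1 pow_bounds)+
  qed fact
  also have "\<dots> = (\<integral>w'. (\<Prod>i<m. if active i w' then G (grid n (t - T i w')) else 1) \<partial>M)"
  proof (intro Bochner_Integration.integral_cong refl)
    fix w'
    let ?\<phi> = "\<lambda>i p. if active i w' then pow_enat s (p (grid n (t - T i w'))) else 1"
    have \<phi>: "?\<phi> i \<in> borel_measurable path_space" for i
      by (cases "active i w'") (simp_all add: measurable_path_space_eval)
    have "indep_vars (\<lambda>_. path_space) (\<lambda>i. path (X i)) {..<m}"
      using X unfolding iid_branching_processes_def by (blast intro: indep_vars_subset)
    then have ind: "indep_vars (\<lambda>_. borel) (\<lambda>i w. ?\<phi> i (path (X i) w)) {..<m}"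
      using \<phi> by (rule indep_vars_compose2)
    have int: "integrable M (\<lambda>w. ?\<phi> i (path (X i) w))" for i
    proof (rule integrable_const_bound[where B = 1])
      show "AE w in M. norm (?\<phi> i (path (X i) w)) \<le> 1"
        using pow_bounds by simp
      show "(\<lambda>w. ?\<phi> i (path (X i) w)) \<in> borel_measurable M"
        by (rule measurable_compose[OF measurable_path[OF bp] \<phi>])
    qed
    have "(\<integral>w. f (paths X w, atoms \<kappa> T w') \<partial>M) = (\<integral>w. (\<Prod>i<m. ?\<phi> i (path (X i) w)) \<partial>M)"
      by (simp add: f_def paths_def atoms_def active_def)
    also have "\<dots> = (\<Prod>i<m. \<integral>w. ?\<phi> i (path (X i) w) \<partial>M)"
      by (rule indep_vars_lebesgue_integral[OF _ ind int]) simp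
    also have "\<dots> = (\<Prod>i<m. if active i w' then G (grid n (t - T i w')) else 1)"
      by (intro prod.cong refl) (simp add: path_def pow_enat_def expectation_power prob_space)
    finally show "(\<integral>w. f (paths X w, atoms \<kappa> T w') \<partial>M) = \<dots>" .
  qed
  also have "(\<integral>w. f (paths X w, atoms \<kappa> T w) \<partial>M) =
      (\<integral>w. (\<Prod>i<m. if active i w then s ^ X i (grid n (t - T i w)) w else 1) \<partial>M)"
    by (simp add: f_def paths_def path_def atoms_def active_def pow_enat_def cong: if_cong)
  finally show ?thesis .
qed

lemma tendsto_grid_X:
  assumes "w \<in> space M" "active i w"
  shows "(\<lambda>n. s ^ X i (grid n (t - T i w)) w) \<longlonglongrightarrow> s ^ X i (t - T i w) w"
proof -
  have "0 \<le> t - T i w" using assms by (simp add: active_def)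
  then have "\<forall>\<^sub>F v in at_right (t - T i w). X i v w = X i (t - T i w) w"
    using bp[of i] assms by (simp add: branching_process_def)
  then have "\<forall>\<^sub>F n in sequentially. X i (grid n (t - T i w)) w = X i (t - T i w) w"
    by (rule eventually_compose_filterlim[OF _ filterlim_grid[OF \<open>0 \<le> t - T i w\<close>]])
  then show ?thesis
    by (intro tendsto_eventually) (auto elim: eventually_mono)
qed

lemma measurable_X_atom:
  "(\<lambda>w. if active i w then s ^ X i (t - T i w) w else 1) \<in> borel_measurable M"
proof (rule borel_measurable_LIMSEQ_real)
  show "(\<lambda>n. if active i w then s ^ X i (grid n (t - T i w)) w else 1)
      \<longlonglongrightarrow> (if active i w then s ^ X i (t - T i w) w else 1)" if "w \<in> space M" for w
    using tendsto_grid_X[OF that] by simp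
  fix n
  have [measurable]: "(\<lambda>w. X i (grid n (t - T i w)) w) \<in> M \<rightarrow>\<^sub>M count_space UNIV"
    by (rule measurable_grid_compose[where f = "X i"]) (auto intro: measurable_X)
  show "(\<lambda>w. if active i w then s ^ X i (grid n (t - T i w)) w else 1) \<in> borel_measurable M"
    by measurable
qed

text \<open>Refinement of the grid while the number of atoms stays finite: right-continuity of the
  paths acts on the left, that of G on the right.\<close>

lemma expectation_atoms:
  "(\<integral>w. (\<Prod>i<m. if active i w then s ^ X i (t - T i w) w else 1) \<partial>M) =
   (\<integral>w. (\<Prod>i<m. if enat i < \<kappa> w then h (T i w) else 1) \<partial>M)"
proof (rule LIMSEQ_unique)
  note [measurable] = measurable_X_atom
  show "(\<lambda>n. \<integral>w. (\<Prod>i<m. if active i w then s ^ X i (grid n (t - T i w)) w else 1) \<partial>M)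
      \<longlonglongrightarrow> (\<integral>w. (\<Prod>i<m. if active i w then s ^ X i (t - T i w) w else 1) \<partial>M)"
  proof (rule integral_dominated_convergence[where w = "\<lambda>_. 1"])
    fix n
    have [measurable]: "(\<lambda>w. X i (grid n (t - T i w)) w) \<in> M \<rightarrow>\<^sub>M count_space UNIV" for i
      by (rule measurable_grid_compose[where f = "X i"]) (auto intro: measurable_X)
    show "(\<lambda>w. \<Prod>i<m. if active i w then s ^ X i (grid n (t - T i w)) w else 1) \<in> borel_measurable M"
      by measurable
    show "AE w in M. norm (\<Prod>i<m. if active i w then s ^ X i (grid n (t - T i w)) w else 1) \<le> 1"
      using s by (auto simp: abs_prod power_le_one intro!: prod_le_1)
  next
    show "AE w in M. (\<lambda>n. \<Prod>i<m. if active i w then s ^ X i (grid n (t - T i w)) w else 1)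
        \<longlonglongrightarrow> (\<Prod>i<m. if active i w then s ^ X i (t - T i w) w else 1)"
      by (intro AE_I2 tendsto_prod) (simp add: tendsto_grid_X)
  qed auto
  show "(\<lambda>n. \<integral>w. (\<Prod>i<m. if active i w then s ^ X i (grid n (t - T i w)) w else 1) \<partial>M)
      \<longlonglongrightarrow> (\<integral>w. (\<Prod>i<m. if enat i < \<kappa> w then h (T i w) else 1) \<partial>M)"
    unfolding expectation_grid
  proof (rule integral_dominated_convergence[where w = "\<lambda>_. 1"])
    show "AE w in M. norm (\<Prod>i<m. if active i w then G (grid n (t - T i w)) else 1) \<le> 1" for n
      using G_bounds by (auto simp: abs_prod intro!: prod_le_1)
    show "AE w in M. (\<lambda>n. \<Prod>i<m. if active i w then G (grid n (t - T i w)) else 1)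
        \<longlonglongrightarrow> (\<Prod>i<m. if enat i < \<kappa> w then h (T i w) else 1)"
      by (intro AE_I2 tendsto_prod) (auto simp: active_def h_def intro!: G_grid)
  qed auto
qed

text \<open>As m grows, the same partial products give the power of a possibly infinite sum on one
  side and, after conditioning, the generating functional on the other.\<close>

lemma expectation_immigration:
  "(\<integral>w. pow_enat s (immigration_process \<kappa> T X t w) \<partial>M) = pgfl M \<kappa> T h"
proof (rule LIMSEQ_unique)
  note [measurable] = measurable_X_atom
  have *: "(\<lambda>m. \<Prod>i<m. if active i w then s ^ X i (t - T i w) w else 1)
      \<longlonglongrightarrow> pow_enat s (immigration_process \<kappa> T X t w)" for w
  proof -
    have "(\<Prod>i<m. if active i w then s ^ X i (t - T i w) w else 1) =
        s ^ (\<Sum>i<m. if active i w then X i (t - T i w) w else 0)" for m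
      by (simp add: power_sum if_distrib[of "\<lambda>n. s ^ n"] cong: if_cong)
    moreover have "immigration_process \<kappa> T X t w = (\<Sum>i. enat (if active i w then X i (t - T i w) w else 0))"
      unfolding immigration_process_def by (intro suminf_cong) (auto simp: active_def zero_enat_def)
    ultimately show ?thesis
      using tendsto_power_partial_sums[OF s] by simp
  qed
  have [measurable]: "(\<lambda>w. pow_enat s (immigration_process \<kappa> T X t w)) \<in> borel_measurable M"
    by (rule borel_measurable_LIMSEQ_real[OF *]) measurable
  show "(\<lambda>m. \<integral>w. (\<Prod>i<m. if active i w then s ^ X i (t - T i w) w else 1) \<partial>M)
      \<longlonglongrightarrow> (\<integral>w. pow_enat s (immigration_process \<kappa> T X t w) \<partial>M)"
    using * s by (intro integral_dominated_convergence[where w = "\<lambda>_. 1"])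
      (auto simp: abs_prod power_le_one intro!: prod_le_1)
  show "(\<lambda>m. \<integral>w. (\<Prod>i<m. if active i w then s ^ X i (t - T i w) w else 1) \<partial>M) \<longlonglongrightarrow> pgfl M \<kappa> T h"
    unfolding expectation_atoms pgfl_def
  proof (rule integral_dominated_convergence[where w = "\<lambda>_. 1"])
    show "(\<lambda>w. exp_neg (\<integral>\<^sup>+x. neg_ln (h x) \<partial>random_measure \<kappa> T w)) \<in> borel_measurable M"
      by (intro measurable_compose[OF measurable_nn_integral_random_measure[OF pp]]) measurable
    show "AE w in M. norm (\<Prod>i<m. if enat i < \<kappa> w then h (T i w) else 1) \<le> 1" for m
      using h_bounds by (auto simp: abs_prod intro!: prod_le_1)
    show "AE w in M. (\<lambda>m. \<Prod>i<m. if enat i < \<kappa> w then h (T i w) else 1)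
        \<longlonglongrightarrow> exp_neg (\<integral>\<^sup>+x. neg_ln (h x) \<partial>random_measure \<kappa> T w)"
      unfolding random_measure_def using h_bounds point_process_atom_nonneg[OF pp]
      by (intro AE_I2 tendsto_prod_atoms) auto
  qed auto
qed

end

section \<open>Thinned Poisson processes\<close>

lemma nn_integral_exp_rate_atLeast:
  assumes "0 < u"
  shows "(\<integral>\<^sup>+z. ennreal (u * exp (- (u * z))) * indicator {a..} z \<partial>lborel) = ennreal (exp (- (u * a)))"
proof -
  have "filterlim (\<lambda>z. u * z) at_top (at_top :: real filter)"
    using assms by (intro filterlim_tendsto_pos_mult_at_top[OF tendsto_const] filterlim_ident)
  then have "((\<lambda>z. - exp (- (u * z))) \<longlongrightarrow> - 0) (at_top :: real filter)"
    by (intro tendsto_minus filterlim_compose[OF exp_at_bot]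
        filterlim_compose[OF filterlim_uminus_at_bot_at_top])
  then have "(\<integral>\<^sup>+z. ennreal (u * exp (- (u * z))) * indicator {a..} z \<partial>lborel) = ennreal (- 0 - - exp (- (u * a)))"
    using assms by (intro nn_integral_FTC_atLeast) (auto intro!: derivative_eq_intros)
  then show ?thesis by simp
qed

lemma nn_integral_exp_atLeast:
  "(\<integral>\<^sup>+z. ennreal (exp (- z)) * indicator {a..} z \<partial>lborel) = ennreal (exp (- a :: real))"
  using nn_integral_exp_rate_atLeast[of 1 a] by simp

lemma nn_integral_mult_exp:
  "(\<integral>\<^sup>+z. ennreal (z * exp (- z)) * indicator {0..} z \<partial>lborel) = 1"
proof -
  interpret prob_space "density lborel (erlang_density 1 1)"
    by (rule prob_space_erlang_density) simp
  have "1 = emeasure (density lborel (erlang_density 1 1)) UNIV"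
    using emeasure_space_1 by simp
  also have "\<dots> = (\<integral>\<^sup>+z. ennreal (z * exp (- z)) * indicator {0..} z \<partial>lborel)"
    by (subst emeasure_density) (auto intro!: nn_integral_cong simp: erlang_density_def indicator_def)
  finally show ?thesis ..
qed

text \<open>A random variable with hazard rate \<open>k\<close> is almost surely finite if the cumulative hazard
  is infinite. As \<open>k\<close> is only measurable, the cumulative hazard need not be differentiable; the
  layer-cake formula replaces the fundamental theorem of calculus.\<close>

lemma nn_integral_hazard_rate:
  fixes k :: "real \<Rightarrow> real" and L :: real
  defines "m \<equiv> density lborel (\<lambda>x. ennreal (k x))"
  assumes [measurable]: "k \<in> borel_measurable borel"
    and k: "\<And>x. 0 \<le> k x" "\<And>x. k x \<le> L" and "0 < L"
    and unbounded: "\<And>z. \<exists>x. z \<le> measure m {0<..x}"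
  shows "(\<integral>\<^sup>+x. ennreal (k x * exp (- measure m {0<..x})) * indicator {0<..} x \<partial>lborel) = 1"
proof -
  define H where "H x = measure m {0<..x}" for x
  have sets [simp]: "sets m = sets borel" by (simp add: m_def)
  have lip: "emeasure m {x<..y} \<le> ennreal (L * (y - x))" if "x \<le> y" for x y
  proof -
    have "emeasure m {x<..y} = (\<integral>\<^sup>+z. ennreal (k z) * indicator {x<..y} z \<partial>lborel)"
      unfolding m_def by (subst emeasure_density) auto
    also have "\<dots> \<le> (\<integral>\<^sup>+z. ennreal L * indicator {x<..y} z \<partial>lborel)"
      using k by (intro nn_integral_mono mult_right_mono ennreal_leI) auto
    also have "\<dots> = ennreal (L * (y - x))"
      using that \<open>0 < L\<close> by (simp add: nn_integral_cmult_indicator ennreal_mult)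
    finally show ?thesis .
  qed
  have fin: "emeasure m {x<..y} \<noteq> \<infinity>" for x y
    using lip[of x y] by (cases "x \<le> y") (auto simp: top_unique)
  have H0: "0 \<le> H x" for x by (simp add: H_def)
  have emeasure_H: "emeasure m {0<..x} = ennreal (H x)" for x
    unfolding H_def using fin by (intro emeasure_eq_ennreal_measure) auto
  have H_mono: "H x \<le> H y" if "x \<le> y" for x y
    unfolding H_def using that fin by (intro measure_mono_fmeasurable) (auto simp: fmeasurable_def less_top[symmetric])
  have H_lip: "H y \<le> H x + L * (y - x)" if "0 \<le> x" "x \<le> y" for x y
  proof -
    have "ennreal (H y) = emeasure m ({0<..x} \<union> {x<..y})"
      using that by (simp add: emeasure_H[symmetric] ivl_disj_un)
    also have "\<dots> \<le> emeasure m {0<..x} + emeasure m {x<..y}"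
      by (rule emeasure_subadditive) auto
    also have "\<dots> \<le> ennreal (H x) + ennreal (L * (y - x))"
      using lip[OF that(2)] by (simp add: emeasure_H add_left_mono)
    also have "\<dots> = ennreal (H x + L * (y - x))"
      using that \<open>0 < L\<close> H0 by simp
    finally show ?thesis
      using that \<open>0 < L\<close> H0[of x] by (subst (asm) ennreal_le_iff) auto
  qed
  \<comment> \<open>H is nondecreasing, Lipschitz and unbounded, so each sublevel set on the
    positive half-line is an interval at whose end point the level is attained.\<close>
  have level: "\<exists>r. {x. 0 < x \<and> H x \<le> z} = {0<..r} \<and> H r = z" if "0 \<le> z" for z
  proof -
    define S where "S = {x. 0 \<le> x \<and> H x \<le> z}"
    obtain b where b: "z + 1 \<le> H b" using unbounded[of "z + 1"] by (auto simp: H_def)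
    have "x \<le> b" if "x \<in> S" for x
      using H_mono[of b x] that b by (force simp: S_def)
    then have bdd: "bdd_above S" by (rule bdd_aboveI)
    have "H 0 = 0" by (simp add: H_def)
    then have "0 \<in> S" using \<open>0 \<le> z\<close> by (simp add: S_def)
    define r where "r = Sup S"
    have S_le: "x \<le> r" if "x \<in> S" for x unfolding r_def using that bdd by (rule cSup_upper)
    have "0 \<le> r" using S_le[OF \<open>0 \<in> S\<close>] .
    have below: "H x \<le> z" if x_less: "x < r" for x
    proof -
      obtain y where "y \<in> S" "x < y"
        using x_less less_cSup_iff[OF _ bdd, of x] \<open>0 \<in> S\<close> unfolding r_def by blast
      then show ?thesis using H_mono[of x y] by (simp add: S_def)
    qed
    have "H r \<le> z"
    proof (rule field_le_epsilon)
      fix e :: real assume "0 < e"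
      \<comment> \<open>A point at distance at most e / L from r at which H \<le> z is already
        known; the Lipschitz bound then costs at most e.\<close>
      define x where "x = max 0 (r - e / L)"
      have "H r \<le> H x + L * (r - x)"
        using \<open>0 \<le> r\<close> \<open>0 < e\<close> \<open>0 < L\<close> by (intro H_lip) (auto simp: x_def)
      moreover have "H x \<le> z"
      proof (cases "r = 0")
        case True
        then have "x = 0" using \<open>0 < e\<close> \<open>0 < L\<close> by (simp add: x_def)
        then show ?thesis using \<open>H 0 = 0\<close> \<open>0 \<le> z\<close> by simp
      next
        case False
        then show ?thesis using \<open>0 \<le> r\<close> \<open>0 < e\<close> \<open>0 < L\<close> by (intro below) (auto simp: x_def)
      qed
      moreover have "L * (r - x) \<le> L * (e / L)"
        using \<open>0 < L\<close> by (intro mult_left_mono) (auto simp: x_def)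
      ultimately show "H r \<le> z + e" using \<open>0 < L\<close> by simp
    qed
    moreover have "z \<le> H r"
    proof (rule ccontr)
      assume "\<not> z \<le> H r"
      \<comment> \<open>If H r < z, the Lipschitz bound leaves room to move right by d inside the
        sublevel set, against the choice of r as supremum.\<close>
      define d where "d = (z - H r) / L"
      have "d > 0" using \<open>\<not> z \<le> H r\<close> \<open>0 < L\<close> by (simp add: d_def)
      have "H (r + d) \<le> H r + L * d"
        using H_lip[of r "r + d"] \<open>0 \<le> r\<close> \<open>d > 0\<close> by simp
      also have "\<dots> = z" using \<open>0 < L\<close> by (simp add: d_def)
      finally have "r + d \<in> S" using \<open>0 \<le> r\<close> \<open>d > 0\<close> by (simp add: S_def)
      from S_le[OF this] \<open>d > 0\<close> show False by simp
    qed
    moreover have "{x. 0 < x \<and> H x \<le> z} = {0<..r}"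
    proof (intro equalityI subsetI)
      fix x assume "x \<in> {x. 0 < x \<and> H x \<le> z}"
      then show "x \<in> {0<..r}" using S_le[of x] by (auto simp: S_def)
    next
      fix x assume "x \<in> {0<..r}"
      then show "x \<in> {x. 0 < x \<and> H x \<le> z}"
        using H_mono[of x r] \<open>H r \<le> z\<close> by auto
    qed
    ultimately show ?thesis by (intro exI[of _ r]) auto
  qed
  have [measurable]: "H \<in> borel_measurable borel"
    by (rule borel_measurable_mono) (auto simp: mono_def intro: H_mono)
  \<comment> \<open>exp (- H x) is the integral of exp (- z) over z \<ge> H x. After the exchange of
    integrals, the integral over x is the m-mass of a sublevel set, which is z, and the integral of
    z exp (- z) remains.\<close>
  have "(\<integral>\<^sup>+x. ennreal (k x * exp (- H x)) * indicator {0<..} x \<partial>lborel) =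
      (\<integral>\<^sup>+x. (\<integral>\<^sup>+z. ennreal (k x) * indicator {0<..} x * (ennreal (exp (- z)) * indicator {H x..} z) \<partial>lborel) \<partial>lborel)"
  proof (rule nn_integral_cong)
    fix x
    have "(\<integral>\<^sup>+z. ennreal (k x) * indicator {0<..} x * (ennreal (exp (- z)) * indicator {H x..} z) \<partial>lborel) =
        ennreal (k x) * indicator {0<..} x * (\<integral>\<^sup>+z. ennreal (exp (- z)) * indicator {H x..} z \<partial>lborel)"
      by (rule nn_integral_cmult) measurable
    also have "\<dots> = ennreal (k x) * indicator {0<..} x * ennreal (exp (- H x))"
      by (simp only: nn_integral_exp_atLeast)
    also have "\<dots> = ennreal (k x * exp (- H x)) * indicator {0<..} x"
      using k by (simp add: ennreal_mult mult_ac)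
    finally show "ennreal (k x * exp (- H x)) * indicator {0<..} x =
        (\<integral>\<^sup>+z. ennreal (k x) * indicator {0<..} x * (ennreal (exp (- z)) * indicator {H x..} z) \<partial>lborel)" ..
  qed
  also have "\<dots> = (\<integral>\<^sup>+x. (\<integral>\<^sup>+z. ennreal (k x) * ennreal (exp (- z)) * indicator {p. 0 < fst p \<and> H (fst p) \<le> snd p} (x, z) \<partial>lborel) \<partial>lborel)"
    by (intro nn_integral_cong) (auto simp: indicator_def)
  also have "\<dots> = (\<integral>\<^sup>+z. (\<integral>\<^sup>+x. ennreal (k x) * ennreal (exp (- z)) * indicator {p. 0 < fst p \<and> H (fst p) \<le> snd p} (x, z) \<partial>lborel) \<partial>lborel)"
    by (rule lborel_pair.Fubini'[symmetric]) measurable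
  also have "\<dots> = (\<integral>\<^sup>+z. ennreal (z * exp (- z)) * indicator {0..} z \<partial>lborel)"
  proof (intro nn_integral_cong)
    fix z :: real
    show "(\<integral>\<^sup>+x. ennreal (k x) * ennreal (exp (- z)) * indicator {p. 0 < fst p \<and> H (fst p) \<le> snd p} (x, z) \<partial>lborel) =
        ennreal (z * exp (- z)) * indicator {0..} z"
    proof (cases "0 \<le> z")
      case True
      then obtain r where r: "{x. 0 < x \<and> H x \<le> z} = {0<..r}" "H r = z" using level by blast
      have "(\<integral>\<^sup>+x. ennreal (k x) * ennreal (exp (- z)) * indicator {p. 0 < fst p \<and> H (fst p) \<le> snd p} (x, z) \<partial>lborel) =
          (\<integral>\<^sup>+x. ennreal (exp (- z)) * (ennreal (k x) * indicator {0<..r} x) \<partial>lborel)"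
        using r(1) by (intro nn_integral_cong) (auto simp: indicator_def mult_ac set_eq_iff)
      also have "\<dots> = ennreal (exp (- z)) * emeasure m {0<..r}"
        unfolding m_def by (simp add: nn_integral_cmult emeasure_density)
      finally show ?thesis
        using True by (simp add: emeasure_H r(2) ennreal_mult mult.commute)
    next
      case False
      then have "\<not> H x \<le> z" for x using H0[of x] by linarith
      then show ?thesis using False by simp
    qed
  qed
  also have "\<dots> = 1" by (rule nn_integral_mult_exp)
  finally show ?thesis by (simp only: H_def)
qed

section \<open>Iterates of the renewal equation\<close>

text \<open>With S_i the partial sums of independent steps of law F, this is the expectation of c (x
  + S_1) ... c (x + S_m), defined by conditioning on the first step.\<close>

primrec renewal_prod :: "real measure \<Rightarrow> (real \<Rightarrow> ennreal) \<Rightarrow> nat \<Rightarrow> real \<Rightarrow> ennreal" where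
  "renewal_prod F c 0 x = 1"
| "renewal_prod F c (Suc m) x = (\<integral>\<^sup>+y. c (x + y) * renewal_prod F c m (x + y) \<partial>F)"

abbreviation exponential :: "real \<Rightarrow> real measure" where
  "exponential rate \<equiv> density lborel (exponential_density rate)"

lemma borel_measurable_renewal_prod [measurable]:
  assumes "sigma_finite_measure F" and [measurable_cong]: "sets F = sets borel"
    and [measurable]: "c \<in> borel_measurable borel"
  shows "renewal_prod F c m \<in> borel_measurable borel"
proof (induction m)
  case (Suc m)
  interpret sigma_finite_measure F by fact
  note [measurable] = Suc.IH
  show ?case
    unfolding renewal_prod.simps[abs_def] by measurable
qed simp

lemma AE_exponential_nonneg: "AE e in exponential rate. 0 \<le> e"
  by (subst AE_density) (auto simp: exponential_density_def)

lemma nn_integral_Ici_Ioi: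
  "(\<integral>\<^sup>+x. f x * indicator {0..} x \<partial>lborel) = (\<integral>\<^sup>+x. f x * indicator {0<..} (x :: real) \<partial>lborel)"
proof -
  have "AE x in lborel. x \<noteq> (0 :: real)" by (rule AE_lborel_singleton)
  then show ?thesis
    by (intro nn_integral_cong_AE) (auto elim!: eventually_mono simp: indicator_def)
qed

lemma nn_integral_exponential:
  assumes "0 < rate" and [measurable]: "f \<in> borel_measurable borel"
  shows "(\<integral>\<^sup>+e. f e \<partial>exponential rate) = (\<integral>\<^sup>+e. ennreal (rate * exp (- (rate * e))) * f e * indicator {0<..} e \<partial>lborel)"
proof -
  have "(\<integral>\<^sup>+e. f e \<partial>exponential rate) = (\<integral>\<^sup>+e. ennreal (rate * exp (- (rate * e))) * f e * indicator {0..} e \<partial>lborel)"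
    by (subst nn_integral_density)
      (auto intro!: nn_integral_cong simp: exponential_density_def indicator_def mult.commute)
  then show ?thesis by (simp only: nn_integral_Ici_Ioi)
qed

text \<open>A Poisson point at x contributes the factor k x; equivalently, it is marked with
  probability 1 - k x. As k = 1 from b on, the expected number of marked points beyond any given
  time is finite.\<close>

locale thinned_poisson =
  fixes rate :: real and k :: "real \<Rightarrow> real" and b :: real
  assumes rate_pos: "0 < rate" and k_measurable [measurable]: "k \<in> borel_measurable borel"
    and k: "\<And>x. 0 \<le> k x" "\<And>x. k x \<le> 1" "\<And>x. b \<le> x \<Longrightarrow> k x = 1" and b: "0 \<le> b"
begin

definition n :: "real measure" where
  "n = density lborel (\<lambda>x. ennreal (rate * (1 - k x)))"

text \<open>\<open>n\<close> is the intensity of the marked points, so this is the probability that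
  none of them lies beyond a.\<close>

definition q :: "real \<Rightarrow> real" where
  "q a = exp (- measure n {a<..})"

lemma sets_n [simp]: "sets n = sets borel"
  by (simp add: n_def)

lemma emeasure_n:
  "A \<in> sets borel \<Longrightarrow> emeasure n A = (\<integral>\<^sup>+x. ennreal (rate * (1 - k x)) * indicator A x \<partial>lborel)"
  unfolding n_def by (subst emeasure_density) auto

lemma emeasure_n_finite: "emeasure n {a<..} \<noteq> \<infinity>"
proof -
  have "emeasure n {a<..} \<le> (\<integral>\<^sup>+x. ennreal rate * indicator {a..b} x \<partial>lborel)"
    using rate_pos k(1) by (subst emeasure_n, simp, intro nn_integral_mono)
      (auto simp: indicator_def k(3) intro!: ennreal_leI mult_left_le)
  also have "\<dots> < \<infinity>"
    by (auto simp: nn_integral_cmult_indicator ennreal_mult_less_top emeasure_lborel_Icc_eq)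
  finally show ?thesis by simp
qed

lemma q_bounds: "0 < q a" "q a \<le> 1"
  by (auto simp: q_def)

lemma q_eq_1:
  assumes "b \<le> a" shows "q a = 1"
proof -
  have "emeasure n {a<..} = (\<integral>\<^sup>+x. 0 \<partial>(lborel :: real measure))"
    using assms by (subst emeasure_n, simp, intro nn_integral_cong) (auto simp: indicator_def k(3))
  then show ?thesis by (simp add: q_def measure_def)
qed

lemma borel_measurable_q [measurable]: "q \<in> borel_measurable borel"
proof (rule borel_measurable_mono)
  show "mono q"
    unfolding mono_def q_def using emeasure_n_finite
    by (auto intro!: measure_mono_fmeasurable simp: fmeasurable_def less_top[symmetric])
qed

text \<open>Conditioning on the first point a + e. Divided by q a, the integrand against Lebesgue
  measure is the density of a variable with hazard rate \<open>rate * k (a + e)\<close>, whose total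
  mass is 1.\<close>

lemma q_renewal:
  "ennreal (q a) = (\<integral>\<^sup>+e. ennreal (k (a + e)) * ennreal (q (a + e)) \<partial>exponential rate)"
proof -
  define \<kappa> where "\<kappa> e = rate * k (a + e)" for e
  have [measurable]: "\<kappa> \<in> borel_measurable borel" unfolding \<kappa>_def by measurable
  define m where "m = density lborel (\<lambda>x. ennreal (\<kappa> x))"
  have [simp]: "sets m = sets borel" by (simp add: m_def)
  define W where "W x = measure n {x<..}" for x
  have W: "emeasure n {x<..} = ennreal (W x)" for x
    unfolding W_def using emeasure_n_finite[of x] by (intro emeasure_eq_ennreal_measure) simp
  have W0: "0 \<le> W x" for x by (simp add: W_def)
  \<comment> \<open>Marked and unmarked intensities add up to \<open>rate\<close>; the unmarked one
    is the hazard rate.\<close>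
  have hazard: "measure m {0<..e} = rate * e - (W a - W (a + e))" if "0 \<le> e" for e
  proof -
    have "emeasure n {a<..a + e} = (\<integral>\<^sup>+x. ennreal (rate * (1 - k (a + x))) * indicator {0<..e} x \<partial>lborel)"
      by (subst emeasure_n, simp, subst nn_integral_real_affine[where c = 1 and t = a])
        (auto intro!: nn_integral_cong simp: indicator_def)
    moreover have "emeasure m {0<..e} = (\<integral>\<^sup>+x. ennreal (\<kappa> x) * indicator {0<..e} x \<partial>lborel)"
      unfolding m_def by (subst emeasure_density) auto
    ultimately have "emeasure m {0<..e} + emeasure n {a<..a + e} =
        (\<integral>\<^sup>+x. ennreal (\<kappa> x) * indicator {0<..e} x + ennreal (rate * (1 - k (a + x))) * indicator {0<..e} x \<partial>lborel)"
      by (subst nn_integral_add) auto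
    also have "\<dots> = (\<integral>\<^sup>+x. ennreal rate * indicator {0<..e} x \<partial>lborel)"
      using rate_pos k by (intro nn_integral_cong)
        (auto simp: indicator_def \<kappa>_def algebra_simps mult_left_le simp flip: ennreal_plus)
    also have "\<dots> = ennreal (rate * e)"
      using that rate_pos by (simp add: nn_integral_cmult_indicator ennreal_mult)
    finally have sum: "emeasure m {0<..e} + emeasure n {a<..a + e} = ennreal (rate * e)" .
    have "emeasure n {a<..} = emeasure n ({a<..a + e} \<union> {a + e<..})"
      using that by (intro arg_cong[where f = "emeasure n"]) auto
    also have "\<dots> = emeasure n {a<..a + e} + emeasure n {a + e<..}"
      by (rule plus_emeasure[symmetric]) auto
    finally have "emeasure m {0<..e} + ennreal (W a) = ennreal (rate * e) + ennreal (W (a + e))"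
      unfolding W[symmetric] sum[symmetric] by (simp add: ac_simps)
    also have "\<dots> = ennreal (rate * e + W (a + e))"
      using that rate_pos W0 by simp
    finally have eq: "emeasure m {0<..e} + ennreal (W a) = ennreal (rate * e + W (a + e))" .
    then have "emeasure m {0<..e} \<noteq> \<infinity>" by auto
    then have "emeasure m {0<..e} = ennreal (measure m {0<..e})"
      by (intro emeasure_eq_ennreal_measure) simp
    with eq have "ennreal (measure m {0<..e} + W a) = ennreal (rate * e + W (a + e))"
      using W0 by simp
    then show ?thesis
      using that rate_pos W0 by (subst (asm) ennreal_inj) auto
  qed
  have "1 = (\<integral>\<^sup>+e. ennreal (\<kappa> e * exp (- measure m {0<..e})) * indicator {0<..} e \<partial>lborel)"
    unfolding m_def
  proof (rule nn_integral_hazard_rate[symmetric, where L = rate])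
    show "\<exists>x. z \<le> measure (density lborel (\<lambda>x. ennreal (\<kappa> x))) {0<..x}" for z
    proof (rule exI)
      \<comment> \<open>Ensures rate * e - W a \<ge> z, and the left-hand side is a lower bound of
        the cumulative hazard.\<close>
      define e where "e = max 0 ((z + W a) / rate)"
      have "0 \<le> e" by (simp add: e_def)
      have "z + W a \<le> rate * e" using rate_pos by (auto simp: e_def max_def field_simps)
      then show "z \<le> measure (density lborel (\<lambda>x. ennreal (\<kappa> x))) {0<..e}"
        using hazard[OF \<open>0 \<le> e\<close>] W0[of "a + e"] by (simp add: m_def)
    qed
  qed (use rate_pos k in \<open>auto simp: \<kappa>_def mult_left_le\<close>)
  then have "ennreal (q a) = ennreal (exp (- W a)) *
      (\<integral>\<^sup>+e. ennreal (\<kappa> e * exp (- measure m {0<..e})) * indicator {0<..} e \<partial>lborel)"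
    by (simp add: q_def W_def)
  also have "\<dots> = (\<integral>\<^sup>+e. ennreal (exp (- W a)) * (ennreal (\<kappa> e * exp (- (rate * e - (W a - W (a + e))))) * indicator {0<..} e) \<partial>lborel)"
  proof -
    have [measurable]: "(\<lambda>e. exp (- (rate * e - (W a - W (a + e))))) \<in> borel_measurable borel"
    proof -
      have "(\<lambda>e. exp (- (rate * e - (W a - W (a + e))))) = (\<lambda>e. exp (- (rate * e)) * exp (W a) * q (a + e))"
        by (simp add: q_def W_def fun_eq_iff flip: exp_add)
      then show ?thesis by simp
    qed
    have eq: "(\<integral>\<^sup>+e. ennreal (\<kappa> e * exp (- measure m {0<..e})) * indicator {0<..} e \<partial>lborel) =
        (\<integral>\<^sup>+e. ennreal (\<kappa> e * exp (- (rate * e - (W a - W (a + e))))) * indicator {0<..} e \<partial>lborel)"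
      by (intro nn_integral_cong) (simp add: indicator_def hazard)
    show ?thesis unfolding eq by (rule nn_integral_cmult[symmetric]) measurable
  qed
  also have "\<dots> = (\<integral>\<^sup>+e. ennreal (rate * exp (- (rate * e))) * (ennreal (k (a + e)) * ennreal (q (a + e))) * indicator {0<..} e \<partial>lborel)"
  proof (intro nn_integral_cong)
    fix e
    have "exp (- W a) * (\<kappa> e * exp (- (rate * e - (W a - W (a + e))))) =
        rate * exp (- (rate * e)) * (k (a + e) * q (a + e))"
      by (simp add: \<kappa>_def q_def W_def flip: exp_add)
    then have "ennreal (exp (- W a)) * ennreal (\<kappa> e * exp (- (rate * e - (W a - W (a + e))))) =
        ennreal (rate * exp (- (rate * e))) * (ennreal (k (a + e)) * ennreal (q (a + e)))"
      using rate_pos k q_bounds(1)[THEN less_imp_le] by (simp add: \<kappa>_def flip: ennreal_mult)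
    then show "ennreal (exp (- W a)) * (ennreal (\<kappa> e * exp (- (rate * e - (W a - W (a + e))))) * indicator {0<..} e) =
        ennreal (rate * exp (- (rate * e))) * (ennreal (k (a + e)) * ennreal (q (a + e))) * indicator {0<..} e"
      by (simp add: mult.assoc[symmetric])
  qed
  also have "\<dots> = (\<integral>\<^sup>+e. ennreal (k (a + e)) * ennreal (q (a + e)) \<partial>exponential rate)"
    using rate_pos by (rule nn_integral_exponential[symmetric]) measurable
  finally show ?thesis .
qed

text \<open>The probability that a waiting time is at most b. Staying below b for one more step from
  a nonnegative position requires such a waiting time, so this is the contraction factor.\<close>

definition \<rho> :: real where
  "\<rho> = 1 - exp (- (rate * b))"

lemma \<rho>: "0 \<le> \<rho>" "\<rho> < 1"
  using rate_pos b by (auto simp: \<rho>_def)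

lemma emeasure_exponential_b: "emeasure (exponential rate) {..b} = ennreal \<rho>"
  using rate_pos b by (simp add: emeasure_erlang_density erlang_CDF_def \<rho>_def)

text \<open>The iteration starts at 1, above q, and q is a fixed point of the monotone renewal
  operator.\<close>

lemma renewal_prod_lower:
  "ennreal (q a) \<le> renewal_prod (exponential rate) (\<lambda>x. ennreal (k x)) m a"
proof (induction m arbitrary: a)
  case 0
  then show ?case using q_bounds[of a] by simp
next
  case (Suc m)
  show ?case
    unfolding q_renewal[of a] renewal_prod.simps by (intro nn_integral_mono mult_left_mono Suc.IH) simp
qed

text \<open>The iteration contracts because nothing happens after time \<open>b\<close>.\<close>

lemma renewal_prod_upper:
  assumes "0 \<le> a"
  shows "renewal_prod (exponential rate) (\<lambda>x. ennreal (k x)) m a \<le> ennreal (q a) + ennreal (\<rho> ^ m) * indicator {..<b} a"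
  using assms
proof (induction m arbitrary: a)
  case 0
  then show ?case
    using q_eq_1[of a] q_bounds[of a] by (cases "a < b") auto
next
  case (Suc m)
  let ?E = "exponential rate"
  have "renewal_prod ?E (\<lambda>x. ennreal (k x)) (Suc m) a \<le>
      (\<integral>\<^sup>+e. ennreal (k (a + e)) * ennreal (q (a + e)) + ennreal (\<rho> ^ m) * indicator {..<b} a * indicator {..b} e \<partial>?E)"
    unfolding renewal_prod.simps
  proof (rule nn_integral_mono_AE, rule AE_mp[OF AE_exponential_nonneg], rule AE_I2, rule impI)
    fix e :: real assume "0 \<le> e"
    have "ennreal (k (a + e)) * renewal_prod ?E (\<lambda>x. ennreal (k x)) m (a + e) \<le>
        ennreal (k (a + e)) * (ennreal (q (a + e)) + ennreal (\<rho> ^ m) * indicator {..<b} (a + e))"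
      using Suc.prems \<open>0 \<le> e\<close> by (intro mult_left_mono Suc.IH) auto
    also have "\<dots> \<le> ennreal (k (a + e)) * ennreal (q (a + e)) + 1 * (ennreal (\<rho> ^ m) * indicator {..<b} (a + e))"
      unfolding distrib_left using k by (intro add_left_mono mult_right_mono) auto
    \<comment> \<open>From a + e < b with a and e nonnegative, both a < b and e \<le> b
      follow.\<close>
    also have "\<dots> \<le> ennreal (k (a + e)) * ennreal (q (a + e)) + ennreal (\<rho> ^ m) * indicator {..<b} a * indicator {..b} e"
      using Suc.prems \<open>0 \<le> e\<close> by (auto simp: indicator_def)
    finally show "ennreal (k (a + e)) * renewal_prod ?E (\<lambda>x. ennreal (k x)) m (a + e) \<le> \<dots>" .
  qed
  also have "\<dots> = ennreal (q a) + ennreal (\<rho> ^ m) * indicator {..<b} a * ennreal \<rho>"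
    by (subst nn_integral_add) (auto simp: q_renewal[symmetric] nn_integral_cmult emeasure_exponential_b)
  also have "\<dots> = ennreal (q a) + ennreal (\<rho> ^ Suc m) * indicator {..<b} a"
    using \<rho> by (simp add: ennreal_mult mult_ac)
  finally show ?case .
qed

lemma renewal_prod_tendsto:
  "(\<lambda>m. renewal_prod (exponential rate) (\<lambda>x. ennreal (k x)) m 0) \<longlonglongrightarrow>
    ennreal (exp_neg (ennreal rate * (\<integral>\<^sup>+x. ennreal (1 - k x) * indicator {0<..} x \<partial>lborel)))"
proof -
  have "ennreal rate * (\<integral>\<^sup>+x. ennreal (1 - k x) * indicator {0<..} x \<partial>lborel) = emeasure n {0<..}"
    using rate_pos k by (simp add: emeasure_n ennreal_mult mult.assoc nn_integral_cmult)
  also have "exp_neg \<dots> = q 0"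
    using emeasure_n_finite[of 0] by (simp add: exp_neg_def q_def measure_def)
  finally have q: "exp_neg (ennreal rate * (\<integral>\<^sup>+x. ennreal (1 - k x) * indicator {0<..} x \<partial>lborel)) = q 0" .
  show ?thesis
    unfolding q
  proof (rule tendsto_sandwich[where f = "\<lambda>_. ennreal (q 0)"])
    have "(\<lambda>m. ennreal (q 0 + \<rho> ^ m)) \<longlonglongrightarrow> ennreal (q 0 + 0)"
      using \<rho> by (intro tendsto_intros tendsto_ennrealI LIMSEQ_power_zero) auto
    then show "(\<lambda>m. ennreal (q 0 + \<rho> ^ m)) \<longlonglongrightarrow> ennreal (q 0)" by simp
    show "\<forall>\<^sub>F m in sequentially. renewal_prod (exponential rate) (\<lambda>x. ennreal (k x)) m 0 \<le> ennreal (q 0 + \<rho> ^ m)"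
    proof (rule always_eventually, rule allI)
      fix m
      have "renewal_prod (exponential rate) (\<lambda>x. ennreal (k x)) m 0 \<le> ennreal (q 0) + ennreal (\<rho> ^ m) * indicator {..<b} 0"
        by (rule renewal_prod_upper) simp
      also have "\<dots> \<le> ennreal (q 0) + ennreal (\<rho> ^ m)"
        by (auto simp: indicator_def)
      also have "\<dots> = ennreal (q 0 + \<rho> ^ m)"
        using \<rho> q_bounds(1)[of 0] by simp
      finally show "renewal_prod (exponential rate) (\<lambda>x. ennreal (k x)) m 0 \<le> ennreal (q 0 + \<rho> ^ m)" .
    qed
  qed (auto intro!: always_eventually renewal_prod_lower)
qed

end

section \<open>Random walks and subordinators\<close>

lemma (in prob_space) nn_integral_indep_var:
  assumes ind: "indep_var S U R V" and [measurable]: "f \<in> borel_measurable (S \<Otimes>\<^sub>M R)"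
  shows "(\<integral>\<^sup>+w. f (U w, V w) \<partial>M) = (\<integral>\<^sup>+w'. (\<integral>\<^sup>+w. f (U w, V w') \<partial>M) \<partial>M)"
  using ind unfolding indep_var_distribution_eq by (intro nn_integral_indep_law) auto

text \<open>Both the start x and the index j of the first step are general, because splitting off
  one step leaves a walk from x + X j with first step \<open>Suc j\<close>.\<close>

lemma (in prob_space) nn_integral_random_walk:
  fixes X :: "nat \<Rightarrow> 'a \<Rightarrow> real"
  assumes X: "indep_vars (\<lambda>_. borel) X UNIV" and F: "\<And>n. distr M borel (X n) = F"
    and [measurable]: "c \<in> borel_measurable borel"
  shows "(\<integral>\<^sup>+w. (\<Prod>i<m. c (x + (\<Sum>l\<le>i. X (j + l) w))) \<partial>M) = renewal_prod F c m x"
proof (induction m arbitrary: x j)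
  case 0
  then show ?case by (simp add: emeasure_space_1)
next
  case (Suc m)
  have [measurable]: "X n \<in> borel_measurable M" for n
    using X by (simp add: indep_vars_def)
  have "prob_space F"
    unfolding F[of 0, symmetric] by (rule prob_space_distr) simp
  then have [measurable]: "renewal_prod F c m \<in> borel_measurable borel"
    by (intro borel_measurable_renewal_prod prob_space_imp_sigma_finite)
      (simp_all add: F[of 0, symmetric])
  define f where "f = (\<lambda>(p, q). c (x + q j) * (\<Prod>i<m. c (x + q j + (\<Sum>l\<le>i. p (Suc j + l) :: real))))"
  have [measurable]: "f \<in> borel_measurable (PiM {Suc j..} (\<lambda>_. borel) \<Otimes>\<^sub>M PiM {j} (\<lambda>_. borel))"
    unfolding f_def by measurable
  have ind: "indep_var (PiM {Suc j..} (\<lambda>_. borel)) (\<lambda>w. restrict (\<lambda>i. X i w) {Suc j..})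
      (PiM {j} (\<lambda>_. borel)) (\<lambda>w. restrict (\<lambda>i. X i w) {j})"
    by (rule indep_var_restrict[OF X]) auto
  have "(\<integral>\<^sup>+w. (\<Prod>i<Suc m. c (x + (\<Sum>l\<le>i. X (j + l) w))) \<partial>M) =
      (\<integral>\<^sup>+w. f (restrict (\<lambda>i. X i w) {Suc j..}, restrict (\<lambda>i. X i w) {j}) \<partial>M)"
    unfolding f_def
    by (simp add: prod.lessThan_Suc_shift sum.atMost_Suc_shift add.assoc
        del: prod.lessThan_Suc sum.atMost_Suc)
  also have "\<dots> = (\<integral>\<^sup>+w'. (\<integral>\<^sup>+w. f (restrict (\<lambda>i. X i w) {Suc j..}, restrict (\<lambda>i. X i w') {j}) \<partial>M) \<partial>M)"
    using ind by (rule nn_integral_indep_var) measurable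
  also have "\<dots> = (\<integral>\<^sup>+w'. c (x + X j w') * renewal_prod F c m (x + X j w') \<partial>M)"
  proof (rule nn_integral_cong)
    fix w'
    have "(\<integral>\<^sup>+w. f (restrict (\<lambda>i. X i w) {Suc j..}, restrict (\<lambda>i. X i w') {j}) \<partial>M) =
        (\<integral>\<^sup>+w. c (x + X j w') * (\<Prod>i<m. c (x + X j w' + (\<Sum>l\<le>i. X (Suc j + l) w))) \<partial>M)"
      by (simp add: f_def)
    also have "\<dots> = c (x + X j w') * renewal_prod F c m (x + X j w')"
      unfolding Suc.IH[of "x + X j w'" "Suc j", symmetric] by (rule nn_integral_cmult) measurable
    finally show "(\<integral>\<^sup>+w. f (restrict (\<lambda>i. X i w) {Suc j..}, restrict (\<lambda>i. X i w') {j}) \<partial>M) = \<dots>" .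
  qed
  also have "\<dots> = (\<integral>\<^sup>+y. c (x + y) * renewal_prod F c m (x + y) \<partial>distr M borel (X j))"
    by (rule nn_integral_distr[symmetric]) measurable
  finally show ?case by (simp add: F)
qed

section \<open>Subordinators sampled at Poisson times\<close>

text \<open>D is extended by 0 to negative times, so that every path is a monotone function on the
  whole line, the form in which its inverse is treated. The stable index is absent; it enters with
  the Laplace transform, supplied separately.\<close>

locale regular_subordinator = prob_space N for N :: "'a measure" +
  fixes D :: "real \<Rightarrow> 'a \<Rightarrow> real"
  assumes measurable_D: "\<And>r. D r \<in> borel_measurable N"
    and D_nonpos: "\<And>r w. r \<le> 0 \<Longrightarrow> D r w = 0"
    and D_mono: "\<And>r q w. r \<le> q \<Longrightarrow> D r w \<le> D q w"
    and D_grid: "\<And>r w. 0 \<le> r \<Longrightarrow> (\<lambda>n. D (grid n r) w) \<longlonglongrightarrow> D r w"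
    and D_unbounded: "\<And>z w. \<exists>r. z < D r w"
    and independent_increments: "\<And>n (r :: nat \<Rightarrow> real). 0 \<le> r 0 \<Longrightarrow> mono r \<Longrightarrow>
      indep_vars (\<lambda>_. borel) (\<lambda>i w. D (r (Suc i)) w - D (r i) w) {..<n}"
    and stationary_increments: "\<And>r h. 0 \<le> r \<Longrightarrow> 0 \<le> h \<Longrightarrow>
      distr N borel (\<lambda>w. D (r + h) w - D r w) = distr N borel (D h)"
begin

declare measurable_D [measurable]

text \<open>Approximation along the grid reduces joint measurability to fixed times.\<close>

lemma measurable_D_pair [measurable]:
  "(\<lambda>z. D (fst z) (snd z)) \<in> borel_measurable (borel \<Otimes>\<^sub>M N)"
proof (rule borel_measurable_LIMSEQ_real)
  show "(\<lambda>n. D (grid n (fst z)) (snd z)) \<longlonglongrightarrow> D (fst z) (snd z)" for z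
  proof (cases "0 \<le> fst z")
    case False
    \<comment> \<open>For a negative time the floor is at most -1, so the grid point is truncated to
      0, where D vanishes as well.\<close>
    then have "(real n + 1) * fst z < 0" for n
      by (intro mult_pos_neg) auto
    then have "\<lfloor>(real n + 1) * fst z\<rfloor> < 0" for n
      by (simp only: floor_less_zero)
    then have "real_of_int \<lfloor>(real n + 1) * fst z\<rfloor> + 1 \<le> 0" for n
      by (metis add.commute of_int_1 of_int_add of_int_le_0_iff zless_imp_add1_zle)
    then have "grid n (fst z) = 0" for n
      unfolding grid_def by (simp add: divide_le_0_iff)
    then show ?thesis using False by (simp add: D_nonpos)
  qed (rule D_grid)
  show "(\<lambda>z. D (grid n (fst z)) (snd z)) \<in> borel_measurable (borel \<Otimes>\<^sub>M N)" for n
    by (rule measurable_grid_compose[where f = "\<lambda>v z. D v (snd z)"]) measurable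
qed

text \<open>The values up to time r k are sums of earlier increments, hence independent of the
  increment over the final stretch of length e, which has the law of D e by stationarity.\<close>

lemma markov_property:
  fixes r :: "nat \<Rightarrow> real"
  assumes r: "0 \<le> r 0" "mono r" and e: "0 \<le> e"
    and [measurable]: "c \<in> borel_measurable borel" "\<psi> \<in> borel_measurable borel"
  shows "(\<integral>\<^sup>+w. (\<Prod>i\<le>k. c (D (r i) w)) * \<psi> (D (r k + e) w) \<partial>N) =
    (\<integral>\<^sup>+w'. (\<Prod>i\<le>k. c (D (r i) w')) * (\<integral>\<^sup>+w. \<psi> (D (r k) w' + D e w) \<partial>N) \<partial>N)"
proof -
  \<comment> \<open>The times with 0 put in front, so that D (r i) is the sum of the increments 0,
    ..., i; the final stretch has index \<open>Suc k\<close>.\<close>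
  define \<rho> where "\<rho> i = (case i of 0 \<Rightarrow> 0 | Suc i \<Rightarrow> if i \<le> k then r i else r k + e)" for i
  define Y where "Y i w = D (\<rho> (Suc i)) w - D (\<rho> i) w" for i w
  have [measurable]: "Y i \<in> borel_measurable N" for i
    unfolding Y_def by measurable
  have r0: "0 \<le> r i" for i
    using r(1) monoD[OF r(2), of 0 i] by simp
  have "incseq \<rho>"
  proof (rule incseq_SucI)
    fix i show "\<rho> i \<le> \<rho> (Suc i)"
    proof (cases i)
      case 0
      then show ?thesis using r0[of 0] by (simp add: \<rho>_def)
    next
      case (Suc l)
      then show ?thesis
        using monoD[OF r(2), of l "Suc l"] monoD[OF r(2), of l k] e by (auto simp: \<rho>_def not_le le_Suc_eq)
    qed
  qed
  then have ind: "indep_vars (\<lambda>_. borel) Y {..<Suc (Suc k)}"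
    unfolding Y_def[abs_def] by (intro independent_increments) (simp add: \<rho>_def)
  have D_sum: "D (r i) w = (\<Sum>j\<le>i. Y j w)" if "i \<le> k" for i w
  proof -
    have "(\<Sum>j<Suc i. Y j w) = D (\<rho> (Suc i)) w - D (\<rho> 0) w"
      unfolding Y_def by (rule sum_lessThan_telescope)
    then show ?thesis
      using that by (simp add: \<rho>_def D_nonpos lessThan_Suc_atMost)
  qed
  have Y_last: "Y (Suc k) w = D (r k + e) w - D (r k) w" for w
    by (simp add: Y_def \<rho>_def)
  define f where "f = (\<lambda>(q, p). (\<Prod>i\<le>k. c (\<Sum>j\<le>i. p j)) * \<psi> ((\<Sum>j\<le>k. p j) + q (Suc k) :: real))"
  have [measurable]: "f \<in> borel_measurable (PiM {Suc k} (\<lambda>_. borel) \<Otimes>\<^sub>M PiM {..k} (\<lambda>_. borel))"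
  proof -
    have [measurable]: "(\<lambda>z. snd z j) \<in> borel_measurable (PiM {Suc k} (\<lambda>_. borel) \<Otimes>\<^sub>M PiM {..k} (\<lambda>_. borel :: real measure))"
      if "j \<in> {..i}" "i \<in> {..k}" for i j
      using that by (intro measurable_compose[OF measurable_snd measurable_component_singleton]) auto
    have [measurable]: "(\<lambda>z. snd z j) \<in> borel_measurable (PiM {Suc k} (\<lambda>_. borel) \<Otimes>\<^sub>M PiM {..k} (\<lambda>_. borel :: real measure))"
      if "j \<in> {..k}" for j
      using that by (intro measurable_compose[OF measurable_snd measurable_component_singleton]) auto
    show ?thesis
      unfolding f_def split_beta' by measurable
  qed
  have ind2: "indep_var (PiM {Suc k} (\<lambda>_. borel)) (\<lambda>w. restrict (\<lambda>i. Y i w) {Suc k})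
      (PiM {..k} (\<lambda>_. borel)) (\<lambda>w. restrict (\<lambda>i. Y i w) {..k})"
    by (rule indep_var_restrict[OF ind]) auto
  have f_eq: "f (restrict (\<lambda>i. Y i w) {Suc k}, restrict (\<lambda>i. Y i w') {..k}) =
      (\<Prod>i\<le>k. c (D (r i) w')) * \<psi> (D (r k) w' + Y (Suc k) w)" for w w'
    unfolding f_def prod.case by (intro arg_cong2[where f = "(*)"] prod.cong) (auto simp: D_sum)
  have "(\<integral>\<^sup>+w. (\<Prod>i\<le>k. c (D (r i) w)) * \<psi> (D (r k + e) w) \<partial>N) =
      (\<integral>\<^sup>+w. f (restrict (\<lambda>i. Y i w) {Suc k}, restrict (\<lambda>i. Y i w) {..k}) \<partial>N)"
    unfolding f_eq Y_last by simp
  also have "\<dots> = (\<integral>\<^sup>+w'. (\<integral>\<^sup>+w. f (restrict (\<lambda>i. Y i w) {Suc k}, restrict (\<lambda>i. Y i w') {..k}) \<partial>N) \<partial>N)"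
    using ind2 by (rule nn_integral_indep_var) measurable
  also have "\<dots> = (\<integral>\<^sup>+w'. (\<Prod>i\<le>k. c (D (r i) w')) * (\<integral>\<^sup>+w. \<psi> (D (r k) w' + D e w) \<partial>N) \<partial>N)"
  proof (rule nn_integral_cong)
    fix w'
    have "(\<integral>\<^sup>+w. f (restrict (\<lambda>i. Y i w) {Suc k}, restrict (\<lambda>i. Y i w') {..k}) \<partial>N) =
        (\<Prod>i\<le>k. c (D (r i) w')) * (\<integral>\<^sup>+w. \<psi> (D (r k) w' + Y (Suc k) w) \<partial>N)"
      unfolding f_eq by (rule nn_integral_cmult) measurable
    also have "(\<integral>\<^sup>+w. \<psi> (D (r k) w' + Y (Suc k) w) \<partial>N) =
        (\<integral>\<^sup>+y. \<psi> (D (r k) w' + y) \<partial>distr N borel (Y (Suc k)))"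
      by (rule nn_integral_distr[symmetric]) measurable
    also have "distr N borel (Y (Suc k)) = distr N borel (D e)"
      unfolding Y_last[abs_def] using r0 e by (rule stationary_increments)
    also have "(\<integral>\<^sup>+y. \<psi> (D (r k) w' + y) \<partial>distr N borel (D e)) = (\<integral>\<^sup>+w. \<psi> (D (r k) w' + D e w) \<partial>N)"
      by (rule nn_integral_distr) measurable
    finally show "(\<integral>\<^sup>+w. f (restrict (\<lambda>i. Y i w) {Suc k}, restrict (\<lambda>i. Y i w') {..k}) \<partial>N) =
      (\<Prod>i\<le>k. c (D (r i) w')) * (\<integral>\<^sup>+w. \<psi> (D (r k) w' + D e w) \<partial>N)" .
  qed
  finally show ?thesis .
qed

definition at_exponential :: "real \<Rightarrow> real measure" where
  "at_exponential rate = distr (exponential rate \<Otimes>\<^sub>M N) borel (\<lambda>z. D (fst z) (snd z))"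

lemma sets_at_exponential [simp, measurable_cong]: "sets (at_exponential rate) = sets borel"
  by (simp add: at_exponential_def)

context
  fixes rate :: real
  assumes rate: "0 < rate"
begin

interpretation E: prob_space "exponential rate"
  using rate by (rule prob_space_exponential_density)

interpretation EN: pair_sigma_finite "exponential rate" N ..

lemma measurable_D_pair_exponential [measurable]:
  "(\<lambda>z. D (fst z) (snd z)) \<in> borel_measurable (exponential rate \<Otimes>\<^sub>M N)"
  using measurable_D_pair by (simp cong: measurable_cong_sets sets_pair_measure_cong)

lemma prob_space_at_exponential: "prob_space (at_exponential rate)"
proof -
  interpret EN: pair_prob_space "exponential rate" N ..
  show ?thesis
    unfolding at_exponential_def by (rule EN.prob_space_distr) measurable
qed

lemma nn_integral_at_exponential:
  assumes [measurable]: "f \<in> borel_measurable borel"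
  shows "(\<integral>\<^sup>+y. f y \<partial>at_exponential rate) = (\<integral>\<^sup>+e. (\<integral>\<^sup>+w. f (D e w) \<partial>N) \<partial>exponential rate)"
proof -
  have "(\<integral>\<^sup>+y. f y \<partial>at_exponential rate) = (\<integral>\<^sup>+z. f (D (fst z) (snd z)) \<partial>(exponential rate \<Otimes>\<^sub>M N))"
    unfolding at_exponential_def by (rule nn_integral_distr) measurable
  also have "\<dots> = (\<integral>\<^sup>+e. (\<integral>\<^sup>+w. f (D e w) \<partial>N) \<partial>exponential rate)"
    by (subst nn_integral_fst[symmetric]) simp_all
  finally show ?thesis .
qed

lemma measurable_renewal_prod_path [measurable]:
  assumes [measurable]: "c \<in> borel_measurable borel"
  shows "(\<lambda>z. renewal_prod (exponential rate) (\<lambda>a. c (D a (snd z))) m (fst z)) \<in> borel_measurable (borel \<Otimes>\<^sub>M N)"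
proof (induction m)
  case (Suc m)
  have [measurable]: "(\<lambda>z. (fst (fst z) + snd z, snd (fst z))) \<in> (borel \<Otimes>\<^sub>M N) \<Otimes>\<^sub>M exponential rate \<rightarrow>\<^sub>M (borel :: real measure) \<Otimes>\<^sub>M N"
    by (simp cong: measurable_cong_sets sets_pair_measure_cong) measurable
  have "(\<lambda>z. c (D (fst (fst z) + snd z) (snd (fst z))) * renewal_prod (exponential rate) (\<lambda>a. c (D a (snd (fst z)))) m (fst (fst z) + snd z))
      \<in> borel_measurable ((borel \<Otimes>\<^sub>M N) \<Otimes>\<^sub>M exponential rate)"
    using measurable_compose[OF _ Suc.IH, of "\<lambda>z. (fst (fst z) + snd z, snd (fst z))" "(borel \<Otimes>\<^sub>M N) \<Otimes>\<^sub>M exponential rate"]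
      measurable_compose[OF _ measurable_D_pair, of "\<lambda>z. (fst (fst z) + snd z, snd (fst z))" "(borel \<Otimes>\<^sub>M N) \<Otimes>\<^sub>M exponential rate"]
    by simp
  then show ?case
    unfolding renewal_prod.simps by (intro E.borel_measurable_nn_integral) (simp add: split_beta')
qed simp

text \<open>Sampling the subordinator at the points of an independent Poisson process yields a random
  walk whose steps are distributed as the value at an exponential time.\<close>

lemma nn_integral_renewal_prod_path:
  fixes r :: "nat \<Rightarrow> real"
  assumes [measurable]: "c \<in> borel_measurable borel" and r: "0 \<le> r 0" "mono r"
  shows "(\<integral>\<^sup>+w. (\<Prod>i\<le>k. c (D (r i) w)) * renewal_prod (exponential rate) (\<lambda>a. c (D a w)) m (r k) \<partial>N) =
    (\<integral>\<^sup>+w. (\<Prod>i\<le>k. c (D (r i) w)) * renewal_prod (at_exponential rate) c m (D (r k) w) \<partial>N)"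
  using r
\<comment> \<open>The factors at r 0, ..., r k are carried along so that the Markov property can be
  applied at r k; k and r vary because every step appends a sampling time.\<close>
proof (induction m arbitrary: k r)
  case (Suc m)
  let ?E = "exponential rate" and ?Q = "at_exponential rate"
  define \<Xi> where "\<Xi> w = (\<Prod>i\<le>k. c (D (r i) w))" for w
  have [measurable]: "\<Xi> \<in> borel_measurable N"
    unfolding \<Xi>_def by measurable
  have [measurable]: "renewal_prod ?Q c m \<in> borel_measurable borel"
    using prob_space_at_exponential by (intro borel_measurable_renewal_prod prob_space_imp_sigma_finite) auto
  let ?p = "\<lambda>e w. c (D (r k + e) w) * renewal_prod ?E (\<lambda>a. c (D a w)) m (r k + e)"
  let ?v = "\<lambda>x. c x * renewal_prod ?Q c m x"
  let ?V = "\<lambda>e w. \<integral>\<^sup>+w'. ?v (D (r k) w + D e w') \<partial>N"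
  have p_meas: "(\<lambda>z. ?p (fst z) (snd z)) \<in> borel_measurable (?E \<Otimes>\<^sub>M N)"
  proof -
    have *: "(\<lambda>z. (r k + fst z, snd z)) \<in> ?E \<Otimes>\<^sub>M N \<rightarrow>\<^sub>M borel \<Otimes>\<^sub>M N"
      by (simp cong: measurable_cong_sets sets_pair_measure_cong)
    show ?thesis
      using measurable_compose[OF * measurable_renewal_prod_path[of c m]] measurable_compose[OF * measurable_D_pair]
      by simp
  qed
  have "(\<integral>\<^sup>+w. \<Xi> w * renewal_prod ?E (\<lambda>a. c (D a w)) (Suc m) (r k) \<partial>N) =
      (\<integral>\<^sup>+w. (\<integral>\<^sup>+e. \<Xi> w * ?p e w \<partial>?E) \<partial>N)"
  proof (rule nn_integral_cong)
    fix w assume "w \<in> space N"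
    then have "(\<lambda>e. ?p e w) \<in> borel_measurable ?E"
      using measurable_compose[OF measurable_Pair2' p_meas, of w] by simp
    then show "\<Xi> w * renewal_prod ?E (\<lambda>a. c (D a w)) (Suc m) (r k) = (\<integral>\<^sup>+e. \<Xi> w * ?p e w \<partial>?E)"
      unfolding renewal_prod.simps by (rule nn_integral_cmult[symmetric])
  qed
  \<comment> \<open>The exchange fixes the waiting time e, which makes r k + e a deterministic time
    that can be appended for the induction hypothesis.\<close>
  also have "\<dots> = (\<integral>\<^sup>+e. (\<integral>\<^sup>+w. \<Xi> w * ?p e w \<partial>N) \<partial>?E)"
    using p_meas by (intro EN.Fubini') (simp add: split_beta')
  also have "\<dots> = (\<integral>\<^sup>+e. (\<integral>\<^sup>+w. \<Xi> w * ?V e w \<partial>N) \<partial>?E)"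
  proof (rule nn_integral_cong_AE, rule AE_mp[OF AE_exponential_nonneg], rule AE_I2, rule impI)
    fix e :: real assume "0 \<le> e"
    define r' where "r' i = (if i \<le> k then r i else r k + e)" for i
    have "r i \<le> r k + e" if "i \<le> k" for i
      using incseqD[OF Suc.prems(2) that] \<open>0 \<le> e\<close> by simp
    then have "incseq r'"
      using incseqD[OF Suc.prems(2)] by (auto simp: incseq_def r'_def)
    have r'_k: "r' (Suc k) = r k + e" by (simp add: r'_def)
    have \<Xi>': "(\<Prod>i\<le>Suc k. c (D (r' i) w)) = \<Xi> w * c (D (r k + e) w)" for w
      unfolding \<Xi>_def prod.atMost_Suc r'_k
      by (intro arg_cong2[where f = "(*)"] prod.cong) (auto simp: r'_def)
    have "(\<integral>\<^sup>+w. \<Xi> w * ?p e w \<partial>N) =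
        (\<integral>\<^sup>+w. (\<Prod>i\<le>Suc k. c (D (r' i) w)) * renewal_prod ?E (\<lambda>a. c (D a w)) m (r' (Suc k)) \<partial>N)"
      unfolding \<Xi>' r'_k by (simp add: mult.assoc)
    also have "\<dots> = (\<integral>\<^sup>+w. (\<Prod>i\<le>Suc k. c (D (r' i) w)) * renewal_prod ?Q c m (D (r' (Suc k)) w) \<partial>N)"
      using Suc.prems(1) by (intro Suc.IH \<open>incseq r'\<close>) (simp add: r'_def)
    also have "\<dots> = (\<integral>\<^sup>+w. \<Xi> w * ?v (D (r k + e) w) \<partial>N)"
      unfolding \<Xi>' r'_k by (simp add: mult.assoc)
    also have "\<dots> = (\<integral>\<^sup>+w. \<Xi> w * ?V e w \<partial>N)"
      unfolding \<Xi>_def by (rule markov_property[OF Suc.prems \<open>0 \<le> e\<close>]) measurable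
    finally show "(\<integral>\<^sup>+w. \<Xi> w * ?p e w \<partial>N) = \<dots>" .
  qed
  also have "\<dots> = (\<integral>\<^sup>+w. (\<integral>\<^sup>+e. \<Xi> w * ?V e w \<partial>?E) \<partial>N)"
  proof (rule EN.Fubini'[symmetric])
    have [measurable]: "(\<lambda>x. D (fst (fst x)) (snd x)) \<in> borel_measurable ((?E \<Otimes>\<^sub>M N) \<Otimes>\<^sub>M N)"
      using measurable_compose[OF _ measurable_D_pair_exponential, of "\<lambda>x. (fst (fst x), snd x)" "(?E \<Otimes>\<^sub>M N) \<Otimes>\<^sub>M N"]
      by simp
    have "(\<lambda>x. D (r k) (snd (fst x)) + D (fst (fst x)) (snd x)) \<in> borel_measurable ((?E \<Otimes>\<^sub>M N) \<Otimes>\<^sub>M N)"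
      by measurable
    moreover have "?v \<in> borel_measurable borel" by measurable
    ultimately have "(\<lambda>x. ?v (D (r k) (snd (fst x)) + D (fst (fst x)) (snd x))) \<in> borel_measurable ((?E \<Otimes>\<^sub>M N) \<Otimes>\<^sub>M N)"
      by (rule measurable_compose)
    then have "(\<lambda>z. \<integral>\<^sup>+w'. ?v (D (r k) (snd z) + D (fst z) w') \<partial>N) \<in> borel_measurable (?E \<Otimes>\<^sub>M N)"
      by (intro borel_measurable_nn_integral) (simp add: split_beta')
    moreover have "(\<lambda>z. \<Xi> (snd z)) \<in> borel_measurable (?E \<Otimes>\<^sub>M N)"
      by measurable
    ultimately have "(\<lambda>z. \<Xi> (snd z) * (\<integral>\<^sup>+w'. ?v (D (r k) (snd z) + D (fst z) w') \<partial>N)) \<in> borel_measurable (?E \<Otimes>\<^sub>M N)"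
      by (intro borel_measurable_times_ennreal)
    then show "(\<lambda>(e, w). \<Xi> w * ?V e w) \<in> borel_measurable (?E \<Otimes>\<^sub>M N)"
      by (simp only: split_beta')
  qed
  also have "\<dots> = (\<integral>\<^sup>+w. \<Xi> w * renewal_prod ?Q c (Suc m) (D (r k) w) \<partial>N)"
  proof (rule nn_integral_cong)
    fix w
    have "(\<integral>\<^sup>+e. \<Xi> w * ?V e w \<partial>?E) =
        \<Xi> w * (\<integral>\<^sup>+e. ?V e w \<partial>?E)"
      by (rule nn_integral_cmult) measurable
    also have "(\<integral>\<^sup>+e. ?V e w \<partial>?E) = (\<integral>\<^sup>+y. ?v (D (r k) w + y) \<partial>?Q)"
      by (rule nn_integral_at_exponential[symmetric]) measurable
    finally show "(\<integral>\<^sup>+e. \<Xi> w * ?V e w \<partial>?E) =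
        \<Xi> w * renewal_prod ?Q c (Suc m) (D (r k) w)" by simp
  qed
  finally show ?case by (simp only: \<Xi>_def)
qed simp

end

end

section \<open>Uniqueness of Laplace transforms\<close>

text \<open>Multiplied by exp (- n x), the monomial of degree k in exp (- x) is the Laplace kernel
  at n + k.\<close>

lemma integral_exp_poly_eq:
  fixes M1 M2 :: "real measure"
  assumes M: "real_distribution M1" "real_distribution M2"
    and nonneg: "AE x in M1. 0 \<le> x" "AE x in M2. 0 \<le> x"
    and eq: "\<And>k :: nat. (\<integral>x. exp (- (real n + real k) * x) \<partial>M1) = (\<integral>x. exp (- (real n + real k) * x) \<partial>M2)"
    and p: "real_polynomial_function p"
  shows "(\<integral>x. exp (- real n * x) * p (exp (- x)) \<partial>M1) = (\<integral>x. exp (- real n * x) * p (exp (- x)) \<partial>M2)"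
proof -
  obtain a N where p: "p = (\<lambda>y. \<Sum>i\<le>N. a i * y ^ i)"
    using p unfolding real_polynomial_function_iff_sum by blast
  have *: "(\<integral>x. exp (- real n * x) * p (exp (- x)) \<partial>R) =
      (\<Sum>i\<le>N. a i * (\<integral>x. exp (- (real n + real i) * x) \<partial>R))"
    if "real_distribution R" "AE x in R. 0 \<le> x" for R
  proof -
    interpret R: real_distribution R by fact
    have int: "integrable R (\<lambda>x. exp (- (real n + real i) * x))" for i
      using that(2) by (intro R.integrable_const_bound[where B = 1]) (auto elim!: eventually_mono simp: mult_nonpos_nonneg)
    have "(\<lambda>x. exp (- real n * x) * p (exp (- x))) = (\<lambda>x. \<Sum>i\<le>N. a i * exp (- (real n + real i) * x))"
      by (simp add: p fun_eq_iff sum_distrib_left exp_of_nat_mult[symmetric] exp_add[symmetric] algebra_simps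
          flip: exp_add)
    then show ?thesis
      using int by simp
  qed
  show ?thesis
    using *[OF M(1) nonneg(1)] *[OF M(2) nonneg(2)] eq by simp
qed

text \<open>For x \<ge> 0 the point exp (- x) lies in [0,1], where Weierstrass approximation
  applies; the weight exp (- n x) is at most 1 and does not enlarge the error.\<close>

lemma integral_exp_continuous_eq:
  fixes M1 M2 :: "real measure"
  assumes M: "real_distribution M1" "real_distribution M2"
    and nonneg: "AE x in M1. 0 \<le> x" "AE x in M2. 0 \<le> x"
    and eq: "\<And>k :: nat. (\<integral>x. exp (- (real n + real k) * x) \<partial>M1) = (\<integral>x. exp (- (real n + real k) * x) \<partial>M2)"
    and \<phi>: "continuous_on UNIV \<phi>"
  shows "(\<integral>x. exp (- real n * x) * \<phi> (exp (- x)) \<partial>M1) = (\<integral>x. exp (- real n * x) * \<phi> (exp (- x)) \<partial>M2)"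
    (is "?I M1 \<phi> = ?I M2 \<phi>")
proof -
  have [measurable]: "\<phi> \<in> borel_measurable borel"
    using \<phi> by (rule borel_measurable_continuous_onI)
  have close: "\<bar>?I M1 \<phi> - ?I M2 \<phi>\<bar> \<le> 2 * e" if "e > 0" for e
  proof -
    obtain p where p: "real_polynomial_function p" "\<And>y. y \<in> {0..1} \<Longrightarrow> \<bar>\<phi> y - p y\<bar> < e"
      using Stone_Weierstrass_real_polynomial_function[of "{0..1 :: real}" \<phi> e] \<phi> \<open>e > 0\<close>
      by (metis compact_Icc continuous_on_subset subset_UNIV)
    have "continuous_on UNIV p"
      using p(1) by (simp add: continuous_on_eq_continuous_within continuous_real_polymonial_function)
    then have [measurable]: "p \<in> borel_measurable borel"
      by (rule borel_measurable_continuous_onI)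
    have diff: "\<bar>?I R \<phi> - ?I R p\<bar> \<le> e" if "real_distribution R" "AE x in R. 0 \<le> x" for R
    proof -
      interpret R: real_distribution R by fact
      obtain b where b: "\<And>y. y \<in> {0..1} \<Longrightarrow> \<bar>\<phi> y\<bar> \<le> b"
      proof -
        have "bounded (\<phi> ` {0..1})"
          using \<phi> by (intro compact_imp_bounded compact_continuous_image) (auto intro: continuous_on_subset)
        then obtain a where "\<forall>z\<in>\<phi> ` {0..1}. norm z \<le> a" unfolding bounded_iff by blast
        then show ?thesis using that[of a] by (metis imageI real_norm_def)
      qed
      have AE1: "AE x in R. 0 < exp (- x) \<and> exp (- x) \<le> 1 \<and> exp (- real n * x) \<le> 1"
        using that(2) by eventually_elim auto
      have i1: "integrable R (\<lambda>x. exp (- real n * x) * \<phi> (exp (- x)))"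
      proof (rule R.integrable_const_bound[where B = b])
        show "AE x in R. norm (exp (- real n * x) * \<phi> (exp (- x))) \<le> b"
          using AE1
        proof eventually_elim
          case (elim x)
          then have "\<bar>\<phi> (exp (- x))\<bar> \<le> b" by (intro b) auto
          then have "exp (- real n * x) * \<bar>\<phi> (exp (- x))\<bar> \<le> 1 * b"
            using elim by (intro mult_mono) auto
          then show ?case by (simp add: abs_mult)
        qed
      qed measurable
      have i2: "integrable R (\<lambda>x. exp (- real n * x) * p (exp (- x)))"
      proof (rule R.integrable_const_bound[where B = "b + e"])
        show "AE x in R. norm (exp (- real n * x) * p (exp (- x))) \<le> b + e"
          using AE1
        proof eventually_elim
          case (elim x)
          then have "\<bar>\<phi> (exp (- x))\<bar> \<le> b" by (intro b) auto
          moreover have "\<bar>\<phi> (exp (- x)) - p (exp (- x))\<bar> < e"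
            using elim by (intro p(2)) auto
          ultimately have "\<bar>p (exp (- x))\<bar> \<le> b + e" by linarith
          then have "exp (- real n * x) * \<bar>p (exp (- x))\<bar> \<le> 1 * (b + e)"
            using elim by (intro mult_mono) auto
          then show ?case by (simp add: abs_mult)
        qed
      qed measurable
      have "\<bar>?I R \<phi> - ?I R p\<bar> = \<bar>\<integral>x. exp (- real n * x) * (\<phi> (exp (- x)) - p (exp (- x))) \<partial>R\<bar>"
        using Bochner_Integration.integral_diff[OF i1 i2] by (simp add: right_diff_distrib)
      also have "\<dots> \<le> (\<integral>x. \<bar>exp (- real n * x) * (\<phi> (exp (- x)) - p (exp (- x)))\<bar> \<partial>R)"
        by (rule integral_abs_bound)
      also have "\<dots> \<le> e"
      proof (rule R.integral_le_const)
        show "integrable R (\<lambda>x. \<bar>exp (- real n * x) * (\<phi> (exp (- x)) - p (exp (- x)))\<bar>)"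
          using Bochner_Integration.integrable_diff[OF i1 i2] by (simp add: right_diff_distrib)
        show "AE x in R. \<bar>exp (- real n * x) * (\<phi> (exp (- x)) - p (exp (- x)))\<bar> \<le> e"
          using AE1
        proof eventually_elim
          case (elim x)
          then have "\<bar>\<phi> (exp (- x)) - p (exp (- x))\<bar> < e" by (intro p(2)) auto
          then have "exp (- real n * x) * \<bar>\<phi> (exp (- x)) - p (exp (- x))\<bar> \<le> 1 * e"
            using elim by (intro mult_mono) auto
          then show ?case by (simp add: abs_mult)
        qed
      qed
      finally show ?thesis .
    qed
    have "?I M1 p = ?I M2 p"
      by (rule integral_exp_poly_eq[OF M nonneg eq p(1)])
    then show ?thesis
      using diff[OF M(1) nonneg(1)] diff[OF M(2) nonneg(2)] by linarith
  qed
  show ?thesis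
  proof (rule ccontr)
    assume "?I M1 \<phi> \<noteq> ?I M2 \<phi>"
    then have "0 < \<bar>?I M1 \<phi> - ?I M2 \<phi>\<bar> / 4" by simp
    moreover have "\<not> (0 < d / 4 \<and> d \<le> 2 * (d / 4))" for d :: real by linarith
    ultimately show False using close by blast
  qed
qed

text \<open>Since the transforms agree only from u0 on, the measures are weighted by exp (- n x)
  with n \<ge> u0. The weighted measures have the same distribution function, and the positive
  weight can be divided out.\<close>

lemma laplace_transform_unique:
  fixes M1 M2 :: "real measure"
  assumes M: "real_distribution M1" "real_distribution M2"
    and nonneg: "AE x in M1. 0 \<le> x" "AE x in M2. 0 \<le> x"
    and eq: "\<And>u. u0 \<le> u \<Longrightarrow> (\<integral>x. exp (- u * x) \<partial>M1) = (\<integral>x. exp (- u * x) \<partial>M2)"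
  shows "M1 = M2"
proof -
  interpret M1: real_distribution M1 by fact
  interpret M2: real_distribution M2 by fact
  define n where "n = nat \<lceil>u0\<rceil>"
  have n: "u0 \<le> real n" unfolding n_def by linarith
  \<comment> \<open>The maximum bounds the weight by 1 on the negative half-line too, so the
    weighted measures are finite; almost everywhere it changes nothing.\<close>
  define w where "w x = exp (- real n * max 0 x)" for x :: real
  have [measurable]: "w \<in> borel_measurable borel" unfolding w_def by measurable
  have w: "0 < w x" "w x \<le> 1" for x by (auto simp: w_def)
  \<comment> \<open>A continuous function of y = exp (- x) that is 1 for x \<le> a and, for k > 0,
    falls to 0 over a range of y of length 1 / k.\<close>
  define \<psi> where "\<psi> a k y = min 1 (max 0 (1 + real k * (y - exp (- a))))" for a y :: real and k :: nat
  have \<psi>_lim: "(\<lambda>k. \<psi> a k (exp (- x))) \<longlonglongrightarrow> indicator {..a} x" for a x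
  proof (cases "x \<le> a")
    case True
    then have "\<psi> a k (exp (- x)) = 1" for k by (simp add: \<psi>_def)
    with True show ?thesis by simp
  next
    case False
    define d where "d = exp (- a) - exp (- x)"
    have "d > 0" using False by (simp add: d_def)
    have "\<psi> a k (exp (- x)) = 0" if "nat \<lceil>1 / d\<rceil> \<le> k" for k
    proof -
      have "1 / d \<le> real k" using that by linarith
      then have "1 \<le> real k * d" using \<open>d > 0\<close> by (simp add: divide_le_eq)
      then have "1 + real k * (exp (- x) - exp (- a)) \<le> 0" by (simp add: d_def algebra_simps)
      then show ?thesis by (simp add: \<psi>_def)
    qed
    then show ?thesis
      using False by (intro tendsto_eventually eventually_sequentiallyI[of "nat \<lceil>1 / d\<rceil>"]) simp
  qed
  have lim: "(\<lambda>k. \<integral>x. exp (- real n * x) * \<psi> a k (exp (- x)) \<partial>R) \<longlonglongrightarrow> (\<integral>x. w x * indicator {..a} x \<partial>R)"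
    if "real_distribution R" "AE x in R. 0 \<le> x" for R a
  proof -
    interpret R: real_distribution R by fact
    show ?thesis
    proof (rule integral_dominated_convergence[where w = "\<lambda>_. 1"])
      show "(\<lambda>x. w x * indicator {..a} x) \<in> borel_measurable R" by measurable
      show "(\<lambda>x. exp (- real n * x) * \<psi> a k (exp (- x))) \<in> borel_measurable R" for k
        unfolding \<psi>_def by measurable
      show "AE x in R. (\<lambda>k. exp (- real n * x) * \<psi> a k (exp (- x))) \<longlonglongrightarrow> w x * indicator {..a} x"
        using that(2) by eventually_elim (simp add: w_def tendsto_mult_left \<psi>_lim)
      show "AE x in R. norm (exp (- real n * x) * \<psi> a k (exp (- x))) \<le> 1" for k
        using that(2)
      proof eventually_elim
        case (elim x)
        have "\<bar>exp (- real n * x) * \<psi> a k (exp (- x))\<bar> \<le> 1 * 1"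
          unfolding abs_mult using elim by (intro mult_mono) (auto simp: \<psi>_def)
        then show ?case by simp
      qed
    qed simp
  qed
  have cdf_eq: "(\<integral>x. w x * indicator {..a} x \<partial>M1) = (\<integral>x. w x * indicator {..a} x \<partial>M2)" for a
  proof (rule LIMSEQ_unique[OF lim[OF M(1) nonneg(1)]])
    have "(\<integral>x. exp (- real n * x) * \<psi> a k (exp (- x)) \<partial>M1) = (\<integral>x. exp (- real n * x) * \<psi> a k (exp (- x)) \<partial>M2)" for k
      using n unfolding \<psi>_def
      by (intro integral_exp_continuous_eq[OF M nonneg] eq continuous_intros) auto
    then show "(\<lambda>k. \<integral>x. exp (- real n * x) * \<psi> a k (exp (- x)) \<partial>M1) \<longlonglongrightarrow> (\<integral>x. w x * indicator {..a} x \<partial>M2)"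
      using lim[OF M(2) nonneg(2), of a] by simp
  qed
  define W where "W R = density R (\<lambda>x. ennreal (w x))" for R
  have fin: "finite_borel_measure (W R)" if "real_distribution R" for R
  proof -
    interpret R: real_distribution R by fact
    have "emeasure (W R) UNIV = (\<integral>\<^sup>+x. ennreal (w x) \<partial>R)"
      unfolding W_def by (subst emeasure_density) auto
    also have "\<dots> \<le> (\<integral>\<^sup>+x. 1 \<partial>R)"
      using w by (intro nn_integral_mono) simp
    also have "\<dots> < \<infinity>"
      using R.emeasure_space_1 by simp
    finally show ?thesis
      by (intro finite_borel_measure.intro finite_measureI finite_borel_measure_axioms.intro) (auto simp: W_def)
  qed
  have cdf: "cdf (W R) a = (\<integral>x. w x * indicator {..a} x \<partial>R)" if "real_distribution R" for R a
  proof -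
    interpret R: real_distribution R by fact
    have "emeasure (W R) {..a} = (\<integral>\<^sup>+x. ennreal (w x * indicator {..a} x) \<partial>R)"
      unfolding W_def by (subst emeasure_density) (auto intro!: nn_integral_cong simp: indicator_def)
    also have "\<dots> = ennreal (\<integral>x. w x * indicator {..a} x \<partial>R)"
      using w by (intro nn_integral_eq_integral R.integrable_const_bound[where B = 1])
        (auto simp: indicator_def less_imp_le)
    finally show ?thesis
      using w by (simp add: cdf_def measure_def less_imp_le)
  qed
  have "W M1 = W M2"
    using cdf[OF M(1)] cdf[OF M(2)] cdf_eq by (intro cdf_unique' fin M) (simp add: fun_eq_iff)
  moreover have "density (W R) (\<lambda>x. ennreal (1 / w x)) = R" if "real_distribution R" for R
  proof -
    interpret R: real_distribution R by fact
    have "density (W R) (\<lambda>x. ennreal (1 / w x)) = density R (\<lambda>x. ennreal (w x) * ennreal (1 / w x))"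
      unfolding W_def by (rule density_density_eq) measurable
    also have "(\<lambda>x. ennreal (w x) * ennreal (1 / w x)) = (\<lambda>x. 1)"
      using w by (simp add: fun_eq_iff less_imp_le less_imp_neq[symmetric] flip: ennreal_mult)
    finally show ?thesis by (simp add: density_1)
  qed
  ultimately show ?thesis
    using M by metis
qed

section \<open>Mittag-Leffler waiting times and the inverse subordinator\<close>

text \<open>The Gamma integral under the scaling of the variable by u.\<close>

lemma nn_integral_powr_exp:
  assumes u: "0 < u" and a: "0 \<le> a"
  shows "(\<integral>\<^sup>+x. ennreal (u * exp (- (u * x)) * x powr a) * indicator {0<..} x \<partial>lborel) =
    ennreal (Gamma (1 + a) / u powr a)"
proof -
  let ?f = "\<lambda>x. ennreal (u * exp (- (u * x)) * x powr a)"
  have "ennreal (Gamma (1 + a)) = (\<integral>\<^sup>+x. ennreal (indicator {0..} x * x powr a / exp x) \<partial>lborel)"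
    using Gamma_conv_nn_integral_real[of "1 + a"] a by simp
  also have "\<dots> = ennreal u * (\<integral>\<^sup>+x. ennreal (indicator {0..} (u * x) * (u * x) powr a / exp (u * x)) \<partial>lborel)"
    using u by (subst nn_integral_real_affine[where c = u and t = 0]) auto
  also have "\<dots> = (\<integral>\<^sup>+x. ennreal u * ennreal (indicator {0..} (u * x) * (u * x) powr a / exp (u * x)) \<partial>lborel)"
    by (rule nn_integral_cmult[symmetric]) measurable
  also have "\<dots> = (\<integral>\<^sup>+x. ennreal (u powr a) * ?f x * indicator {0..} x \<partial>lborel)"
  proof (rule nn_integral_cong)
    fix x
    show "ennreal u * ennreal (indicator {0..} (u * x) * (u * x) powr a / exp (u * x)) =
        ennreal (u powr a) * ?f x * indicator {0..} x"
    proof (cases "0 \<le> x")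
      case True
      then have "u * (indicator {0..} (u * x) * (u * x) powr a / exp (u * x)) = u powr a * (u * exp (- (u * x)) * x powr a)"
        using u by (simp add: powr_mult exp_minus field_simps)
      then show ?thesis
        using True u by (simp flip: ennreal_mult)
    next
      case False
      then have "\<not> 0 \<le> u * x" using u by (simp add: zero_le_mult_iff)
      then show ?thesis using False by simp
    qed
  qed
  also have "\<dots> = (\<integral>\<^sup>+x. ennreal (u powr a) * ?f x * indicator {0<..} x \<partial>lborel)"
    by (rule nn_integral_Ici_Ioi)
  also have "\<dots> = ennreal (u powr a) * (\<integral>\<^sup>+x. ?f x * indicator {0<..} x \<partial>lborel)"
    unfolding mult.assoc by (rule nn_integral_cmult) measurable
  finally have eq: "ennreal (Gamma (1 + a)) = ennreal (u powr a) * (\<integral>\<^sup>+x. ?f x * indicator {0<..} x \<partial>lborel)" .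
  have "ennreal (Gamma (1 + a) / u powr a) = ennreal (1 / u powr a) * ennreal (Gamma (1 + a))"
    using a u by (subst ennreal_mult[symmetric]) (auto intro!: Gamma_real_nonneg)
  also have "\<dots> = ennreal (1 / u powr a) * ennreal (u powr a) * (\<integral>\<^sup>+x. ?f x * indicator {0<..} x \<partial>lborel)"
    unfolding eq by (simp add: mult.assoc)
  also have "ennreal (1 / u powr a) * ennreal (u powr a) = 1"
    using u by (subst ennreal_mult[symmetric]) auto
  finally show ?thesis by simp
qed

lemma has_bochner_integral_powr_exp:
  fixes u a :: real
  assumes u: "0 < u" and a: "0 \<le> a"
  shows "has_bochner_integral lborel (\<lambda>x. indicator {0<..} x * (u * exp (- (u * x)) * x powr a)) (Gamma (1 + a) / u powr a)"
proof (rule has_bochner_integral_nn_integral)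
  show "(\<integral>\<^sup>+x. ennreal (indicator {0<..} x * (u * exp (- (u * x)) * x powr a)) \<partial>lborel) = ennreal (Gamma (1 + a) / u powr a)"
    unfolding nn_integral_powr_exp[OF assms, symmetric] by (intro nn_integral_cong) (simp add: indicator_def)
qed (use u a in \<open>auto intro!: Gamma_real_nonneg divide_nonneg_nonneg\<close>)

lemma mittag_leffler_0: "mittag_leffler \<beta> 0 = 1"
proof -
  have "mittag_leffler \<beta> 0 = (\<Sum>k\<in>{0}. 0 ^ k / Gamma (1 + \<beta> * real k))"
    unfolding mittag_leffler_def by (rule suminf_finite) auto
  then show ?thesis by simp
qed

text \<open>The Gamma factors cancel, so the k-th term integrates to (- \<theta>)^k with \<theta> =
  rate / u powr \<beta>. Absolute convergence of this geometric series is the origin of the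
  condition on u.\<close>

lemma mittag_leffler_laplace:
  assumes \<beta>: "0 < \<beta>" and rate: "0 < rate" and u: "0 < u" "rate < u powr \<beta>"
  shows "has_bochner_integral lborel
    (\<lambda>x. indicator {0<..} x * (u * exp (- (u * x)) * mittag_leffler \<beta> (- rate * x powr \<beta>)))
    (u powr \<beta> / (u powr \<beta> + rate))"
proof -
  let ?G = "\<lambda>k. Gamma (1 + \<beta> * real k)"
  define \<theta> where "\<theta> = rate / u powr \<beta>"
  have \<theta>: "0 < \<theta>" "\<theta> < 1" using u rate by (auto simp: \<theta>_def)
  define F where "F k x = indicator {0<..} x * (u * exp (- (u * x)) * ((- rate * x powr \<beta>) ^ k / ?G k))" for k :: nat and x
  have Gamma_pos: "0 < ?G k" for k
    using \<beta> by (intro Gamma_real_pos) (simp add: add_pos_nonneg)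
  have F_eq: "F k x = (- rate) ^ k / ?G k * (indicator {0<..} x * (u * exp (- (u * x)) * x powr (\<beta> * real k)))" for k x
  proof (cases "0 < x")
    case True
    then have "(x powr \<beta>) ^ k = x powr (\<beta> * real k)"
      by (simp add: powr_power mult.commute)
    then have "(- rate * x powr \<beta>) ^ k = (- rate) ^ k * x powr (\<beta> * real k)"
      using power_mult_distrib[of "- rate" "x powr \<beta>" k] by simp
    then show ?thesis by (simp add: F_def)
  qed (simp add: F_def)
  have norm_F: "norm (F k x) = rate ^ k / ?G k * (indicator {0<..} x * (u * exp (- (u * x)) * x powr (\<beta> * real k)))" for k x
    unfolding F_eq using rate u Gamma_pos[of k] by (simp add: abs_mult power_abs indicator_def)
  have u_powr: "u powr (\<beta> * real k) = (u powr \<beta>) ^ k" for k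
    using u by (simp add: powr_power mult.commute)
  have base: "has_bochner_integral lborel (\<lambda>x. indicator {0<..} x * (u * exp (- (u * x)) * x powr (\<beta> * real k)))
      (?G k / (u powr \<beta>) ^ k)" for k
    using has_bochner_integral_powr_exp[of u "\<beta> * real k"] u \<beta> by (simp add: u_powr)
  have int_F: "has_bochner_integral lborel (F k) ((- \<theta>) ^ k)" for k
  proof -
    have "(- rate) ^ k / ?G k * (?G k / (u powr \<beta>) ^ k) = (- \<theta>) ^ k"
      using Gamma_pos[of k] by (simp add: \<theta>_def power_divide[symmetric])
    then show ?thesis
      using has_bochner_integral_mult_right[OF base[of k], of "(- rate) ^ k / ?G k"]
      unfolding F_eq[abs_def] by simp
  qed
  have int_norm_F: "has_bochner_integral lborel (\<lambda>x. norm (F k x)) (\<theta> ^ k)" for k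
  proof -
    have "rate ^ k / ?G k * (?G k / (u powr \<beta>) ^ k) = \<theta> ^ k"
      using Gamma_pos[of k] by (simp add: \<theta>_def power_divide[symmetric])
    then show ?thesis
      using has_bochner_integral_mult_right[OF base[of k], of "rate ^ k / ?G k"]
      unfolding norm_F by simp
  qed
  have integrable_F: "integrable lborel (F k)" and [measurable]: "F k \<in> borel_measurable borel" for k
    using int_F[of k] by (auto simp: has_bochner_integral_iff)
  have summable_int: "summable (\<lambda>k. \<integral>x. norm (F k x) \<partial>lborel)"
    using int_norm_F \<theta> by (simp add: has_bochner_integral_iff summable_geometric)
  \<comment> \<open>Convergence almost everywhere is read off from the finite integral of the sum of
    the norms, a geometric series in \<theta>.\<close>
  have AE_summable: "AE x in lborel. summable (\<lambda>k. norm (F k x))"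
  proof -
    have "(\<integral>\<^sup>+x. (\<Sum>k. ennreal (norm (F k x))) \<partial>lborel) = (\<Sum>k. \<integral>\<^sup>+x. ennreal (norm (F k x)) \<partial>lborel)"
      by (rule nn_integral_suminf) measurable
    also have "\<dots> = (\<Sum>k. ennreal (\<theta> ^ k))"
    proof (intro suminf_cong)
      show "(\<integral>\<^sup>+x. ennreal (norm (F k x)) \<partial>lborel) = ennreal (\<theta> ^ k)" for k
        using int_norm_F[of k] by (subst nn_integral_eq_integral) (auto simp: has_bochner_integral_iff)
    qed
    also have "\<dots> \<noteq> \<infinity>"
      using \<theta> by (subst suminf_ennreal_eq[OF _ geometric_sums]) auto
    finally have "AE x in lborel. (\<Sum>k. ennreal (norm (F k x))) \<noteq> \<infinity>"
      by (intro nn_integral_PInf_AE) auto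
    then show ?thesis
      by eventually_elim (auto intro: summable_suminf_not_top)
  qed
  have "has_bochner_integral lborel (\<lambda>x. \<Sum>k. F k x) (\<Sum>k. (- \<theta>) ^ k)"
    using integrable_suminf[OF integrable_F AE_summable summable_int]
      integral_suminf[OF integrable_F AE_summable summable_int] int_F
    by (simp add: has_bochner_integral_iff)
  moreover have "(\<Sum>k. (- \<theta>) ^ k) = u powr \<beta> / (u powr \<beta> + rate)"
    using \<theta> u by (subst suminf_geometric) (auto simp: \<theta>_def field_simps)
  moreover have "(\<Sum>k. F k x) = indicator {0<..} x * (u * exp (- (u * x)) * mittag_leffler \<beta> (- rate * x powr \<beta>))"
    if "summable (\<lambda>k. norm (F k x))" for x
  proof (cases "0 < x")
    case True
    have "summable (\<lambda>k. u * exp (- (u * x)) * ((- rate * x powr \<beta>) ^ k / ?G k))"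
      using summable_norm_cancel[OF that] True by (simp add: F_def)
    then have "summable (\<lambda>k. (- rate * x powr \<beta>) ^ k / ?G k)"
      using u by (subst (asm) summable_cmult_iff) simp
    from suminf_mult[OF this, of "u * exp (- (u * x))"] show ?thesis
      using True by (simp add: F_def mittag_leffler_def)
  qed (simp add: F_def)
  ultimately show ?thesis
    using AE_summable
    by (subst has_bochner_integral_cong_AE[where g = "\<lambda>x. \<Sum>k. F k x"])
      (auto elim!: eventually_mono simp: mittag_leffler_def)
qed

text \<open>exp (- u X) is the integral of u exp (- u x) over x \<ge> X; by Fubini its expectation
  is the integral of u exp (- u x) against one minus the tail. Positivity comes from the tail 1 at t
  = 0.\<close>

lemma (in prob_space) mittag_leffler_distribution:
  assumes \<beta>: "0 < \<beta>" and rate: "0 < rate" and [measurable]: "X \<in> borel_measurable M"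
    and tail: "\<And>t. 0 \<le> t \<Longrightarrow> prob {w \<in> space M. t < X w} = mittag_leffler \<beta> (- rate * t powr \<beta>)"
  shows mittag_leffler_pos: "AE w in M. 0 < X w"
    and laplace_mittag_leffler: "0 < u \<Longrightarrow> rate < u powr \<beta> \<Longrightarrow>
      (\<integral>w. exp (- u * X w) \<partial>M) = rate / (rate + u powr \<beta>)"
proof -
  have "prob {w \<in> space M. 0 < X w} = 1"
    using tail[of 0] \<beta> by (simp add: mittag_leffler_0)
  then show pos: "AE w in M. 0 < X w"
    by (intro AE_I_eq_1) (auto simp: emeasure_eq_measure)
  assume u: "0 < u" "rate < u powr \<beta>"
  let ?f = "\<lambda>x. u * exp (- (u * x))" and ?m = "\<lambda>x. mittag_leffler \<beta> (- rate * x powr \<beta>)"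
  \<comment> \<open>The factor x powr 0 is 1 for x > 0; it makes the Gamma integral with exponent 0
    apply verbatim.\<close>
  let ?g = "\<lambda>x. indicator {0<..} x * (?f x * x powr 0) - indicator {0<..} x * (?f x * ?m x)"
  have "(\<integral>\<^sup>+w. ennreal (exp (- u * X w)) \<partial>M) =
      (\<integral>\<^sup>+w. (\<integral>\<^sup>+x. ennreal (?f x) * indicator {0<..} x * indicator {p. X (fst p) \<le> snd p} (w, x) \<partial>lborel) \<partial>M)"
  proof (rule nn_integral_cong_AE, rule AE_mp[OF pos], rule AE_I2, rule impI)
    fix w assume "0 < X w"
    have "ennreal (exp (- u * X w)) = (\<integral>\<^sup>+x. ennreal (?f x) * indicator {X w..} x \<partial>lborel)"
      using nn_integral_exp_rate_atLeast[OF u(1), of "X w"] by simp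
    also have "\<dots> = (\<integral>\<^sup>+x. ennreal (?f x) * indicator {0<..} x * indicator {p. X (fst p) \<le> snd p} (w, x) \<partial>lborel)"
      using \<open>0 < X w\<close> by (intro nn_integral_cong) (auto simp: indicator_def)
    finally show "ennreal (exp (- u * X w)) = \<dots>" .
  qed
  also have "\<dots> = (\<integral>\<^sup>+x. (\<integral>\<^sup>+w. ennreal (?f x) * indicator {0<..} x * indicator {p. X (fst p) \<le> snd p} (w, x) \<partial>M) \<partial>lborel)"
  proof -
    interpret pair_sigma_finite M lborel ..
    show ?thesis by (rule Fubini'[symmetric]) measurable
  qed
  also have "\<dots> = (\<integral>\<^sup>+x. ennreal (?g x) \<partial>lborel)"
  proof (rule nn_integral_cong)
    fix x :: real
    show "(\<integral>\<^sup>+w. ennreal (?f x) * indicator {0<..} x * indicator {p. X (fst p) \<le> snd p} (w, x) \<partial>M) =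
        ennreal (?g x)"
    proof (cases "0 < x")
      case True
      have "(\<integral>\<^sup>+w. ennreal (?f x) * indicator {0<..} x * indicator {p. X (fst p) \<le> snd p} (w, x) \<partial>M) =
          (\<integral>\<^sup>+w. ennreal (?f x) * indicator {w \<in> space M. X w \<le> x} w \<partial>M)"
        using True by (intro nn_integral_cong) (auto simp: indicator_def)
      also have "\<dots> = ennreal (?f x) * emeasure M {w \<in> space M. X w \<le> x}"
        by (rule nn_integral_cmult_indicator) measurable
      also have "{w \<in> space M. X w \<le> x} = space M - {w \<in> space M. x < X w}"
        by auto
      also have "emeasure M \<dots> = ennreal (1 - ?m x)"
        using prob_compl[of "{w \<in> space M. x < X w}"] tail[of x] True by (simp add: emeasure_eq_measure)
      finally show ?thesis
        using True u tail[of x, symmetric] by (simp add: right_diff_distrib flip: ennreal_mult)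
    qed simp
  qed
  also have "\<dots> = ennreal (\<integral>x. ?g x \<partial>lborel)"
  proof (rule nn_integral_eq_integral)
    show "integrable lborel (\<lambda>x. ?g x)"
      using has_bochner_integral_powr_exp[of u 0] mittag_leffler_laplace[OF \<beta> rate u] u
      by (intro Bochner_Integration.integrable_diff) (auto simp only: has_bochner_integral_iff order_refl)
    show "AE x in lborel. 0 \<le> ?g x"
    proof (rule AE_I2)
      fix x :: real
      have "?f x * ?m x \<le> ?f x * 1" if "0 < x"
        using that u tail[of x, symmetric] by (intro mult_left_mono) auto
      then show "0 \<le> ?g x"
        by (simp add: indicator_def)
    qed
  qed
  also have "(\<integral>x. ?g x \<partial>lborel) =
      Gamma (1 + 0) / u powr 0 - u powr \<beta> / (u powr \<beta> + rate)"
    using has_bochner_integral_diff[OF has_bochner_integral_powr_exp[of u 0] mittag_leffler_laplace[OF \<beta> rate u]] u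
    by (simp only: has_bochner_integral_iff order_refl)
  also have "\<dots> = rate / (rate + u powr \<beta>)"
    using u rate by (simp add: field_simps)
  finally have nn: "(\<integral>\<^sup>+w. ennreal (exp (- u * X w)) \<partial>M) = ennreal (rate / (rate + u powr \<beta>))" .
  have "integrable M (\<lambda>w. exp (- u * X w))"
    using pos u by (intro integrable_const_bound[where B = 1]) (auto elim!: eventually_mono)
  then have "(\<integral>\<^sup>+w. ennreal (exp (- u * X w)) \<partial>M) = ennreal (\<integral>w. exp (- u * X w) \<partial>M)"
    by (rule nn_integral_eq_integral) simp
  then have "ennreal (\<integral>w. exp (- u * X w) \<partial>M) = ennreal (rate / (rate + u powr \<beta>))"
    by (simp only: nn)
  then show "(\<integral>w. exp (- u * X w) \<partial>M) = rate / (rate + u powr \<beta>)"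
    using rate u by (subst (asm) ennreal_inj) auto
qed

section \<open>The Stieltjes measure of an inverse path\<close>

text \<open>The times r > 0 with d r \<le> b fill (0, Y b] except possibly its right end point, so
  both measures give (a, b] the mass Y b - Y a. Jumps of d turn into flat stretches of Y.\<close>

lemma interval_measure_inverse:
  fixes d :: "real \<Rightarrow> real"
  defines "Y \<equiv> \<lambda>b. Inf {r. 0 \<le> r \<and> b < d r}"
  assumes nonpos: "\<And>r. r \<le> 0 \<Longrightarrow> d r = 0" and "mono d" and unbounded: "\<And>z. \<exists>r. z < d r"
  shows "interval_measure Y = distr (density lborel (indicator {0<..})) borel d"
proof -
  have [measurable]: "d \<in> borel_measurable borel"
    using \<open>mono d\<close> by (rule borel_measurable_mono)
  have ne: "{r. 0 \<le> r \<and> b < d r} \<noteq> {}" for b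
  proof -
    obtain r where "max b 0 < d r" using unbounded by blast
    then have "0 \<le> r" using nonpos[of r] by (cases "r \<le> 0") auto
    with \<open>max b 0 < d r\<close> show ?thesis by auto
  qed
  have bdd: "bdd_below {r. 0 \<le> r \<and> b < d r}" for b
    by (rule bdd_belowI[of _ 0]) auto
  have Y0: "0 \<le> Y b" for b
    unfolding Y_def using ne by (intro cInf_greatest) auto
  have Y_mono: "Y a \<le> Y b" if "a \<le> b" for a b
    unfolding Y_def using that ne bdd by (intro cInf_superset_mono) auto
  have Y_le: "Y b \<le> r" if "0 \<le> r" "b < d r" for b r
    unfolding Y_def using that bdd by (intro cInf_lower) auto
  \<comment> \<open>The strict inequality in Y gives right-continuity: a < d r persists for
    arguments slightly larger than a.\<close>
  have Y_cont: "continuous (at_right a) Y" for a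
    unfolding continuous_within
  proof (rule order_tendstoI)
    fix y assume "y < Y a"
    then show "\<forall>\<^sub>F x in at_right a. y < Y x"
      using Y_mono by (auto simp: eventually_at_filter intro!: always_eventually less_le_trans[of y "Y a"])
  next
    fix y assume "Y a < y"
    then obtain r where r: "0 \<le> r" "a < d r" "r < y"
      using cInf_less_iff[OF ne bdd, of a y] unfolding Y_def by auto
    have "\<forall>\<^sub>F x in at_right a. x < d r"
      using r(2) by (intro eventually_at_rightI[of a "d r"]) auto
    then show "\<forall>\<^sub>F x in at_right a. Y x < y"
      by eventually_elim (use r Y_le in \<open>force intro: le_less_trans\<close>)
  qed
  let ?R = "distr (density lborel (indicator {0<..})) borel d"
  have below: "emeasure lborel {r. 0 < r \<and> d r \<le> b} = ennreal (Y b)" for b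
  proof (rule antisym)
    have "{r. 0 < r \<and> d r \<le> b} \<subseteq> {0<..Y b}"
    proof safe
      fix r assume r: "0 < r" "d r \<le> b"
      show "r \<in> {0<..Y b}"
      proof (rule ccontr)
        assume "r \<notin> {0<..Y b}"
        then have "Y b < r" using r by simp
        then obtain q where "b < d q" "q < r"
          using cInf_less_iff[OF ne bdd, of b r] unfolding Y_def by auto
        then show False using monoD[OF \<open>mono d\<close>, of q r] r by simp
      qed
    qed
    then have "emeasure lborel {r. 0 < r \<and> d r \<le> b} \<le> emeasure lborel {0<..Y b}"
      by (rule emeasure_mono) simp
    then show "emeasure lborel {r. 0 < r \<and> d r \<le> b} \<le> ennreal (Y b)"
      using Y0[of b] by simp
    have "{0<..<Y b} \<subseteq> {r. 0 < r \<and> d r \<le> b}"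
    proof safe
      fix r assume r: "r \<in> {0<..<Y b}"
      show "0 < r" using r by simp
      show "d r \<le> b"
      proof (rule ccontr)
        assume "\<not> d r \<le> b"
        then show False using Y_le[of r b] r by auto
      qed
    qed
    then have "emeasure lborel {0<..<Y b} \<le> emeasure lborel {r. 0 < r \<and> d r \<le> b}"
      by (rule emeasure_mono) simp
    then show "ennreal (Y b) \<le> emeasure lborel {r. 0 < r \<and> d r \<le> b}"
      using Y0[of b] by simp
  qed
  have R: "emeasure ?R {a<..b} = ennreal (Y b - Y a)" if "a \<le> b" for a b
  proof -
    have "emeasure ?R {a<..b} = emeasure (density lborel (indicator {0<..})) (d -` {a<..b})"
      by (subst emeasure_distr) auto
    also have "\<dots> = (\<integral>\<^sup>+r. indicator ({r. 0 < r \<and> d r \<le> b} - {r. 0 < r \<and> d r \<le> a}) r \<partial>lborel)"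
    proof -
      have [measurable]: "d -` {a<..b} \<in> sets borel"
        by (rule measurable_sets_borel[where M = borel]) auto
      show ?thesis
        by (subst emeasure_density, simp, simp, intro nn_integral_cong) (auto simp: indicator_def)
    qed
    also have "\<dots> = emeasure lborel ({r. 0 < r \<and> d r \<le> b} - {r. 0 < r \<and> d r \<le> a})"
      by (rule nn_integral_indicator) measurable
    also have "\<dots> = emeasure lborel {r. 0 < r \<and> d r \<le> b} - emeasure lborel {r. 0 < r \<and> d r \<le> a}"
      using that by (intro emeasure_Diff) (auto simp: below)
    also have "\<dots> = ennreal (Y b - Y a)"
      using Y0[of a] by (simp add: below ennreal_minus)
    finally show ?thesis .
  qed
  show ?thesis
  proof (rule measure_eqI_generator_eq[where \<Omega> = UNIV])
    show "Int_stable (range (\<lambda>(a, b). {a<..b::real}))"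
      by (auto simp: Int_stable_def)
    show "emeasure (interval_measure Y) X = emeasure ?R X" if X: "X \<in> range (\<lambda>(a, b). {a<..b::real})" for X
    proof -
      obtain a b where X: "X = {a<..b}" using X by auto
      show ?thesis
        using R[of a b] emeasure_interval_measure_Ioc[of a b Y] Y_mono Y_cont by (cases "a \<le> b") (auto simp: X)
    qed
    show "(\<Union>i. {- real (i::nat)<..real i}) = UNIV"
      by (rule UN_Ioc_eq_UNIV)
    show "emeasure (interval_measure Y) {- real i<..real i} \<noteq> \<infinity>" for i :: nat
      using Y_mono Y_cont by (subst emeasure_interval_measure_Ioc) auto
  qed (auto simp: borel_sigma_sets_Ioc)
qed

section \<open>Fractional Poisson processes\<close>

lemma renewal_prod_le_1:
  assumes "prob_space F" and c: "\<And>x. c x \<le> 1"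
  shows "renewal_prod F c m x \<le> 1"
proof (induction m arbitrary: x)
  case (Suc m)
  interpret prob_space F by fact
  have "renewal_prod F c (Suc m) x \<le> (\<integral>\<^sup>+y. 1 * 1 \<partial>F)"
    unfolding renewal_prod.simps by (intro nn_integral_mono mult_mono c Suc.IH) auto
  then show ?case by (simp add: emeasure_space_1)
qed simp

text \<open>exp (- D n) has expectation exp (- n), so its infimum over n has expectation 0 and
  vanishes almost surely: D is unbounded already along the integers.\<close>

lemma stable_subordinator_unbounded:
  assumes D: "stable_subordinator N \<beta> D"
  shows "AE w in N. \<forall>z. \<exists>r\<ge>0. z < D r w"
proof -
  let ?e = "\<lambda>n w. ennreal (exp (- D (real n) w))"
  interpret prob_space N using D by (simp add: stable_subordinator_def)
  have [measurable]: "D (real n) \<in> borel_measurable N" for n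
    using D by (simp add: stable_subordinator_def)
  have lap: "(\<integral>w. exp (- D (real n) w) \<partial>N) = exp (- real n)" for n
  proof -
    have "\<forall>r\<ge>0. \<forall>u\<ge>0. (\<integral>w. exp (- u * D r w) \<partial>N) = exp (- r * u powr \<beta>)"
      using D by (simp add: stable_subordinator_def)
    from this[rule_format, of "real n" 1] show ?thesis by simp
  qed
  have "(\<integral>\<^sup>+w. (INF n. ?e n w) \<partial>N) \<le> ennreal (exp (- real n))" for n
  proof -
    \<comment> \<open>A function that is not integrable would have integral 0, not exp (-
      n).\<close>
    have "integrable N (\<lambda>w. exp (- D (real n) w))"
      using lap[of n] by (metis exp_not_eq_zero not_integrable_integral_eq)
    then have "(\<integral>\<^sup>+w. ?e n w \<partial>N) = ennreal (exp (- real n))"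
      unfolding lap[symmetric] by (rule nn_integral_eq_integral) simp
    moreover have "(\<integral>\<^sup>+w. (INF n. ?e n w) \<partial>N) \<le> (\<integral>\<^sup>+w. ?e n w \<partial>N)"
      by (intro nn_integral_mono INF_lower) simp
    ultimately show ?thesis by simp
  qed
  moreover have "(\<lambda>n. ennreal (exp (- real n))) \<longlonglongrightarrow> ennreal 0"
    by (intro tendsto_ennrealI filterlim_compose[OF exp_at_bot]
        filterlim_compose[OF filterlim_uminus_at_bot_at_top] filterlim_real_sequentially)
  ultimately have "(\<integral>\<^sup>+w. (INF n. ?e n w) \<partial>N) \<le> ennreal 0"
    by (intro LIMSEQ_le_const) auto
  then have "(\<integral>\<^sup>+w. (INF n. ?e n w) \<partial>N) = 0" by simp
  then have "AE w in N. (INF n. ?e n w) = 0"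
    by (subst (asm) nn_integral_0_iff_AE) auto
  then show ?thesis
  proof eventually_elim
    case (elim w)
    show ?case
    proof
      fix z :: real
      have "(INF n. ?e n w) < ennreal (exp (- z))"
        using elim by simp
      then obtain n where "?e n w < ennreal (exp (- z))"
        by (auto simp: INF_less_iff)
      then have "z < D (real n) w" by (simp add: ennreal_less_iff)
      then show "\<exists>r\<ge>0. z < D r w" by (intro exI[of _ "real n"]) simp
    qed
  qed
qed

text \<open>The exceptional null set is removed so that all path properties hold everywhere.\<close>

lemma stable_subordinator_regular:
  assumes D: "stable_subordinator N \<beta> D"
  obtains D' where "regular_subordinator N D'" "AE w in N. \<forall>r\<ge>0. D' r w = D r w"
proof -
  interpret prob_space N using D by (simp add: stable_subordinator_def)
  have D_meas [measurable]: "0 \<le> r \<Longrightarrow> D r \<in> borel_measurable N" for r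
    using D by (simp add: stable_subordinator_def)
  let ?P = "\<lambda>w. D 0 w = 0 \<and> mono_on {0..} (\<lambda>r. D r w) \<and>
    (\<forall>r\<ge>0. continuous (at_right r) (\<lambda>q. D q w)) \<and> (\<forall>z. \<exists>r\<ge>0. z < D r w)"
  have "AE w in N. D 0 w = 0 \<and> mono_on {0..} (\<lambda>r. D r w) \<and>
      (\<forall>r\<ge>0. continuous (at_right r) (\<lambda>q. D q w))"
    using D by (simp add: stable_subordinator_def)
  then have "AE w in N. ?P w"
    using stable_subordinator_unbounded[OF D] by eventually_elim blast
  then obtain Z where Z: "{w \<in> space N. \<not> ?P w} \<subseteq> Z" "emeasure N Z = 0" "Z \<in> sets N"
    by (rule AE_E)
  define good where "good = space N - Z"
  have [measurable]: "good \<in> sets N" using Z by (simp add: good_def)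
  have good: "?P w" if "w \<in> good" for w
  proof -
    have "w \<in> space N" "w \<notin> Z" using that by (auto simp: good_def)
    then show ?thesis using Z(1) by blast
  qed
  have AE_good: "AE w in N. w \<in> good"
    using Z by (intro AE_I[of _ _ Z]) (auto simp: good_def)
  \<comment> \<open>On the exceptional set the path is the identity for positive times, which has
    all the path properties.\<close>
  define D' where "D' r w = (if r \<le> 0 then 0 else if w \<in> good then D r w else r)" for r w
  have D'_good: "D' r w = D r w" if "w \<in> good" "0 \<le> r" for r w
    using good[OF that(1)] that by (cases "r = 0") (auto simp: D'_def)
  have [measurable]: "D' r \<in> borel_measurable N" for r
    unfolding D'_def[abs_def] by (cases "r \<le> 0") simp_all
  have AE_eq: "AE w in N. \<forall>r\<ge>0. D' r w = D r w"
    using AE_good by eventually_elim (simp add: D'_good)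
  have distr_eq: "distr N borel (\<lambda>w. D' q w - D' r w) = distr N borel (\<lambda>w. D q w - D r w)"
    if "0 \<le> q" "0 \<le> r" for q r
    using that AE_eq by (intro distr_cong_AE) (auto elim: eventually_mono)
  have "regular_subordinator N D'"
  proof unfold_locales
    show "D' r \<in> borel_measurable N" for r by measurable
    show "D' r w = 0" if "r \<le> 0" for r w using that by (simp add: D'_def)
    show "D' r w \<le> D' q w" if "r \<le> q" for r q w
    proof (cases "w \<in> good")
      case True
      then have mono: "D a w \<le> D b w" if "0 \<le> a" "a \<le> b" for a b
        using good[OF True] that by (auto simp: mono_on_def)
      have "D 0 w = 0" using good[OF True] by simp
      then show ?thesis
        using True that mono[of 0 q] mono[of r q] by (auto simp: D'_def)
    qed (use that in \<open>auto simp: D'_def\<close>)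
    show "(\<lambda>n. D' (grid n r) w) \<longlonglongrightarrow> D' r w" if "0 \<le> r" for r w
    proof (cases "w \<in> good")
      case True
      have "((\<lambda>q. D q w) \<longlongrightarrow> D r w) (at_right r)"
        using good[OF True] that by (simp add: continuous_within)
      then have "(\<lambda>n. D (grid n r) w) \<longlonglongrightarrow> D r w"
        by (rule filterlim_compose[OF _ filterlim_grid[OF that]])
      then show ?thesis using True that by (simp add: D'_good)
    next
      case False
      then have "D' q w = q" if "0 \<le> q" for q using that by (simp add: D'_def)
      moreover have "(\<lambda>n. grid n r) \<longlonglongrightarrow> r"
        using filterlim_grid[OF that] by (simp add: filterlim_at)
      ultimately show ?thesis using that by simp
    qed
    show "\<exists>r. z < D' r w" for z w
    proof (cases "w \<in> good")
      case True
      then obtain r where "0 \<le> r" "z < D r w" using good by blast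
      then show ?thesis using True by (auto simp: D'_good intro!: exI[of _ r])
    next
      case False
      then show ?thesis by (intro exI[of _ "\<bar>z\<bar> + 1"]) (auto simp: D'_def)
    qed
    show "distr N borel (\<lambda>w. D' (r + h) w - D' r w) = distr N borel (D' h)"
      if "0 \<le> r" "0 \<le> h" for r h
    proof -
      have "distr N borel (\<lambda>w. D' (r + h) w - D' r w) = distr N borel (\<lambda>w. D (r + h) w - D r w)"
        using that by (intro distr_eq) auto
      also have "\<dots> = distr N borel (D h)"
        using D that by (simp add: stable_subordinator_def)
      also have "\<dots> = distr N borel (D' h)"
        using that AE_eq by (intro distr_cong_AE) (auto elim: eventually_mono)
      finally show ?thesis .
    qed
    show "indep_vars (\<lambda>_. borel) (\<lambda>i w. D' (r (Suc i)) w - D' (r i) w) {..<n}"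
      if r: "0 \<le> r 0" "mono r" for n and r :: "nat \<Rightarrow> real"
    proof -
      have r0: "0 \<le> r i" for i
        using r(1) monoD[OF r(2), of 0 i] by simp
      have D_ind: "indep_vars (\<lambda>_. borel) (\<lambda>i w. D (r (Suc i)) w - D (r i) w) {..<n}"
        using D r unfolding stable_subordinator_def by blast
      show ?thesis
      \<comment> \<open>Independence is a property of the joint law and thus survives a change on a
        null set; its characterisation by the law asks for a nonempty index set.\<close>
      proof (cases "n = 0")
        case True
        then show ?thesis by (simp add: indep_vars_def indep_sets_def)
      next
        case False
        then have ne: "{..<n} \<noteq> {}" by auto
        have "distr N (PiM {..<n} (\<lambda>_. borel)) (\<lambda>w. \<lambda>i\<in>{..<n}. D' (r (Suc i)) w - D' (r i) w) =
            distr N (PiM {..<n} (\<lambda>_. borel)) (\<lambda>w. \<lambda>i\<in>{..<n}. D (r (Suc i)) w - D (r i) w)"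
          using AE_eq r0 by (intro distr_cong_AE) (auto elim!: eventually_mono intro!: measurable_restrict)
        also have "\<dots> = PiM {..<n} (\<lambda>i. distr N borel (\<lambda>w. D (r (Suc i)) w - D (r i) w))"
          using D_ind r0 by (subst (asm) indep_vars_iff_distr_eq_PiM[OF ne]) auto
        also have "\<dots> = PiM {..<n} (\<lambda>i. distr N borel (\<lambda>w. D' (r (Suc i)) w - D' (r i) w))"
          using r0 by (simp add: distr_eq)
        finally show ?thesis
          by (subst indep_vars_iff_distr_eq_PiM[OF ne]) auto
      qed
    qed
  qed
  then show ?thesis using AE_eq by (rule that)
qed

text \<open>Averaging exp (- r * a) over an exponential time r gives rate / (rate + a). For a stable
  subordinator a = u powr \<beta>, which yields the transform of the Mittag-Leffler law.\<close>

lemma (in regular_subordinator) laplace_at_exponential: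
  assumes rate: "0 < rate" and u: "0 \<le> u"
    and lap: "\<And>r. 0 \<le> r \<Longrightarrow> (\<integral>w. exp (- u * D r w) \<partial>N) = exp (- r * a)" and a: "0 \<le> a"
  shows "(\<integral>x. exp (- u * x) \<partial>at_exponential rate) = rate / (rate + a)"
    and AE_at_exponential_nonneg: "AE x in at_exponential rate. 0 \<le> x"
proof -
  interpret Q: prob_space "at_exponential rate"
    using rate by (rule prob_space_at_exponential)
  have D_nonneg: "0 \<le> D r w" for r w
    using D_mono[of "min r 0" r w] D_nonpos[of "min r 0" w] by simp
  have "(\<integral>\<^sup>+x. indicator {..<0} x \<partial>at_exponential rate) = 0"
  proof -
    have "\<not> D e w < 0" for e w using D_nonneg[of e w] by simp
    then show ?thesis
      by (subst nn_integral_at_exponential[OF rate]) (simp_all add: indicator_def)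
  qed
  then have "emeasure (at_exponential rate) {..<0} = 0" by simp
  then show nonneg: "AE x in at_exponential rate. 0 \<le> x"
    by (intro AE_I[of _ _ "{..<0}"]) auto
  have "(\<integral>\<^sup>+x. ennreal (exp (- u * x)) \<partial>at_exponential rate) =
      (\<integral>\<^sup>+e. (\<integral>\<^sup>+w. ennreal (exp (- u * D e w)) \<partial>N) \<partial>exponential rate)"
    by (rule nn_integral_at_exponential[OF rate]) measurable
  also have "\<dots> = (\<integral>\<^sup>+e. ennreal (exp (- e * a)) \<partial>exponential rate)"
  proof (rule nn_integral_cong_AE, rule AE_mp[OF AE_exponential_nonneg], rule AE_I2, rule impI)
    fix e :: real assume "0 \<le> e"
    have "integrable N (\<lambda>w. exp (- u * D e w))"
      using u D_nonneg by (intro integrable_const_bound[where B = 1]) auto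
    then show "(\<integral>\<^sup>+w. ennreal (exp (- u * D e w)) \<partial>N) = ennreal (exp (- e * a))"
      unfolding lap[OF \<open>0 \<le> e\<close>, symmetric] by (rule nn_integral_eq_integral) simp
  qed
  also have "\<dots> = (\<integral>\<^sup>+e. ennreal (rate * exp (- (rate * e))) * ennreal (exp (- e * a)) * indicator {0<..} e \<partial>lborel)"
    using rate by (rule nn_integral_exponential) measurable
  also have "\<dots> = (\<integral>\<^sup>+e. ennreal (rate * exp (- (rate * e))) * ennreal (exp (- e * a)) * indicator {0..} e \<partial>lborel)"
    by (rule nn_integral_Ici_Ioi[symmetric])
  also have "\<dots> = (\<integral>\<^sup>+e. ennreal (rate / (rate + a)) * (ennreal ((rate + a) * exp (- ((rate + a) * e))) * indicator {0..} e) \<partial>lborel)"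
  proof (rule nn_integral_cong)
    fix e
    have "rate * exp (- (rate * e)) * exp (- e * a) = rate / (rate + a) * ((rate + a) * exp (- ((rate + a) * e)))"
    proof -
      have "exp (- (rate * e)) * exp (- e * a) = exp (- ((rate + a) * e))"
        by (simp add: algebra_simps flip: exp_add)
      moreover have "rate + a \<noteq> 0" using rate a by simp
      ultimately show ?thesis by (simp only: mult.assoc) simp
    qed
    then have "ennreal (rate * exp (- (rate * e))) * ennreal (exp (- e * a)) =
        ennreal (rate / (rate + a)) * ennreal ((rate + a) * exp (- ((rate + a) * e)))"
      using rate a by (simp flip: ennreal_mult)
    then show "ennreal (rate * exp (- (rate * e))) * ennreal (exp (- e * a)) * indicator {0..} e =
        ennreal (rate / (rate + a)) * (ennreal ((rate + a) * exp (- ((rate + a) * e))) * indicator {0..} e)"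
      by (simp add: mult.assoc[symmetric])
  qed
  also have "\<dots> = ennreal (rate / (rate + a)) *
      (\<integral>\<^sup>+e. ennreal ((rate + a) * exp (- ((rate + a) * e))) * indicator {0..} e \<partial>lborel)"
    by (rule nn_integral_cmult) measurable
  also have "\<dots> = ennreal (rate / (rate + a))"
    using rate a nn_integral_exp_rate_atLeast[of "rate + a" 0] by simp
  finally have nn: "(\<integral>\<^sup>+x. ennreal (exp (- u * x)) \<partial>at_exponential rate) = ennreal (rate / (rate + a))" .
  have "integrable (at_exponential rate) (\<lambda>x. exp (- u * x))"
    using nonneg u by (intro Q.integrable_const_bound[where B = 1]) (auto elim!: eventually_mono)
  then have "(\<integral>\<^sup>+x. ennreal (exp (- u * x)) \<partial>at_exponential rate) = ennreal (\<integral>x. exp (- u * x) \<partial>at_exponential rate)"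
    by (rule nn_integral_eq_integral) simp
  then have "ennreal (\<integral>x. exp (- u * x) \<partial>at_exponential rate) = ennreal (rate / (rate + a))"
    by (simp only: nn)
  then show "(\<integral>x. exp (- u * x) \<partial>at_exponential rate) = rate / (rate + a)"
    using rate a by (subst (asm) ennreal_inj) auto
qed

text \<open>The atoms are the partial sums of a random walk from 0, and \<open>renewal_prod\<close>
  is the expected product of h over the first m of them.\<close>

lemma pgfl_renewal_process:
  assumes pp: "point_process M \<kappa> T" and [measurable]: "h \<in> borel_measurable borel"
    and h: "\<And>x. 0 \<le> h x \<and> h x \<le> 1"
    and X: "prob_space.indep_vars M (\<lambda>_. borel) X UNIV" and F: "\<And>n. distr M borel (X n) = F"
    and pos: "\<And>n. AE w in M. 0 < X n w"
    and atoms: "AE w in M. random_measure \<kappa> T w = atom_measure \<infinity> (\<lambda>n. \<Sum>i\<le>n. X i w)"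
  shows "(\<lambda>m. renewal_prod F (\<lambda>x. ennreal (h x)) m 0) \<longlonglongrightarrow> ennreal (pgfl M \<kappa> T h)"
proof -
  interpret prob_space M using pp by (rule point_process_prob_space)
  have [measurable]: "X n \<in> borel_measurable M" for n
    using X by (simp add: indep_vars_def)
  have h_Rplus [measurable]: "h \<in> borel_measurable borel_Rplus"
    by (rule measurable_restrict_space1) measurable
  let ?S = "\<lambda>i w. \<Sum>l\<le>i. X l w"
  have "renewal_prod F (\<lambda>x. ennreal (h x)) m 0 = ennreal (\<integral>w. (\<Prod>i<m. h (?S i w)) \<partial>M)" for m
  proof -
    have "renewal_prod F (\<lambda>x. ennreal (h x)) m 0 = (\<integral>\<^sup>+w. (\<Prod>i<m. ennreal (h (0 + (\<Sum>l\<le>i. X (0 + l) w)))) \<partial>M)"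
      by (rule nn_integral_random_walk[OF X F, symmetric]) measurable
    also have "\<dots> = (\<integral>\<^sup>+w. ennreal (\<Prod>i<m. h (?S i w)) \<partial>M)"
      using h by (simp add: prod_ennreal)
    also have "\<dots> = ennreal (\<integral>w. (\<Prod>i<m. h (?S i w)) \<partial>M)"
      using h by (intro nn_integral_eq_integral integrable_const_bound[where B = 1])
        (auto simp: abs_prod intro!: prod_le_1 prod_nonneg)
    finally show ?thesis .
  qed
  moreover have "(\<lambda>m. \<integral>w. (\<Prod>i<m. h (?S i w)) \<partial>M) \<longlonglongrightarrow> pgfl M \<kappa> T h"
    unfolding pgfl_def
  proof (rule integral_dominated_convergence[where w = "\<lambda>_. 1"])
    show "(\<lambda>w. exp_neg (\<integral>\<^sup>+x. neg_ln (h x) \<partial>random_measure \<kappa> T w)) \<in> borel_measurable M"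
      by (intro measurable_compose[OF measurable_nn_integral_random_measure[OF pp]]) measurable
    show "AE w in M. norm (\<Prod>i<m. h (?S i w)) \<le> 1" for m
      using h by (auto simp: abs_prod intro!: prod_le_1)
    have "AE w in M. \<forall>n. 0 < X n w"
      using pos by (simp add: AE_all_countable)
    with atoms show "AE w in M. (\<lambda>m. \<Prod>i<m. h (?S i w)) \<longlonglongrightarrow> exp_neg (\<integral>\<^sup>+x. neg_ln (h x) \<partial>random_measure \<kappa> T w)"
    proof eventually_elim
      case (elim w)
      have "0 \<le> ?S i w" for i
        using elim(2) by (intro sum_nonneg) (simp add: less_imp_le)
      from tendsto_prod_atoms[where x = "\<lambda>i. ?S i w", OF this h_Rplus h, where k = \<infinity>] show ?case
        by (simp add: elim(1))
    qed
  qed measurable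
  ultimately show ?thesis by (simp add: tendsto_ennrealI)
qed

text \<open>Both laws are carried by the nonnegative half-line and have the transform rate / (rate +
  u powr \<beta>) for large u.\<close>

lemma mittag_leffler_law:
  assumes D: "regular_subordinator N D" and "0 < \<beta>" "0 < rate"
    and lap: "\<And>r u. 0 \<le> r \<Longrightarrow> 0 \<le> u \<Longrightarrow> (\<integral>w. exp (- u * D r w) \<partial>N) = exp (- r * u powr \<beta>)"
    and "prob_space M" and [measurable]: "X \<in> borel_measurable M"
    and tail: "\<And>t. 0 \<le> t \<Longrightarrow> measure M {w \<in> space M. t < X w} = mittag_leffler \<beta> (- rate * t powr \<beta>)"
  shows "distr M borel X = regular_subordinator.at_exponential N D rate"
proof -
  interpret D: regular_subordinator N D by fact
  interpret prob_space M by fact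
  \<comment> \<open>Chosen so that u0 powr \<beta> = rate + 1; hence rate < u powr \<beta> from u0
    on.\<close>
  define u0 where "u0 = (rate + 1) powr (1 / \<beta>)"
  have u0: "0 < u0" using \<open>0 < rate\<close> by (simp add: u0_def)
  have u0_powr: "u0 powr \<beta> = rate + 1"
    using \<open>0 < rate\<close> \<open>0 < \<beta>\<close> by (simp add: u0_def powr_powr)
  have pos: "AE w in M. 0 < X w"
    using \<open>0 < \<beta>\<close> \<open>0 < rate\<close> by (rule mittag_leffler_pos[OF _ _ _ tail]) measurable
  show ?thesis
  proof (rule laplace_transform_unique)
    show "real_distribution (distr M borel X)"
      by (rule real_distribution_distr) simp
    show "real_distribution (D.at_exponential rate)"
      using D.prob_space_at_exponential[OF \<open>0 < rate\<close>]
      by (intro real_distribution.intro real_distribution_axioms.intro)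
        (simp_all add: sets_eq_imp_space_eq[OF D.sets_at_exponential])
    show "AE x in distr M borel X. 0 \<le> x"
      using pos by (subst AE_distr_iff) (auto elim: eventually_mono)
    show "AE x in D.at_exponential rate. 0 \<le> x"
      using D.AE_at_exponential_nonneg[OF \<open>0 < rate\<close>, of 0 0] lap[of _ 0] by (simp add: D.prob_space)
    fix u assume "u0 \<le> u"
    then have "0 < u" using u0 by simp
    have "rate < u powr \<beta>"
      using powr_mono2[of \<beta> u0 u] u0 u0_powr \<open>u0 \<le> u\<close> \<open>0 < \<beta>\<close> by simp
    have "(\<integral>x. exp (- u * x) \<partial>distr M borel X) = (\<integral>w. exp (- u * X w) \<partial>M)"
      by (rule integral_distr) measurable
    also have "\<dots> = rate / (rate + u powr \<beta>)"
      using \<open>0 < \<beta>\<close> \<open>0 < rate\<close> _ tail \<open>0 < u\<close> \<open>rate < u powr \<beta>\<close> by (rule laplace_mittag_leffler) measurable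
    also have "\<dots> = (\<integral>x. exp (- u * x) \<partial>D.at_exponential rate)"
      using \<open>0 < rate\<close> \<open>0 < u\<close> by (intro D.laplace_at_exponential(1)[symmetric] lap) auto
    finally show "(\<integral>x. exp (- u * x) \<partial>distr M borel X) = (\<integral>x. exp (- u * x) \<partial>D.at_exponential rate)" .
  qed
qed

text \<open>The iterates for the walk are averages over the paths of D of the iterates along one
  path. There h (D r) plays the role of \<open>k\<close> in \<open>thinned_poisson\<close>, because
  it is 1 once D exceeds t, and the limit is explicit.\<close>

lemma (in regular_subordinator) renewal_prod_at_exponential_tendsto:
  assumes rate: "0 < rate" and [measurable]: "h \<in> borel_measurable borel"
    and h: "\<And>x. 0 \<le> h x \<and> h x \<le> 1" "\<And>x. x \<notin> {0<..t} \<Longrightarrow> h x = 1"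
  shows "(\<lambda>m. renewal_prod (at_exponential rate) (\<lambda>x. ennreal (h x)) m 0) \<longlonglongrightarrow>
    stieltjes_expectation N rate (inverse_subordinator D) t (\<lambda>x. 1 - h x)"
proof -
  let ?IM = "\<lambda>w. interval_measure (\<lambda>r. inverse_subordinator D r w)"
  let ?p = "\<lambda>m w. renewal_prod (exponential rate) (\<lambda>a. ennreal (h (D a w))) m 0"
  let ?c = "\<lambda>x. ennreal (h x)"
  have "renewal_prod (at_exponential rate) ?c m 0 =
      (\<integral>\<^sup>+w. ?p m w \<partial>N)" for m
  proof -
    have "?c \<in> borel_measurable borel" by measurable
    \<comment> \<open>With 0 as the only sampling time, the factor in front is h (D 0) = h 0 = 1,
      and the walk starts at 0.\<close>
    note nn_integral_renewal_prod_path[OF rate this, where k = 0 and r = "\<lambda>_. 0" and m = m]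
    then show ?thesis
      using h(2)[of 0] by (simp add: D_nonpos emeasure_space_1 mono_def)
  qed
  moreover have "(\<lambda>m. \<integral>\<^sup>+w. ?p m w \<partial>N) \<longlonglongrightarrow>
      stieltjes_expectation N rate (inverse_subordinator D) t (\<lambda>x. 1 - h x)"
    unfolding stieltjes_expectation_def
  proof (rule nn_integral_dominated_convergence[where w = "\<lambda>_. 1"])
    have meas: "(\<lambda>w. ?p m w) \<in> borel_measurable N" for m
      using measurable_compose[OF _ measurable_renewal_prod_path[OF rate, of ?c m], of "\<lambda>w. (0, w)" N] by simp
    then show "(\<lambda>w. ?p m w) \<in> borel_measurable N" for m .
    have lim: "(\<lambda>m. ?p m w) \<longlonglongrightarrow>
        ennreal (exp_neg (ennreal rate * (\<integral>\<^sup>+x\<in>{0<..t}. ennreal (1 - h x) \<partial>?IM w)))" for w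
    proof -
      \<comment> \<open>D b > t makes h (D x) = 1 for x \<ge> b, and D b > 0 forces b to be
        nonnegative.\<close>
      obtain b where b: "max t 0 < D b w" using D_unbounded by blast
      then have "0 \<le> b" using D_nonpos[of b w] by (cases "b \<le> 0") auto
      have [measurable]: "(\<lambda>r. D r w) \<in> borel_measurable borel"
        by (rule borel_measurable_mono) (simp add: mono_def D_mono)
      interpret thinned_poisson rate "\<lambda>r. h (D r w)" b
      proof
        show "h (D x w) = 1" if "b \<le> x" for x
          using D_mono[OF that, of w] b by (intro h(2)) auto
      qed (use rate h(1) \<open>0 \<le> b\<close> in \<open>auto\<close>)
      have IM: "?IM w =
          distr (density lborel (indicator {0<..})) borel (\<lambda>r. D r w)"
        unfolding inverse_subordinator_def
        by (rule interval_measure_inverse) (simp_all add: D_nonpos D_mono mono_def D_unbounded)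
      have "(\<integral>\<^sup>+x\<in>{0<..t}. ennreal (1 - h x) \<partial>?IM w) =
          (\<integral>\<^sup>+x. ennreal (1 - h x) \<partial>?IM w)"
        by (intro nn_integral_cong) (auto simp: indicator_def h(2))
      also have "\<dots> = (\<integral>\<^sup>+x. ennreal (1 - h (D x w)) * indicator {0<..} x \<partial>lborel)"
        unfolding IM by (subst nn_integral_distr) (auto simp: nn_integral_density mult.commute)
      finally show ?thesis
        using renewal_prod_tendsto by simp
    qed
    then show "AE w in N. (\<lambda>m. ?p m w) \<longlonglongrightarrow>
        ennreal (exp_neg (ennreal rate * (\<integral>\<^sup>+x\<in>{0<..t}. ennreal (1 - h x) \<partial>?IM w)))"
      by simp
    show "(\<lambda>w. ennreal (exp_neg (ennreal rate * (\<integral>\<^sup>+x\<in>{0<..t}. ennreal (1 - h x) \<partial>?IM w))))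
        \<in> borel_measurable N"
      using lim meas by (rule borel_measurable_LIMSEQ_order)
    show "AE w in N. ?p m w \<le> 1" for m
      using h(1) rate by (intro AE_I2 renewal_prod_le_1 prob_space_exponential_density) auto
  qed (simp_all add: emeasure_space_1)
  ultimately show ?thesis by simp
qed

lemma pgfl_fractional_poisson_process:
  assumes pp: "point_process M \<kappa> T" and \<beta>: "0 < \<beta>" and rate: "0 < rate"
    and fpp: "fractional_poisson_process M \<kappa> T \<beta> rate" and D: "stable_subordinator N \<beta> D"
    and h: "h \<in> borel_measurable borel" "\<And>x. 0 \<le> h x \<and> h x \<le> 1" "\<And>x. x \<notin> {0<..t} \<Longrightarrow> h x = 1"
  shows "ennreal (pgfl M \<kappa> T h) = stieltjes_expectation N rate (inverse_subordinator D) t (\<lambda>x. 1 - h x)"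
proof -
  interpret prob_space M using pp by (rule point_process_prob_space)
  obtain X where X: "indep_vars (\<lambda>_. borel) X UNIV"
    and tail: "\<And>n t. 0 \<le> t \<Longrightarrow> prob {w \<in> space M. t < X n w} = mittag_leffler \<beta> (- rate * t powr \<beta>)"
    and atoms: "AE w in M. random_measure \<kappa> T w = atom_measure \<infinity> (\<lambda>n. \<Sum>i\<le>n. X i w)"
    using fpp unfolding fractional_poisson_process_def by blast
  have X_meas: "X n \<in> borel_measurable M" for n
    using X by (simp add: indep_vars_def)
  obtain D' where "regular_subordinator N D'" and D': "AE w in N. \<forall>r\<ge>0. D' r w = D r w"
    using D by (rule stable_subordinator_regular)
  interpret D': regular_subordinator N D' by fact
  have lap: "(\<integral>w. exp (- u * D' r w) \<partial>N) = exp (- r * u powr \<beta>)" if "0 \<le> r" "0 \<le> u" for r u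
  proof -
    have "(\<integral>w. exp (- u * D' r w) \<partial>N) = (\<integral>w. exp (- u * D r w) \<partial>N)"
    proof (rule integral_cong_AE)
      have [measurable]: "D r \<in> borel_measurable N"
        using D \<open>0 \<le> r\<close> by (simp add: stable_subordinator_def)
      show "(\<lambda>w. exp (- u * D' r w)) \<in> borel_measurable N" "(\<lambda>w. exp (- u * D r w)) \<in> borel_measurable N"
        by measurable
      show "AE w in N. exp (- u * D' r w) = exp (- u * D r w)"
        using D' by eventually_elim (simp add: \<open>0 \<le> r\<close>)
    qed
    then show ?thesis
      using D that by (simp add: stable_subordinator_def)
  qed
  have law: "distr M borel (X n) = D'.at_exponential rate" for n
    using \<open>regular_subordinator N D'\<close> \<beta> rate lap prob_space_axioms X_meas tail by (rule mittag_leffler_law)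
  have pos: "AE w in M. 0 < X n w" for n
    using \<beta> rate X_meas tail by (rule mittag_leffler_pos)
  have "ennreal (pgfl M \<kappa> T h) = stieltjes_expectation N rate (inverse_subordinator D') t (\<lambda>x. 1 - h x)"
    using pgfl_renewal_process[OF pp h(1,2) X law pos atoms] D'.renewal_prod_at_exponential_tendsto[OF rate h]
    by (rule LIMSEQ_unique)
  also have "\<dots> = stieltjes_expectation N rate (inverse_subordinator D) t (\<lambda>x. 1 - h x)"
    unfolding stieltjes_expectation_def
  proof (rule nn_integral_cong_AE)
    show "AE w in N. ennreal (exp_neg (ennreal rate * (\<integral>\<^sup>+x\<in>{0<..t}. ennreal (1 - h x) \<partial>interval_measure (\<lambda>r. inverse_subordinator D' r w)))) =
        ennreal (exp_neg (ennreal rate * (\<integral>\<^sup>+x\<in>{0<..t}. ennreal (1 - h x) \<partial>interval_measure (\<lambda>r. inverse_subordinator D r w))))"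
      using D'
    proof eventually_elim
      case (elim w)
      \<comment> \<open>Only times r \<ge> 0 enter the infimum, and there D' and D agree.\<close>
      then have "inverse_subordinator D' r w = inverse_subordinator D r w" for r
        unfolding inverse_subordinator_def by (intro arg_cong[where f = Inf]) auto
      then show ?case by simp
    qed
  qed
  finally show ?thesis .
qed

section \<open>The process with immigration\<close>

text \<open>exp (- s) = 1 exactly when s = 0, so the conventions at \<infinity> agree too.\<close>

lemma exp_enat_eq_pow_enat: "0 \<le> s \<Longrightarrow> exp_enat s z = pow_enat (exp (- s)) z"
  by (auto simp: exp_enat_def pow_enat_def mult.commute split: enat.split simp flip: exp_of_nat_mult)

lemma laplace_process_eq_pgf_process: "laplace_process M X u s = pgf_process M X u (exp (- s))"
  by (simp add: laplace_process_def pgf_process_def mult.commute flip: exp_of_nat_mult)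

context immigration
begin

lemma h_outside: "x \<notin> {0<..t} \<Longrightarrow> h x = 1"
  by (simp only: h_def if_False)

lemma h_inside: "x \<in> {0<..t} \<Longrightarrow> h x = pgf_process P Zx (t - x) s"
  by (simp only: h_def G_def if_True)

lemma pgf_immigration_determinantal:
  assumes D: "determinantal_process M \<kappa> T \<Lambda> K"
  shows "summable (\<lambda>n. det_term \<Lambda> K {0<..t} (\<lambda>x. 1 - pgf_process P Zx (t - x) s) (Suc n)) \<and>
    (\<integral>w. pow_enat s (immigration_process \<kappa> T X t w) \<partial>M) =
    1 + (\<Sum>n. det_term \<Lambda> K {0<..t} (\<lambda>x. 1 - pgf_process P Zx (t - x) s) (Suc n))"
proof -
  have "det_term \<Lambda> K {0<..t} (\<lambda>x. 1 - pgf_process P Zx (t - x) s) n = det_term \<Lambda> K {0<..t} (\<lambda>x. 1 - h x) n" for n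
    by (rule det_term_cong) (simp only: h_inside)
  then show ?thesis
    using pgfl_determinantal_process[OF pp D borel_measurable_h_Rplus h_bounds h_outside]
    by (simp only: expectation_immigration) simp
qed

lemma pgf_immigration_cox:
  assumes "cox_process M \<kappa> T \<eta>"
  shows "(\<integral>w. pow_enat s (immigration_process \<kappa> T X t w) \<partial>M) =
    (\<integral>w. exp_neg (\<integral>\<^sup>+x\<in>{0<..t}. ennreal (1 - pgf_process P Zx (t - x) s) \<partial>\<eta> w) \<partial>M)"
proof -
  interpret cox M \<kappa> T \<eta>
    using pp assms by (rule cox.intro)
  have "(\<integral>\<^sup>+x\<in>{0<..t}. ennreal (1 - pgf_process P Zx (t - x) s) \<partial>\<eta> w) = (\<integral>\<^sup>+x. ennreal (1 - h x) \<partial>\<eta> w)" for w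
    by (rule nn_integral_cong) (metis diff_self ennreal_0 h_inside h_outside indicator_simps mult.right_neutral mult_zero_right)
  then show ?thesis
    unfolding expectation_immigration by (simp only: pgfl_cox_process[OF borel_measurable_h_Rplus h_bounds])
qed

lemma pgf_immigration_fractional_poisson:
  assumes "0 < \<beta>" "0 < rate" "fractional_poisson_process M \<kappa> T \<beta> rate" "stable_subordinator N \<beta> D"
  shows "ennreal (\<integral>w. pow_enat s (immigration_process \<kappa> T X t w) \<partial>M) =
    stieltjes_expectation N rate (inverse_subordinator D) t (\<lambda>x. 1 - pgf_process P Zx (t - x) s)"
proof -
  have "(\<integral>\<^sup>+x\<in>{0<..t}. ennreal (1 - pgf_process P Zx (t - x) s) \<partial>R) = (\<integral>\<^sup>+x\<in>{0<..t}. ennreal (1 - h x) \<partial>R)"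
    for R :: "real measure"
    by (rule nn_integral_cong) (metis h_inside indicator_simps(2) mult_zero_right)
  then show ?thesis
    unfolding expectation_immigration stieltjes_expectation_def
    using pgfl_fractional_poisson_process[OF pp assms borel_measurable_h h_bounds h_outside]
    by (simp only: stieltjes_expectation_def)
qed

end

theorem theorem4p1:
  fixes M :: "'w measure" and P :: "'p measure"
    and \<mu> :: real and I \<nu> :: "nat pmf"
    and Zx :: "real \<Rightarrow> 'p \<Rightarrow> nat" and Zxi :: "nat \<Rightarrow> real \<Rightarrow> 'w \<Rightarrow> nat"
    and \<kappa> :: "'w \<Rightarrow> enat" and T :: "nat \<Rightarrow> 'w \<Rightarrow> real" and t :: real
  assumes "\<mu> > 0"
    and "integrable (measure_pmf I) real" and "integrable (measure_pmf \<nu>) real"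
    and "\<nexists>k. \<nu> = return_pmf k"
    and "branching_process P \<mu> I \<nu> Zx"
    and "iid_branching_processes M \<mu> I \<nu> Zxi"
    and "point_process M \<kappa> T"
    and "independent_rvs M paths_space (paths Zxi) atoms_space (atoms \<kappa> T)"
    and "t \<ge> 0"
  shows
    "(\<forall>\<Lambda> K. determinantal_process M \<kappa> T \<Lambda> K \<longrightarrow>
        (\<forall>s\<in>{0..1}.
           summable (\<lambda>n. det_term \<Lambda> K {0<..t} (\<lambda>x. 1 - pgf_process P Zx (t - x) s) (Suc n)) \<and>
           (\<integral>\<omega>. pow_enat s (immigration_process \<kappa> T Zxi t \<omega>) \<partial>M) =
           1 + (\<Sum>n. det_term \<Lambda> K {0<..t} (\<lambda>x. 1 - pgf_process P Zx (t - x) s) (Suc n))) \<and>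
        (\<forall>s\<ge>0.
           summable (\<lambda>n. det_term \<Lambda> K {0<..t} (\<lambda>x. 1 - laplace_process P Zx (t - x) s) (Suc n)) \<and>
           (\<integral>\<omega>. exp_enat s (immigration_process \<kappa> T Zxi t \<omega>) \<partial>M) =
           1 + (\<Sum>n. det_term \<Lambda> K {0<..t} (\<lambda>x. 1 - laplace_process P Zx (t - x) s) (Suc n)))) \<and>
     (\<forall>\<eta>. cox_process M \<kappa> T \<eta> \<and>
        independent_rvs M paths_space (paths Zxi)
          (atoms_space \<Otimes>\<^sub>M measure_algebra borel_Rplus) (\<lambda>\<omega>. (atoms \<kappa> T \<omega>, \<eta> \<omega>)) \<longrightarrow>
        (\<forall>s\<in>{0..1}.
           (\<integral>\<omega>. pow_enat s (immigration_process \<kappa> T Zxi t \<omega>) \<partial>M) =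
           (\<integral>\<omega>. exp_neg (\<integral>\<^sup>+x\<in>{0<..t}. ennreal (1 - pgf_process P Zx (t - x) s) \<partial>\<eta> \<omega>) \<partial>M)) \<and>
        (\<forall>s\<ge>0.
           (\<integral>\<omega>. exp_enat s (immigration_process \<kappa> T Zxi t \<omega>) \<partial>M) =
           (\<integral>\<omega>. exp_neg (\<integral>\<^sup>+x\<in>{0<..t}. ennreal (1 - laplace_process P Zx (t - x) s) \<partial>\<eta> \<omega>) \<partial>M))) \<and>
     (\<forall>\<beta> rate. \<forall>(N :: 'v measure) D.
        0 < \<beta> \<and> \<beta> \<le> 1 \<and> 0 < rate \<and> fractional_poisson_process M \<kappa> T \<beta> rate \<and> stable_subordinator N \<beta> D \<longrightarrow>
        (\<forall>s\<in>{0..1}.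
           ennreal (\<integral>\<omega>. pow_enat s (immigration_process \<kappa> T Zxi t \<omega>) \<partial>M) =
           stieltjes_expectation N rate (inverse_subordinator D) t
             (\<lambda>x. 1 - pgf_process P Zx (t - x) s)) \<and>
        (\<forall>s\<ge>0.
           ennreal (\<integral>\<omega>. exp_enat s (immigration_process \<kappa> T Zxi t \<omega>) \<partial>M) =
           stieltjes_expectation N rate (inverse_subordinator D) t
             (\<lambda>x. 1 - laplace_process P Zx (t - x) s)))"
proof -
  have imm: "immigration M P \<mu> I \<nu> Zx Zxi \<kappa> T s" if "s \<in> {0..1}" for s
    using assms that by unfold_locales auto
  have mem: "exp (- s) \<in> {0..1}" if "0 \<le> s" for s :: real
    using that by simp
  note det = immigration.pgf_immigration_determinantal[OF imm]
    and cox = immigration.pgf_immigration_cox[OF imm]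
    and frac = immigration.pgf_immigration_fractional_poisson[OF imm]
  note rules = det[THEN conjunct1] det[THEN conjunct2] cox frac
    det[OF mem, THEN conjunct1] det[OF mem, THEN conjunct2] cox[OF mem] frac[OF mem]
  show ?thesis
    by (intro conjI allI impI ballI; (elim conjE)?;
        (simp only: exp_enat_eq_pow_enat laplace_process_eq_pgf_process)?; rule rules; assumption)
qed

end
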